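(* Let $P$ be a reversible and ergodic Markov transition kernel on $(\mathcal{X},\mathcal{B}(\mathcal{X}))$ with stationary probability measure $\pi$, and let $f\in L^2(\pi)$. Assume that the Kipnis–Varadhan condition $$\mathrm{Var}(f,P):=\lim_{n\to\infty} n\,\mathrm{Var}_\pi(\hat I_n)<\infty$$ holds for $f$ and $P$. Let $\mu$ be a probability distribution on the nonnegative integers and let $P_\mu:=\sum_{k=0}^\infty \mu(k)P^k$. Suppose that at least one of the following conditions holds: (i) $\mu_{\mathrm{odd}}:=\mu(\{1,3,5,\dots\})>0$; (ii) $\mu(0)<1$ and $P$ is geometrically ergodic. Then the CLT holds for $f$ and $P_\mu$, and its asymptotic variance is $$\sigma^2_{f,P_\mu}=\int_{[-1,1]}\frac{1+G_\mu(x)}{1-G_\mu(x)}\,E_{f,P}(dx)<\infty,$$ where $G_\mu(z):=\sum_{k\ge 0}\mu(k)z^k$, $|z|\le 1$, is the probability generating function of $\mu$, and $E_{f,P}$ is the spectral measure associated with $f$ and $P$.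
   Context: $P$ is a transition kernel on $(\mathcal{X},\mathcal{B}(\mathcal{X}))$; $P^k$ denotes its $k$-step iterate, $P^0=\mathrm{Id}$. Ergodic means that $\pi$ is the limiting distribution in the usual MCMC sense: $\|P^n(x,\cdot)-\pi\|_{TV}\to 0$ for $\pi$-almost every $x$. Reversible means $\pi(dx)P(x,dy)=\pi(dy)P(y,dx)$. $P$ is geometrically ergodic if there are $\rho<1$ and a $\pi$-a.e. finite function $M$ with $\|P^n(x,\cdot)-\pi\|_{TV}\le M(x)\rho^n$ for all $n$ and $\pi$-a.e. $x$. For a chain $(X_n)_{n\ge0}$ with a given kernel, $\hat I_n:=\frac1n\sum_{i=0}^{n-1}f(X_i)$ and $\pi f:=\int f\,d\pi$. $\mathrm{Var}_\pi(\hat I_n)$ is the variance of $\hat I_n$ when $X_0\sim\pi$. "The CLT holds for $f$ and a kernel $R$" (with stationary distribution $\pi$) means that for the chain with kernel $R$ (started from $X_0\sim\pi$), $\sqrt n(\hat I_n-\pi f)$ converges in distribution to $\mathcal N(0,\sigma^2_{f,R})$ with $\sigma^2_{f,R}<\infty$, the asymptotic variance. $P$ acts as a self-adjoint contraction on $L^2_0(\pi)=\{g\in L^2(\pi):\pi g=0\}$ by $Pg(x)=\int g(y)P(x,dy)$. The spectral measure $E_{f,P}$ is the finite positive measure on $[-1,1]$ such that $\langle f-\pi f,\,P^n(f-\pi f)\rangle_{L^2(\pi)}=\int_{[-1,1]}x^n\,E_{f,P}(dx)$ for all integers $n\ge0$. *)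

theory Defs
  imports "HOL-Probability.Probability"
begin

text \<open>
  The state space, with its \<open>\<sigma>\<close>-algebra, is the one carried by the probability measure \<open>\<pi>\<close>; a
  transition kernel on it is a function in \<open>\<pi> \<rightarrow>\<^sub>M prob_algebra \<pi>\<close>.
\<close>

definition reversible :: "'a measure \<Rightarrow> ('a \<Rightarrow> 'a measure) \<Rightarrow> bool" where
  "reversible \<pi> P \<longleftrightarrow>
     do {x \<leftarrow> \<pi>; y \<leftarrow> P x; return (\<pi> \<Otimes>\<^sub>M \<pi>) (x, y)} =
     do {y \<leftarrow> \<pi>; x \<leftarrow> P y; return (\<pi> \<Otimes>\<^sub>M \<pi>) (x, y)}"

primrec kernel_pow :: "'a measure \<Rightarrow> ('a \<Rightarrow> 'a measure) \<Rightarrow> nat \<Rightarrow> 'a \<Rightarrow> 'a measure" where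
  "kernel_pow \<pi> P 0 x = return \<pi> x"
| "kernel_pow \<pi> P (Suc k) x = kernel_pow \<pi> P k x \<bind> P"

text \<open>The kernel \<open>P\<^sub>\<mu> = (\<Sum>k. \<mu>(k) P\<^sup>k)\<close>.\<close>

definition kernel_mix :: "'a measure \<Rightarrow> nat pmf \<Rightarrow> ('a \<Rightarrow> 'a measure) \<Rightarrow> 'a \<Rightarrow> 'a measure" where
  "kernel_mix \<pi> \<mu> P x = measure_pmf \<mu> \<bind> (\<lambda>k. kernel_pow \<pi> P k x)"

definition tv_dist :: "'a measure \<Rightarrow> 'a measure \<Rightarrow> real" where
  "tv_dist M N = (SUP A\<in>sets M. \<bar>measure M A - measure N A\<bar>)"

definition ergodic_kernel :: "'a measure \<Rightarrow> ('a \<Rightarrow> 'a measure) \<Rightarrow> bool" where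
  "ergodic_kernel \<pi> P \<longleftrightarrow> (AE x in \<pi>. (\<lambda>n. tv_dist (kernel_pow \<pi> P n x) \<pi>) \<longlonglongrightarrow> 0)"

definition geometrically_ergodic :: "'a measure \<Rightarrow> ('a \<Rightarrow> 'a measure) \<Rightarrow> bool" where
  "geometrically_ergodic \<pi> P \<longleftrightarrow>
     (\<exists>\<rho> (M :: 'a \<Rightarrow> ennreal). 0 \<le> \<rho> \<and> \<rho> < 1 \<and> (AE x in \<pi>. M x < \<infinity>) \<and>
        (AE x in \<pi>. \<forall>n. ennreal (tv_dist (kernel_pow \<pi> P n x) \<pi>) \<le> M x * ennreal (\<rho> ^ n)))"

text \<open>
  The law, on the space of trajectories, of the chain with kernel \<open>R\<close> started from \<open>\<pi>\<close>: the
  Ionescu-Tulcea measure in which the conditional law of the state at time \<open>n\<close> given the past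
  \<open>\<omega>\<close> on \<open>{0..<n}\<close> is \<open>chain_step \<pi> R n \<omega>\<close>.
\<close>

definition chain_step :: "'a measure \<Rightarrow> ('a \<Rightarrow> 'a measure) \<Rightarrow> nat \<Rightarrow> (nat \<Rightarrow> 'a) \<Rightarrow> 'a measure" where
  "chain_step \<pi> R n \<omega> = (if n = 0 then \<pi> else R (\<omega> (n - 1)))"

definition chain_law :: "'a measure \<Rightarrow> ('a \<Rightarrow> 'a measure) \<Rightarrow> (nat \<Rightarrow> 'a) measure" where
  "chain_law \<pi> R =
     projective_family.lim UNIV (Ionescu_Tulcea.CI (chain_step \<pi> R) (\<lambda>_. \<pi>)) (\<lambda>_. \<pi>)"

lemma Ionescu_Tulcea_chain_step:
  fixes \<pi> :: "'a measure"
  assumes "prob_space \<pi>" and R: "R \<in> \<pi> \<rightarrow>\<^sub>M prob_algebra \<pi>"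
  shows "Ionescu_Tulcea (chain_step \<pi> R) (\<lambda>_. \<pi>)"
proof (rule Ionescu_Tulcea.intro)
  interpret prob_space \<pi> by fact
  fix i
  show "chain_step \<pi> R i \<in> Pi\<^sub>M {0..<i} (\<lambda>_. \<pi>) \<rightarrow>\<^sub>M subprob_algebra \<pi>"
  proof (cases "i = 0")
    case True
    then show ?thesis
      by (simp add: chain_step_def[abs_def] space_subprob_algebra subprob_space_axioms)
  next
    case False
    then have "(\<lambda>\<omega>. R (\<omega> (i - 1))) \<in> Pi\<^sub>M {0..<i} (\<lambda>_. \<pi>) \<rightarrow>\<^sub>M subprob_algebra \<pi>"
      by (intro measurable_compose[OF _ measurable_prob_algebraD[OF R]] measurable_component_singleton) auto
    with False show ?thesis
      by (simp add: chain_step_def[abs_def])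
  qed
next
  interpret prob_space \<pi> by fact
  fix i and x :: "nat \<Rightarrow> 'a" assume "x \<in> space (Pi\<^sub>M {0..<i} (\<lambda>_. \<pi>))"
  then have "i \<noteq> 0 \<Longrightarrow> x (i - 1) \<in> space \<pi>"
    by (auto simp: space_PiM PiE_iff)
  then show "prob_space (chain_step \<pi> R i x)"
    using measurable_space[OF R] prob_space_axioms by (auto simp: chain_step_def space_prob_algebra)
qed

text \<open>The law of the first \<open>n + 1\<close> states arises from that of the first \<open>n\<close> by one step.\<close>

lemma distr_chain_law:
  fixes \<pi> :: "'a measure" and L :: "nat \<Rightarrow> (nat \<Rightarrow> 'a) measure"
  assumes "prob_space \<pi>" "R \<in> \<pi> \<rightarrow>\<^sub>M prob_algebra \<pi>"
  defines "L n \<equiv> distr (chain_law \<pi> R) (Pi\<^sub>M {0..<n} (\<lambda>_. \<pi>)) (\<lambda>\<omega>. restrict \<omega> {0..<n})"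
  shows "prob_space (chain_law \<pi> R)"
    and "L 0 = return (Pi\<^sub>M {} (\<lambda>_. \<pi>)) (\<lambda>_. undefined)"
    and "L (Suc n) = L n \<bind>
           (\<lambda>\<omega>. distr (chain_step \<pi> R n \<omega>) (Pi\<^sub>M {0..<Suc n} (\<lambda>_. \<pi>)) (fun_upd \<omega> n))"
proof -
  interpret Ionescu_Tulcea "chain_step \<pi> R" "\<lambda>_. \<pi>"
    using assms(1,2) by (rule Ionescu_Tulcea_chain_step)
  have up: "up_to {0..<n} = n" for n
    unfolding up_to_def by (rule Least_equality) (auto simp: not_less[symmetric])
  have sets_C: "sets (C 0 n (\<lambda>_. undefined)) = sets (Pi\<^sub>M {0..<n} (\<lambda>_. \<pi>))" for n
    using sets_C[of "\<lambda>_. undefined" 0 n] by (simp add: space_PiM)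
  have L: "L n = C 0 n (\<lambda>_. undefined)" for n
  proof -
    have "L n = distr (C 0 n (\<lambda>_. undefined)) (Pi\<^sub>M {0..<n} (\<lambda>_. \<pi>)) (\<lambda>f. restrict f {0..<n})"
      unfolding L_def chain_law_def by (subst distr_lim) (simp_all add: CI_def up)
    also have "\<dots> = distr (C 0 n (\<lambda>_. undefined)) (C 0 n (\<lambda>_. undefined)) (\<lambda>x. x)"
      using sets_eq_imp_space_eq[OF sets_C]
      by (intro distr_cong) (auto simp: sets_C space_PiM PiE_restrict)
    finally show ?thesis by simp
  qed
  show "L 0 = return (Pi\<^sub>M {} (\<lambda>_. \<pi>)) (\<lambda>_. undefined)"
    by (simp add: L)
  show "L (Suc n) = L n \<bind>
      (\<lambda>\<omega>. distr (chain_step \<pi> R n \<omega>) (Pi\<^sub>M {0..<Suc n} (\<lambda>_. \<pi>)) (fun_upd \<omega> n))"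
    by (simp add: L eP_def[abs_def])
  have "prob_space (L 0)"
    by (simp add: L prob_space_return space_PiM)
  then show "prob_space (chain_law \<pi> R)"
    unfolding L_def by (rule prob_space_distrD[rotated])
      (auto simp: chain_law_def measurable_cong_sets[OF PF.sets_lim refl] intro!: measurable_restrict_subset)
qed

definition ergodic_avg :: "('a \<Rightarrow> real) \<Rightarrow> nat \<Rightarrow> (nat \<Rightarrow> 'a) \<Rightarrow> real" where
  "ergodic_avg f n \<omega> = (\<Sum>i<n. f (\<omega> i)) / real n"

definition var_avg :: "'a measure \<Rightarrow> ('a \<Rightarrow> 'a measure) \<Rightarrow> ('a \<Rightarrow> real) \<Rightarrow> nat \<Rightarrow> real" where
  "var_avg \<pi> R f n = prob_space.variance (chain_law \<pi> R) (ergodic_avg f n)"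

text \<open>\<open>convergent\<close> for real sequences means that the limit exists and is finite.\<close>

definition kipnis_varadhan :: "'a measure \<Rightarrow> ('a \<Rightarrow> 'a measure) \<Rightarrow> ('a \<Rightarrow> real) \<Rightarrow> bool" where
  "kipnis_varadhan \<pi> P f \<longleftrightarrow> convergent (\<lambda>n. real n * var_avg \<pi> P f n)"

text \<open>
  The law \<open>N(0,v)\<close>, as an image of \<open>N(0,1)\<close> so that the case \<open>v = 0\<close> is the point mass at \<open>0\<close>
  (\<open>normal_density 0 0\<close> is constantly \<open>0\<close>).
\<close>

definition centered_normal :: "real \<Rightarrow> real measure" where
  "centered_normal v = distr std_normal_distribution borel (\<lambda>x. sqrt v * x)"

definition clt_holds :: "'a measure \<Rightarrow> ('a \<Rightarrow> 'a measure) \<Rightarrow> ('a \<Rightarrow> real) \<Rightarrow> real \<Rightarrow> bool" where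
  "clt_holds \<pi> R f v \<longleftrightarrow> 0 \<le> v \<and>
     weak_conv_m
       (\<lambda>n. distr (chain_law \<pi> R) borel (\<lambda>\<omega>. sqrt (real n) * (ergodic_avg f n \<omega> - (\<integral>x. f x \<partial>\<pi>))))
       (centered_normal v)"

definition kernel_op :: "('a \<Rightarrow> 'a measure) \<Rightarrow> ('a \<Rightarrow> real) \<Rightarrow> 'a \<Rightarrow> real" where
  "kernel_op P g x = (\<integral>y. g y \<partial>P x)"

definition is_spectral_measure ::
  "'a measure \<Rightarrow> ('a \<Rightarrow> 'a measure) \<Rightarrow> ('a \<Rightarrow> real) \<Rightarrow> real measure \<Rightarrow> bool" where
  "is_spectral_measure \<pi> P f E \<longleftrightarrow>
     finite_measure E \<and> sets E = sets (restrict_space borel {-1..1}) \<and>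
     (let g = (\<lambda>x. f x - (\<integral>y. f y \<partial>\<pi>)) in
      \<forall>n. (\<integral>x. g x * (kernel_op P ^^ n) g x \<partial>\<pi>) = (\<integral>x. x ^ n \<partial>E))"

definition spectral_measure :: "'a measure \<Rightarrow> ('a \<Rightarrow> 'a measure) \<Rightarrow> ('a \<Rightarrow> real) \<Rightarrow> real measure" where
  "spectral_measure \<pi> P f = (THE E. is_spectral_measure \<pi> P f E)"

definition pgf :: "nat pmf \<Rightarrow> real \<Rightarrow> real" where
  "pgf \<mu> z = (\<Sum>k. pmf \<mu> k * z ^ k)"

end

theory Submission
  imports Defs "HOL-Computational_Algebra.Polynomial" "HOL-Real_Asymp.Real_Asymp"
begin

text \<open>
  Write \<open>g = f - \<pi> f\<close>, \<open>R = P\<^sub>\<mu>\<close> and \<open>S\<^sub>n = (\<Sum>i<n. g (X\<^sub>i))\<close> for the chain with kernel \<open>R\<close>. The operator \<open>R\<close> is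
  the power series \<open>G\<^sub>\<mu>\<close> in the self-adjoint contraction \<open>P\<close>, so it is itself a self-adjoint
  contraction, and the spectral measure of \<open>g\<close> for \<open>R\<close> is the image of \<open>E\<close>, the one for \<open>P\<close>, under \<open>G\<^sub>\<mu>\<close>
  (\<open>spectral_kernel_mix\<close>). Everything thus reduces to two statements: a central limit theorem for a
  reversible kernel in terms of the spectral measure of \<open>g\<close>, and a bound on \<open>1 / (1 - G\<^sub>\<mu>)\<close> in \<open>L\<^sup>1(E)\<close>.

  \<^bold>\<open>Spectral measures.\<close> On polynomials, \<open>p \<mapsto> \<langle>h, p(K) h\<rangle>\<close> is a linear functional, and it is nonnegative
  on the products \<open>(1 + x)\<^sup>a (1 - x)\<^sup>b\<close> because \<open>K\<close> is a self-adjoint contraction. The Hausdorff moment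
  problem (\<open>hausdorff_moment\<close>) turns it into a measure on \<open>[-1, 1]\<close> (\<open>spectral_measure_exists\<close>); the
  measure is unique since its characteristic function is determined by the moments. Every second
  moment of \<open>S\<^sub>n\<close> becomes an integral: \<open>E[S\<^sub>n\<^sup>2] / n = \<integral> T\<^sub>n dE\<close>, where \<open>T\<^sub>n(x)\<close> is the sum of \<open>x\<^bsup>|i - j|\<^esup>\<close> over
  all \<open>i, j < n\<close>, divided by \<open>n\<close> (\<open>toeplitz\<close>). The identity \<open>(1 - x) T\<^sub>n(x) = 1 + x - 2 x a\<^sub>n(x)\<close>, with
  \<open>a\<^sub>n(x)\<close> the mean of \<open>1, x, \<dots>, x\<^bsup>n-1\<^esup>\<close>, gives both the limit \<open>(1 + x) / (1 - x)\<close> and the domination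
  \<open>T\<^sub>n(x) \<le> 4 / (1 - x)\<close>.

  \<^bold>\<open>The central limit theorem\<close> (\<open>clt_of_spectral\<close>). Let \<open>E\<close> now be the spectral measure of \<open>g\<close> for the
  kernel of the chain, with \<open>1 / (1 - x)\<close> in \<open>L\<^sup>1(E)\<close>. With \<open>A\<^sub>N\<close> the mean of \<open>1, R, \<dots>, R\<^bsup>N-1\<^esup>\<close>, the function
  \<open>g - A\<^sub>N g\<close> is a coboundary \<open>(1 - R) u\<close> with \<open>u\<close> in \<open>L\<^sup>2\<close>, and the variance of \<open>S\<^sub>n(A\<^sub>N g) / \<surd>n\<close> is at most
  \<open>\<integral> 4 a\<^sub>N\<^sup>2 / (1 - x) dE\<close>, which tends to \<open>0\<close> as \<open>N\<close> grows. Truncating \<open>u\<close> costs little, as the variance of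
  \<open>S\<^sub>n((1 - R) v) / \<surd>n\<close> is at most \<open>8 \<parallel>v\<parallel>\<^sup>2\<close>. So \<open>S\<^sub>n / \<surd>n\<close> is, uniformly in \<open>n\<close>, close in \<open>L\<^sup>2\<close> to
  \<open>S\<^sub>n((1 - R) u) / \<surd>n\<close> for a bounded \<open>u\<close> (\<open>approx_bounded_coboundary\<close>). The latter is, up to a bounded
  term, a sum of the martingale differences \<open>u(X\<^sub>k\<^sub>+\<^sub>1) - R u(X\<^sub>k)\<close>, whose characteristic function is
  computed by telescoping (\<open>bounded_martingale_char_estimate\<close>, \<open>char_coboundary_tendsto\<close>). The
  fluctuation of the conditional variances averages out by the mean ergodic theorem, which in
  spectral terms says that spectral measures of bounded centred functions have no atom at \<open>1\<close>.

  \<^bold>\<open>The hypotheses.\<close> Convergence in total variation makes \<open>\<parallel>P\<^sup>n w\<parallel>\<close> tend to \<open>0\<close> for bounded centred \<open>w\<close>, so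
  their spectral measures for \<open>P\<close> do not charge \<open>1\<close> and \<open>-1\<close>; as \<open>\<mu>(0) < 1\<close>, \<open>G\<^sub>\<mu> = 1\<close> is only possible at
  these points, so the spectral measures for \<open>R\<close> have no atom at \<open>1\<close> (\<open>mean_ergodic_kernel_mix\<close>). By
  Fatou's lemma the Kipnis-Varadhan condition makes \<open>1 / (1 - x)\<close> integrable
  (\<open>kipnis_varadhan_integrable\<close>). Finally \<open>1 - G\<^sub>\<mu>(x) \<ge> \<mu>(m) (1 - x\<^sup>m)\<close> for all \<open>m\<close>. If some odd \<open>m\<close> has
  positive mass, the right-hand side is bounded below by a multiple of \<open>min 1 (1 - x)\<close>; if \<open>P\<close> is
  geometrically ergodic, \<open>E\<close> lives on a smaller interval \<open>[-r, r]\<close> (\<open>geometric_spectral_support\<close>), and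
  any \<open>m > 0\<close> of positive mass will do (\<open>pgf_gap\<close>).
\<close>

section \<open>The Hausdorff moment problem\<close>

lemma borel_measurable_poly [measurable]: "poly (p :: real poly) \<in> borel_measurable borel"
  by (intro borel_measurable_continuous_onI continuous_intros)

lemma linear_functional_poly_eq_sum:
  fixes L :: "real poly \<Rightarrow> real"
  assumes add: "\<And>p q. L (p + q) = L p + L q" and smult: "\<And>a p. L (smult a p) = a * L p"
  shows "L (\<Sum>i\<in>I. smult (a i) (p i)) = (\<Sum>i\<in>I. a i * L (p i))"
proof -
  have "L 0 = 0" using smult[of 0 0] by simp
  then show ?thesis
    by (induction I rule: infinite_finite_induct) (simp_all add: add smult)
qed

text \<open>
  The factorial moments of the binomial distribution, as an identity of polynomials in \<open>x\<close>. Unlike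
  the powers, binomial coefficients are reproduced exactly by the Bernstein weights.
\<close>

lemma binomial_sum_choose_poly:
  fixes x :: "'a :: comm_ring_1"
  assumes "j \<le> n"
  shows "(\<Sum>k\<le>n. of_nat ((n choose k) * (k choose j)) * (x ^ k * (1 - x) ^ (n - k))) = of_nat (n choose j) * x ^ j"
proof -
  have "(\<Sum>k\<le>n. of_nat ((n choose k) * (k choose j)) * (x ^ k * (1 - x) ^ (n - k))) =
        (\<Sum>k\<in>{j..n}. of_nat ((n choose k) * (k choose j)) * (x ^ k * (1 - x) ^ (n - k)))"
    by (intro sum.mono_neutral_right) (auto simp: binomial_eq_0)
  also have "\<dots> = (\<Sum>k\<in>{j..n}. of_nat ((n choose j) * ((n - j) choose (k - j))) * (x ^ k * (1 - x) ^ (n - k)))"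
    by (intro sum.cong refl) (use assms in \<open>simp add: choose_mult del: of_nat_mult\<close>)
  also have "\<dots> = (\<Sum>l\<le>n-j. of_nat ((n choose j) * ((n - j) choose l)) * (x ^ (l+j) * (1 - x) ^ (n - j - l)))"
    by (rule sum.reindex_bij_witness[where i="\<lambda>l. l + j" and j="\<lambda>k. k - j"]) (use assms in auto)
  also have "\<dots> = of_nat (n choose j) * x ^ j * (\<Sum>l\<le>n-j. of_nat ((n - j) choose l) * x ^ l * (1 - x) ^ (n - j - l))"
    by (simp add: sum_distrib_left power_add mult_ac)
  also have "(\<Sum>l\<le>n-j. of_nat ((n - j) choose l) * x ^ l * (1 - x) ^ (n - j - l)) = (x + (1 - x)) ^ (n - j)"
    by (rule binomial_ring[symmetric])
  finally show ?thesis by simp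
qed

text \<open>
  The ratio is the product of the \<open>j\<close> factors \<open>(k - i) / (n - i)\<close>, each of which differs from \<open>k / n\<close> by
  at most \<open>j / (n - j)\<close>. The bound is uniform in \<open>k\<close>, which is what the moment problem needs.
\<close>

lemma binomial_ratio_approx_power:
  assumes "k \<le> n" "2 * j < n"
  shows "\<bar>real (k choose j) / real (n choose j) - (real k / real n) ^ j\<bar> \<le> real j * real j / (real n - real j)"
proof -
  define z where "z i = (real k - real i) / (real n - real i)" for i
  have "(\<Prod>i<j. z i) = real (k choose j) / real (n choose j)"
    by (simp add: z_def prod_dividef binomial_gbinomial gbinomial_prod_rev atLeast0LessThan)
  moreover have "(\<Prod>i<j. real k / real n) = (real k / real n) ^ j"
    by simp
  moreover have "norm ((\<Prod>i<j. z i) - (\<Prod>i<j. real k / real n)) \<le> (\<Sum>i<j. norm (z i - real k / real n))"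
    using assms by (intro norm_prod_diff) (auto simp: z_def abs_le_iff field_simps)
  moreover have "norm (z i - real k / real n) \<le> real j / (real n - real j)" if "i < j" for i
  proof -
    have pos: "real n > 0" "real n - real i > 0" "real n - real j > 0" using assms that by auto
    have "z i - real k / real n = - (real i / (real n - real i)) * ((real n - real k) / real n)"
      using pos by (simp add: z_def divide_simps) (simp add: algebra_simps)
    then have "norm (z i - real k / real n) = real i / (real n - real i) * ((real n - real k) / real n)"
      using pos assms by (simp add: abs_mult)
    also have "\<dots> \<le> real i / (real n - real i) * 1"
      using pos assms by (intro mult_left_mono) auto
    also have "\<dots> \<le> real j / (real n - real j)"
      using pos that by (auto intro!: frac_le)
    finally show ?thesis .
  qed
  then have "(\<Sum>i<j. norm (z i - real k / real n)) \<le> (\<Sum>i<j. real j / (real n - real j))"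
    by (intro sum_mono) auto
  ultimately show ?thesis by simp
qed

text \<open>
  The measure is a weak limit of discrete measures: at level \<open>n\<close>, the point \<open>k / n\<close> carries the value
  of \<open>L\<close> at the \<open>k\<close>-th Bernstein polynomial, which is nonnegative by hypothesis. All of them live on
  \<open>[0, 1]\<close>, so Helly's theorem applies, and the two lemmas above identify the moments of the limit.
\<close>

lemma hausdorff_moment:
  fixes L :: "real poly \<Rightarrow> real"
  assumes add: "\<And>p q. L (p + q) = L p + L q" and smult: "\<And>a p. L (smult a p) = a * L p"
    and nonneg: "\<And>k m. 0 \<le> L ([:0, 1:] ^ k * [:1, -1:] ^ m)"
  shows "\<exists>M. finite_measure M \<and> sets M = sets borel \<and> (AE x in M. 0 \<le> x \<and> x \<le> 1) \<and>
             (\<forall>p. integrable M (poly p)) \<and> (\<forall>p. L p = (\<integral>x. poly p x \<partial>M))"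
proof -
  note L_sum = linear_functional_poly_eq_sum[of L, OF add smult]
  have L_pow: "L p = (\<Sum>i\<le>degree p. coeff p i * L ([:0, 1:] ^ i))" for p
  proof -
    have "p = (\<Sum>i\<le>degree p. smult (coeff p i) ([:0, 1:] ^ i))"
      using poly_as_sum_of_monoms[of p] by (simp add: monom_altdef)
    then show ?thesis using L_sum[where I="{..degree p}" and a="coeff p" and p="\<lambda>i. [:0, 1:] ^ i"] by metis
  qed
  have one_minus: "[:1, -1:] = 1 - [:0, 1::real:]" by (simp add: one_pCons)
  define m where "m = L 1"
  show ?thesis
  proof (cases "m = 0")
    case True
    have "L ([:0, 1:] ^ k) = 0" for k
    proof -
      have "L ([:0, 1:] ^ k) \<le> 0"
      proof (induction k)
        case (Suc k)
        have "[:0, 1::real:] ^ k = [:0, 1:] ^ k * [:1, -1:] ^ 1 + [:0, 1:] ^ Suc k"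
          unfolding one_minus by (simp add: algebra_simps)
        then have "L ([:0, 1:] ^ k) = L ([:0, 1:] ^ k * [:1, -1:] ^ 1) + L ([:0, 1:] ^ Suc k)"
          by (metis add)
        with nonneg[of k 1] Suc show ?case by linarith
      qed (use True m_def in simp)
      with nonneg[of k 0] show ?thesis by simp
    qed
    then have "L p = 0" for p by (subst L_pow) simp
    moreover have "AE x in null_measure borel. 0 \<le> x \<and> x \<le> (1::real)"
      by (rule AE_I[where N=UNIV]) auto
    moreover have "finite_measure (null_measure (borel :: real measure))"
      by (rule finite_measureI) simp
    moreover have "integrable (null_measure borel) (poly p)" "(\<integral>x. poly p x \<partial>null_measure borel) = 0" for p :: "real poly"
      by simp_all
    ultimately show ?thesis
      by (intro exI[of _ "null_measure borel"]) (auto simp: sets_null_measure)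
  next
    case False
    with nonneg[of 0 0] have m: "m > 0" by (simp add: m_def)
    define W where "W n k = real (n choose k) * L ([:0, 1:] ^ k * [:1, -1:] ^ (n - k)) / m" for n k
    have W0: "W n k \<ge> 0" for n k
      using nonneg m by (simp add: W_def)
    have W_choose: "(\<Sum>k\<le>n. W n k * real (k choose j)) = real (n choose j) * L ([:0, 1:] ^ j) / m" if "j \<le> n" for n j
    proof -
      have "(\<Sum>k\<le>n. W n k * real (k choose j)) * m = (\<Sum>k\<le>n. real ((n choose k) * (k choose j)) * L ([:0, 1:] ^ k * [:1, -1:] ^ (n - k)))"
        using m by (simp add: W_def sum_distrib_right sum_distrib_left mult_ac)
      also have "\<dots> = L (\<Sum>k\<le>n. smult (real ((n choose k) * (k choose j))) ([:0, 1:] ^ k * [:1, -1:] ^ (n - k)))"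
        by (rule L_sum[symmetric])
      also have "(\<Sum>k\<le>n. smult (real ((n choose k) * (k choose j))) ([:0, 1:] ^ k * [:1, -1:] ^ (n - k))) =
                 of_nat (n choose j) * [:0, 1:] ^ j"
        using binomial_sum_choose_poly[OF that, of "[:0, 1::real:]"]
        by (simp add: one_minus of_nat_poly del: of_nat_mult)
      also have "\<dots> = smult (real (n choose j)) ([:0, 1:] ^ j)"
        by (simp add: of_nat_poly)
      finally show ?thesis using m by (simp add: smult field_simps)
    qed
    have W_sum: "(\<Sum>k\<le>n. W n k) = 1" for n
      using W_choose[of 0 n] m by (simp add: m_def)
    define N where "N n = distr (point_measure {..n} (W n)) borel (\<lambda>k. real k / real n)" for n
    have N_int: "(\<integral>x. h x \<partial>N n) = (\<Sum>k\<le>n. W n k * h (real k / real n))"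
      if [measurable]: "h \<in> borel_measurable borel" for h :: "real \<Rightarrow> real" and n
      unfolding N_def by (subst integral_distr) (simp_all add: lebesgue_integral_point_measure_finite W0 measurable_point_measure_eq1)
    have N_01: "AE x in N n. 0 \<le> x \<and> x \<le> 1" for n
      unfolding N_def
      by (subst AE_distr_iff) (auto simp: measurable_point_measure_eq1 AE_point_measure divide_le_eq)
    have N_rd: "real_distribution (N n)" for n
    proof -
      have "prob_space (point_measure {..n} (W n))"
        by (intro prob_spaceI) (simp add: space_point_measure emeasure_point_measure_finite sum_nonneg W0 W_sum)
      then show ?thesis
        unfolding N_def by (intro prob_space.real_distribution_distr) (auto simp: measurable_point_measure_eq1)
    qed
    have "tight N"
      unfolding tight_def
    proof (intro conjI allI impI N_rd)
      fix e :: real assume "e > 0"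
      have "measure (N n) {-1<..1} = 1" for n
      proof -
        interpret N: real_distribution "N n" by (rule N_rd)
        have "AE x in N n. x \<in> {-1<..1}" using N_01[of n] by eventually_elim auto
        then show ?thesis by (subst N.prob_eq_1) auto
      qed
      with \<open>e > 0\<close> show "\<exists>a b. a < b \<and> (\<forall>n. measure (N n) {a<..b} > 1 - e)"
        by (intro exI[of _ "-1"] exI[of _ 1]) auto
    qed
    from tight_imp_convergent_subsubsequence[OF this strict_mono_id]
    obtain r M where r: "strict_mono (r :: nat \<Rightarrow> nat)" and M: "real_distribution M"
      and conv: "weak_conv_m (N \<circ> id \<circ> r) M" by blast
    interpret M: real_distribution M by (rule M)
    \<comment> \<open>Weak convergence tests bounded functions only; precomposing with the retraction onto \<open>[0, 1]\<close>
      makes the powers bounded without changing any of the integrals.\<close>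
    define clip :: "real \<Rightarrow> real" where "clip x = max 0 (min 1 x)" for x
    have clip01: "0 \<le> clip x" "clip x \<le> 1" for x by (auto simp: clip_def)
    have clip_meas [measurable]: "clip \<in> borel_measurable borel"
      unfolding clip_def[abs_def] by measurable
    have lim: "(\<lambda>n. \<integral>x. h x \<partial>N (r n)) \<longlonglongrightarrow> (\<integral>x. h x \<partial>M)"
      if "\<And>x. isCont h x" "\<And>x. \<bar>h x\<bar> \<le> B" for h :: "real \<Rightarrow> real" and B
    proof -
      have "(\<lambda>n. \<integral>x. h x \<partial>(N \<circ> id \<circ> r) n) \<longlonglongrightarrow> (\<integral>x. h x \<partial>M)"
        using that by (intro weak_conv_imp_integral_bdd_continuous_conv[OF _ M conv, where B=B]) (auto intro: N_rd)
      then show ?thesis by simp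
    qed
    have M_01: "AE x in M. 0 \<le> x \<and> x \<le> 1"
    proof -
      define h :: "real \<Rightarrow> real" where "h x = min 1 \<bar>x - clip x\<bar>" for x
      have [measurable]: "h \<in> borel_measurable borel" unfolding h_def[abs_def] by measurable
      have lim_h: "(\<lambda>n. \<integral>x. h x \<partial>N (r n)) \<longlonglongrightarrow> (\<integral>x. h x \<partial>M)"
        unfolding h_def[abs_def] clip_def[abs_def] by (rule lim[of _ 1]) (auto intro!: continuous_intros)
      have N_h: "(\<integral>x. h x \<partial>N n) = 0" for n
      proof -
        have "(\<integral>x. h x \<partial>N n) = (\<integral>x. 0 \<partial>N n)"
        proof (rule integral_cong_AE)
          show "h \<in> borel_measurable (N n)" by (simp add: N_def)
          show "AE x in N n. h x = 0" using N_01[of n] by eventually_elim (auto simp: h_def clip_def)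
        qed simp
        then show ?thesis by simp
      qed
      have "(\<integral>x. h x \<partial>M) = 0"
        by (rule LIMSEQ_unique[OF lim_h[unfolded N_h] tendsto_const])
      moreover have "integrable M h"
        by (rule M.integrable_const_bound[where B=1]) (auto simp: h_def)
      ultimately have "AE x in M. h x = 0"
        by (subst (asm) integral_nonneg_eq_0_iff_AE) (auto simp: h_def)
      then show ?thesis by eventually_elim (auto simp: h_def clip_def split: if_splits)
    qed
    have mom: "(\<integral>x. x ^ j \<partial>M) = L ([:0, 1:] ^ j) / m" for j
    proof -
      have 1: "(\<integral>x. x ^ j \<partial>M) = (\<integral>x. clip x ^ j \<partial>M)"
      proof (rule integral_cong_AE)
        show "AE x in M. x ^ j = clip x ^ j" using M_01 by eventually_elim (simp add: clip_def)
      qed simp_all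
      have 2: "(\<lambda>n. \<integral>x. clip x ^ j \<partial>N (r n)) \<longlonglongrightarrow> (\<integral>x. clip x ^ j \<partial>M)"
        by (rule lim[of "\<lambda>x. clip x ^ j" 1]) (auto simp: clip_def power_le_one intro!: continuous_intros)
      have 3: "(\<integral>x. clip x ^ j \<partial>N n) = (\<Sum>k\<le>n. W n k * (real k / real n) ^ j)" for n
      proof -
        have "clip (real k / real n) = real k / real n" if "k \<le> n" for k
        proof -
          have "real k / real n \<le> 1" using that by (simp add: divide_le_eq)
          then show ?thesis by (simp add: clip_def)
        qed
        then show ?thesis by (subst N_int) simp_all
      qed
      have 4: "(\<lambda>n. (\<Sum>k\<le>n. W n k * (real k / real n) ^ j)) \<longlonglongrightarrow> L ([:0, 1:] ^ j) / m"
      proof (rule Lim_transform2)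
        show "(\<lambda>n. L ([:0, 1:] ^ j) / m) \<longlonglongrightarrow> L ([:0, 1:] ^ j) / m" by simp
        have "(\<lambda>n. real j * real j / (real n - real j)) \<longlonglongrightarrow> 0"
          by real_asymp
        moreover have "\<forall>\<^sub>F n in sequentially. norm (L ([:0, 1:] ^ j) / m - (\<Sum>k\<le>n. W n k * (real k / real n) ^ j))
                 \<le> real j * real j / (real n - real j)"
        proof (rule eventually_sequentiallyI[of "2 * j + 1"])
          fix n assume n: "2 * j + 1 \<le> n"
          then have "real (n choose j) > 0" by simp
          then have "L ([:0, 1:] ^ j) / m = (\<Sum>k\<le>n. W n k * real (k choose j)) / real (n choose j)"
            using n by (subst W_choose) auto
          also have "\<dots> = (\<Sum>k\<le>n. W n k * (real (k choose j) / real (n choose j)))"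
            by (simp add: sum_divide_distrib)
          finally have "norm (L ([:0, 1:] ^ j) / m - (\<Sum>k\<le>n. W n k * (real k / real n) ^ j)) =
              norm (\<Sum>k\<le>n. W n k * (real (k choose j) / real (n choose j) - (real k / real n) ^ j))"
            by (simp add: sum_subtractf algebra_simps)
          also have "\<dots> \<le> (\<Sum>k\<le>n. W n k * (real j * real j / (real n - real j)))"
            unfolding real_norm_def
          proof (rule order_trans[OF sum_abs], intro sum_mono)
            fix k assume "k \<in> {..n}"
            then have "\<bar>real (k choose j) / real (n choose j) - (real k / real n) ^ j\<bar> \<le> real j * real j / (real n - real j)"
              using n by (intro binomial_ratio_approx_power) auto
            from mult_left_mono[OF this W0[of n k]]
            show "\<bar>W n k * (real (k choose j) / real (n choose j) - (real k / real n) ^ j)\<bar> \<le> W n k * (real j * real j / (real n - real j))"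
              by (simp only: abs_mult abs_of_nonneg[OF W0])
          qed
          also have "\<dots> = real j * real j / (real n - real j)"
            by (simp only: sum_distrib_right[symmetric] W_sum mult_1)
          finally show "norm (L ([:0, 1:] ^ j) / m - (\<Sum>k\<le>n. W n k * (real k / real n) ^ j)) \<le> real j * real j / (real n - real j)" .
        qed
        ultimately show "(\<lambda>n. L ([:0, 1:] ^ j) / m - (\<Sum>k\<le>n. W n k * (real k / real n) ^ j)) \<longlonglongrightarrow> 0"
          by (rule Lim_null_comparison[rotated])
      qed
      show ?thesis
        using 1 LIMSEQ_unique[OF 2[unfolded 3] LIMSEQ_subseq_LIMSEQ[OF 4 r, unfolded comp_def]] by simp
    qed
    have int_pow: "integrable M (\<lambda>x. x ^ j)" for j
    proof (rule M.integrable_const_bound[where B=1])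
      show "AE x in M. norm (x ^ j) \<le> 1" using M_01 by eventually_elim (simp add: power_le_one)
    qed simp
    define M' where "M' = scale_measure (ennreal m) M"
    have M'_eq: "M' = density M (\<lambda>_. ennreal m)"
      unfolding M'_def by (rule measure_eqI) (auto simp: emeasure_density_const)
    have fin: "finite_measure M'"
      by (rule finite_measureI) (simp add: M'_def ennreal_mult_eq_top_iff M.emeasure_eq_measure)
    have ae: "AE x in M'. 0 \<le> x \<and> x \<le> 1"
      unfolding M'_eq using M_01 m by (subst AE_density) auto
    have int: "integrable M' (poly p)" for p
      unfolding M'_eq using m int_pow by (subst integrable_density) (auto simp: poly_altdef)
    have L: "L p = (\<integral>x. poly p x \<partial>M')" for p
    proof -
      have "(\<integral>x. poly p x \<partial>M') = (\<integral>x. m *\<^sub>R poly p x \<partial>M)"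
        unfolding M'_eq using m by (subst integral_density) auto
      also have "\<dots> = m * (\<Sum>i\<le>degree p. coeff p i * (\<integral>x. x ^ i \<partial>M))"
        using int_pow by (simp add: poly_altdef)
      also have "\<dots> = L p"
        using m unfolding L_pow[of p] mom by (simp add: sum_distrib_left)
      finally show ?thesis ..
    qed
    have sets: "sets M' = sets borel"
      by (simp add: M'_def)
    show ?thesis
      by (intro exI[of _ M'] conjI allI fin ae int L sets)
  qed
qed

section \<open>The moment problem on a symmetric interval\<close>

lemma pcompose_power': "pcompose (p ^ n) q = pcompose p q ^ n" for p q :: "real poly"
  by (induction n) (simp_all add: pcompose_mult pcompose_1)

text \<open>
  The substitution \<open>x = 2 t - 1\<close> reduces to \<open>[0, 1]\<close>. There the products \<open>t\<^sup>k (1 - t)\<^sup>m\<close> are a square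
  times one of \<open>1\<close>, \<open>t\<close>, \<open>1 - t\<close>, \<open>t (1 - t)\<close>, according to the parities of \<open>k\<close> and \<open>m\<close>: these are the four
  positivity hypotheses.
\<close>

lemma interval_moment:
  fixes L :: "real poly \<Rightarrow> real"
  assumes add: "\<And>p q. L (p + q) = L p + L q" and smult: "\<And>a p. L (smult a p) = a * L p"
    and sq: "\<And>p. 0 \<le> L (p * p)" and sq_plus: "\<And>p. 0 \<le> L ([:1, 1:] * (p * p))"
    and sq_minus: "\<And>p. 0 \<le> L ([:1, -1:] * (p * p))" and sq_both: "\<And>p. 0 \<le> L ([:1, 0, -1:] * (p * p))"
  shows "\<exists>E. finite_measure E \<and> sets E = sets (restrict_space borel {-1..1}) \<and>
             (\<forall>n. L ([:0, 1:] ^ n) = (\<integral>x. x ^ n \<partial>E))"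
proof -
  define T :: "real poly" where "T = [:1/2, 1/2:]"
  define S :: "real poly" where "S = [:1/2, -1/2:]"
  define \<Lambda> where "\<Lambda> p = L (pcompose p T)" for p
  have nonneg: "0 \<le> L (T ^ k * S ^ m)" for k m
  proof -
    define p where "p = T ^ (k div 2) * S ^ (m div 2)"
    have k: "T ^ k = T ^ (k mod 2) * (T ^ (k div 2) * T ^ (k div 2))"
      by (metis mod_mult_div_eq mult_2 power_add)
    have m: "S ^ m = S ^ (m mod 2) * (S ^ (m div 2) * S ^ (m div 2))"
      by (metis mod_mult_div_eq mult_2 power_add)
    have eq: "T ^ k * S ^ m = (T ^ (k mod 2) * S ^ (m mod 2)) * (p * p)"
      unfolding k m p_def by (simp only: mult_ac)
    have T: "T * q = smult (1/2) ([:1, 1:] * q)" and S: "S * q = smult (1/2) ([:1, -1:] * q)"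
      and TS: "T * S * q = smult (1/4) ([:1, 0, -1:] * q)" for q
      by (simp_all add: T_def S_def smult_add_right)
    consider "k mod 2 = 0" "m mod 2 = 0" | "k mod 2 = 1" "m mod 2 = 0" | "k mod 2 = 0" "m mod 2 = 1" | "k mod 2 = 1" "m mod 2 = 1"
      by linarith
    then show ?thesis
    proof cases
      case 1 then show ?thesis unfolding eq using sq[of p] by simp
    next
      case 2 then show ?thesis unfolding eq using sq_plus[of p] by (simp only: power_0 power_one_right mult_1_right T smult)
    next
      case 3 then show ?thesis unfolding eq using sq_minus[of p] by (simp only: power_0 power_one_right mult_1_left S smult)
    next
      case 4 then show ?thesis unfolding eq using sq_both[of p] by (simp only: power_one_right TS smult)
    qed
  qed
  have "\<exists>M. finite_measure M \<and> sets M = sets borel \<and> (AE x in M. 0 \<le> x \<and> x \<le> 1) \<and>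
             (\<forall>p. integrable M (poly p)) \<and> (\<forall>p. \<Lambda> p = (\<integral>x. poly p x \<partial>M))"
  proof (rule hausdorff_moment)
    show "\<Lambda> (p + q) = \<Lambda> p + \<Lambda> q" for p q by (simp add: \<Lambda>_def pcompose_add add)
    show "\<Lambda> (smult a p) = a * \<Lambda> p" for a p by (simp add: \<Lambda>_def pcompose_smult smult)
    have "pcompose [:1, -1:] T = S" "pcompose [:0, 1:] T = T" by (simp_all add: T_def S_def pcompose_pCons)
    then show "0 \<le> \<Lambda> ([:0, 1:] ^ k * [:1, - 1:] ^ m)" for k m
      using nonneg[of k m] by (simp only: \<Lambda>_def pcompose_mult pcompose_power')
  qed
  then obtain M where M: "finite_measure M" and sets_M: "sets M = sets borel" and M_01: "AE x in M. 0 \<le> x \<and> x \<le> 1"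
    and M_int: "\<And>p. \<Lambda> p = (\<integral>x. poly p x \<partial>M)" by blast
  define \<phi> :: "real \<Rightarrow> real" where "\<phi> t = (if 0 \<le> t \<and> t \<le> 1 then 2 * t - 1 else 0)" for t
  have \<phi>_borel: "\<phi> \<in> borel \<rightarrow>\<^sub>M restrict_space borel {-1..1}"
    by (rule measurable_restrict_space2) (auto simp: \<phi>_def[abs_def])
  have \<phi>: "\<phi> \<in> M \<rightarrow>\<^sub>M restrict_space borel {-1..1}"
    using \<phi>_borel by (simp add: measurable_cong_sets[OF sets_M refl])
  define E where "E = distr M (restrict_space borel {-1..1}) \<phi>"
  have "L ([:0, 1:] ^ n) = (\<integral>x. x ^ n \<partial>E)" for n
  proof -
    have [measurable]: "\<phi> \<in> borel_measurable M" using \<phi> by (simp add: measurable_restrict_space2_iff)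
    have [measurable]: "poly p \<in> borel_measurable M" for p :: "real poly"
      using borel_measurable_poly[of p] by (simp add: measurable_cong_sets[OF sets_M refl])
    have "pcompose [:-1, 2:] T = [:0, 1:]" by (simp add: T_def pcompose_pCons)
    then have "L ([:0, 1:] ^ n) = \<Lambda> ([:-1, 2:] ^ n)" by (simp add: \<Lambda>_def pcompose_power')
    also have "\<dots> = (\<integral>x. poly ([:-1, 2:] ^ n) x \<partial>M)" by (rule M_int)
    also have "\<dots> = (\<integral>x. \<phi> x ^ n \<partial>M)"
    proof (rule integral_cong_AE)
      show "AE x in M. poly ([:-1, 2:] ^ n) x = \<phi> x ^ n"
        using M_01 by eventually_elim (simp add: \<phi>_def algebra_simps)
    qed measurable
    also have "\<dots> = (\<integral>x. x ^ n \<partial>E)"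
      unfolding E_def by (rule integral_distr[symmetric, OF \<phi>]) (auto intro!: measurable_restrict_space1)
    finally show ?thesis .
  qed
  moreover have "finite_measure E" unfolding E_def by (rule finite_measure.finite_measure_distr[OF M \<phi>])
  moreover have "sets E = sets (restrict_space borel {-1..1})" by (simp add: E_def)
  ultimately show ?thesis by blast
qed

text \<open>
  On \<open>[-1, 1]\<close> the characteristic function is the sum of its Taylor series, whose coefficients are
  the moments.
\<close>

lemma real_distribution_eqI_moments:
  assumes M: "real_distribution M" "AE x in M. \<bar>x\<bar> \<le> 1" and N: "real_distribution N" "AE x in N. \<bar>x\<bar> \<le> 1"
    and eq: "\<And>n. (\<integral>x. x ^ n \<partial>M) = (\<integral>x. x ^ n \<partial>N)"
  shows "M = N"
proof -
  interpret M: real_distribution M by (rule M)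
  interpret N: real_distribution N by (rule N)
  have approx: "cmod (char R t - (\<Sum>k\<le>n. ((\<i> * t)^k / fact k) * (\<integral>x. x^k \<partial>R))) \<le> 2 * \<bar>t\<bar>^n / fact n"
    if R: "real_distribution R" and R1: "AE x in R. \<bar>x\<bar> \<le> 1" for R :: "real measure" and t n
  proof -
    interpret R: real_distribution R by (rule R)
    have le: "AE x in R. \<bar>x ^ k\<bar> \<le> 1" for k
      using R1 by eventually_elim (simp add: power_abs power_le_one)
    have int: "integrable R (\<lambda>x. x ^ k)" for k
      by (rule R.integrable_const_bound[where B=1]) (use le[of k] in auto)
    have "(\<integral>x. \<bar>x\<bar> ^ n \<partial>R) \<le> (\<integral>x. 1 \<partial>R)"
      by (rule integral_mono_AE) (use le[of n] integrable_abs[OF int[of n]] in \<open>simp_all add: power_abs\<close>)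
    then have 1: "(\<integral>x. \<bar>x\<bar> ^ n \<partial>R) \<le> 1" using R.prob_space by simp
    have "(2*\<bar>t\<bar>^n / fact n) * (\<integral>x. \<bar>x\<bar> ^ n \<partial>R) \<le> 2 * \<bar>t\<bar>^n / fact n"
      using mult_left_mono[OF 1, of "2*\<bar>t\<bar>^n / fact n"] by simp
    then show ?thesis using R.char_approx1[of n t, OF int] by linarith
  qed
  have "char M t = char N t" for t
  proof -
    have "cmod (char M t - char N t) \<le> 4 * (\<bar>t\<bar>^n / fact n)" for n
    proof -
      define s where "s = (\<Sum>k\<le>n. ((\<i> * t)^k / fact k) * (\<integral>x. x^k \<partial>M))"
      have "cmod (char M t - char N t) \<le> cmod (char M t - s) + cmod (char N t - s)"
        using norm_triangle_ineq4[of "char M t - s" "char N t - s"] by simp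
      also have "\<dots> \<le> 2 * \<bar>t\<bar>^n / fact n + 2 * \<bar>t\<bar>^n / fact n"
        using approx[OF M, of t n] approx[OF N, of t n] unfolding s_def eq by (intro add_mono) auto
      finally show ?thesis by simp
    qed
    moreover have "(\<lambda>n. 4 * (\<bar>t\<bar>^n / fact n)) \<longlonglongrightarrow> 4 * 0"
      using summable_LIMSEQ_zero[OF summable_exp[of "\<bar>t\<bar>"]]
      by (intro tendsto_mult tendsto_const) (simp add: field_simps)
    ultimately have "cmod (char M t - char N t) \<le> 4 * 0"
      by (intro LIMSEQ_le_const) auto
    then show ?thesis by simp
  qed
  then show ?thesis by (intro Levy_uniqueness M N ext)
qed

lemma finite_measure_eqI_moments:
  fixes E F :: "real measure"
  assumes E: "finite_measure E" "sets E = sets (restrict_space borel {-1..1})"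
    and F: "finite_measure F" "sets F = sets (restrict_space borel {-1..1})"
    and eq: "\<And>n. (\<integral>x. x ^ n \<partial>E) = (\<integral>x. x ^ n \<partial>F)"
  shows "E = F"
proof -
  define m where "m = measure E (space E)"
  have mF: "measure F (space F) = m" using eq[of 0] by (simp add: m_def)
  define N where "N G = distr (density G (\<lambda>_. ennreal (1 / m))) borel (\<lambda>x. x)" for G :: "real measure"
  have main: "real_distribution (N G) \<and> (AE x in N G. \<bar>x\<bar> \<le> 1) \<and> (\<forall>n. (\<integral>x. x ^ n \<partial>N G) = (\<integral>x. x ^ n \<partial>G) / m) \<and>
        (\<forall>A\<in>sets borel. A \<subseteq> {-1..1} \<longrightarrow> emeasure (N G) A = ennreal (1 / m) * emeasure G A)"
    if G: "finite_measure G" "sets G = sets (restrict_space borel {-1..1})" "measure G (space G) = m" and m: "m \<noteq> 0" for G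
  proof -
    interpret G: finite_measure G by fact
    have m0: "m > 0" using m G(3) measure_nonneg[of G "space G"] by linarith
    have spG: "space G = {-1..1}" using sets_eq_imp_space_eq[OF G(2)] by (simp add: space_restrict_space)
    have [measurable]: "h \<in> borel_measurable borel \<Longrightarrow> h \<in> borel_measurable G" for h :: "real \<Rightarrow> real"
      by (simp add: measurable_cong_sets[OF G(2) refl] measurable_restrict_space1)
    have id: "(\<lambda>x. x) \<in> density G (\<lambda>_. ennreal (1 / m)) \<rightarrow>\<^sub>M borel" by simp
    have "prob_space (density G (\<lambda>_. ennreal (1 / m)))"
      by (rule prob_spaceI) (use m0 G(3) in \<open>simp add: emeasure_density_const G.emeasure_eq_measure ennreal_mult[symmetric]\<close>)
    then have "real_distribution (N G)" unfolding N_def using id by (intro prob_space.real_distribution_distr)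
    moreover have "AE x in N G. \<bar>x\<bar> \<le> 1" unfolding N_def
      by (subst AE_distr_iff[OF id]) (use m0 in \<open>auto simp: AE_density spG intro!: AE_I2\<close>)
    moreover have "(\<integral>x. x ^ n \<partial>N G) = (\<integral>x. x ^ n \<partial>G) / m" for n
      unfolding N_def by (subst integral_distr[OF id]) (use m0 in \<open>simp_all add: integral_density\<close>)
    moreover have "emeasure (N G) A = ennreal (1 / m) * emeasure G A" if A: "A \<in> sets borel" "A \<subseteq> {-1..1}" for A
    proof -
      have "A \<in> sets G" using A by (auto simp: G(2) sets_restrict_space_iff)
      then show ?thesis unfolding N_def using A
        by (subst emeasure_distr[OF id]) (auto simp: emeasure_density_const spG Int_absorb2)
    qed
    ultimately show ?thesis by blast
  qed
  show ?thesis
  proof (cases "m = 0")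
    case True
    interpret E: finite_measure E by fact
    interpret F: finite_measure F by fact
    have "emeasure E A = 0" "emeasure F A = 0" if "A \<in> sets E" for A
    proof -
      have "measure E A \<le> 0" "measure F A \<le> 0"
        using True m_def mF E.bounded_measure[of A] F.bounded_measure[of A] by auto
      then show "emeasure E A = 0" "emeasure F A = 0"
        by (simp_all add: E.emeasure_eq_measure F.emeasure_eq_measure measure_le_0_iff)
    qed
    then show ?thesis using E F by (intro measure_eqI) auto
  next
    case False
    note E' = main[OF E m_def[symmetric] False] and F' = main[OF F mF False]
    have "N E = N F" using E' F' eq by (intro real_distribution_eqI_moments) auto
    show ?thesis
    proof (rule measure_eqI)
      fix A assume "A \<in> sets E"
      then have A: "A \<in> sets borel" "A \<subseteq> {-1..1}" by (auto simp: E(2) sets_restrict_space_iff)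
      have "ennreal (1 / m) * emeasure E A = ennreal (1 / m) * emeasure F A"
        using E' F' A \<open>N E = N F\<close> by metis
      moreover have "m > 0" using False measure_nonneg[of E "space E"] by (simp add: m_def less_le)
      then have "ennreal m * ennreal (1 / m) = 1" by (simp add: ennreal_mult[symmetric])
      ultimately have "1 * emeasure E A = 1 * emeasure F A"
        by (metis mult.assoc)
      then show "emeasure E A = emeasure F A" by simp
    qed (simp add: E F)
  qed
qed

section \<open>Integration against a composite measure\<close>

lemma smult_sum_right: "smult a (\<Sum>i\<in>I. p i) = (\<Sum>i\<in>I. smult a (p i))" for a :: real
  by (induction I rule: infinite_finite_induct) (simp_all add: smult_add_right)

text \<open>
  The integrand is integrable but possibly unbounded, so that the inner integrals exist only
  almost everywhere. Positive and negative parts reduce this to the case of nonnegative functions.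
\<close>

lemma
  fixes f :: "'b \<Rightarrow> real"
  assumes N: "N \<in> M \<rightarrow>\<^sub>M subprob_algebra B" and f [measurable]: "f \<in> borel_measurable B"
    and int: "integrable (M \<bind> N) f" and ne: "space M \<noteq> {}"
  shows AE_integrable_bind: "AE x in M. integrable (N x) f"
    and integrable_integral_bind: "integrable M (\<lambda>x. \<integral>y. f y \<partial>N x)"
    and integral_bind_integrable: "(\<integral>y. f y \<partial>(M \<bind> N)) = (\<integral>x. \<integral>y. f y \<partial>N x \<partial>M)"
proof -
  have sets_N: "sets (N x) = sets B" if "x \<in> space M" for x
    using measurable_space[OF N that] by (simp add: space_subprob_algebra)
  have meas_N: "h \<in> borel_measurable (N x)" if "h \<in> borel_measurable B" "x \<in> space M" for h :: "'b \<Rightarrow> real" and x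
    using that by (simp add: measurable_cong_sets[OF sets_N refl])
  have meas_bind: "h \<in> borel_measurable (M \<bind> N)" if "h \<in> borel_measurable B" for h :: "'b \<Rightarrow> real"
    using that by (simp add: measurable_cong_sets[OF sets_bind[OF sets_N ne] refl])
  have meas_int: "(\<lambda>x. \<integral>y. h y \<partial>N x) \<in> borel_measurable M" if "h \<in> borel_measurable B" for h :: "'b \<Rightarrow> real"
    by (rule measurable_compose[OF N integral_measurable_subprob_algebra[OF that]])
  have meas_nn: "(\<lambda>x. \<integral>\<^sup>+y. h y \<partial>N x) \<in> borel_measurable M" if "h \<in> borel_measurable B" for h
    by (rule measurable_compose[OF N nn_integral_measurable_subprob_algebra[OF that]])
  have fin: "(\<integral>\<^sup>+x. \<integral>\<^sup>+y. ennreal (norm (h y)) \<partial>N x \<partial>M) < \<infinity>" if "h \<in> borel_measurable B" "integrable (M \<bind> N) h" for h :: "'b \<Rightarrow> real"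
    using that by (subst nn_integral_bind[OF _ N, symmetric]) (auto simp: integrable_iff_bounded)
  have AE_int: "AE x in M. integrable (N x) h" if h: "h \<in> borel_measurable B" "integrable (M \<bind> N) h" for h :: "'b \<Rightarrow> real"
  proof -
    have "AE x in M. (\<integral>\<^sup>+y. ennreal (norm (h y)) \<partial>N x) \<noteq> \<infinity>"
      using fin[OF h] h by (intro nn_integral_PInf_AE meas_nn) auto
    then show ?thesis
      using AE_space
    proof eventually_elim
      case (elim x)
      with meas_N[OF h(1) elim(2)] show ?case by (simp add: integrable_iff_bounded less_top)
    qed
  qed
  have int_int: "integrable M (\<lambda>x. \<integral>y. h y \<partial>N x)" if h: "h \<in> borel_measurable B" "integrable (M \<bind> N) h" for h :: "'b \<Rightarrow> real"
  proof (rule integrableI_bounded[OF meas_int[OF h(1)]])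
    have "(\<integral>\<^sup>+x. ennreal (norm (\<integral>y. h y \<partial>N x)) \<partial>M) \<le> (\<integral>\<^sup>+x. \<integral>\<^sup>+y. ennreal (norm (h y)) \<partial>N x \<partial>M)"
    proof (rule nn_integral_mono_AE)
      show "AE x in M. ennreal (norm (\<integral>y. h y \<partial>N x)) \<le> (\<integral>\<^sup>+y. ennreal (norm (h y)) \<partial>N x)"
        using AE_int[OF h] by eventually_elim (rule integral_norm_bound_ennreal)
    qed
    also have "\<dots> < \<infinity>" by (rule fin[OF h])
    finally show "(\<integral>\<^sup>+x. ennreal (norm (\<integral>y. h y \<partial>N x)) \<partial>M) < \<infinity>" .
  qed
  have nonneg_case: "(\<integral>y. h y \<partial>(M \<bind> N)) = (\<integral>x. \<integral>y. h y \<partial>N x \<partial>M)"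
    if h: "h \<in> borel_measurable B" "integrable (M \<bind> N) h" and h0: "\<And>y. 0 \<le> h y" for h :: "'b \<Rightarrow> real"
  proof -
    have "ennreal (\<integral>y. h y \<partial>(M \<bind> N)) = (\<integral>\<^sup>+y. h y \<partial>(M \<bind> N))"
      by (intro nn_integral_eq_integral[symmetric] h) (simp add: h0)
    also have "\<dots> = (\<integral>\<^sup>+x. \<integral>\<^sup>+y. h y \<partial>N x \<partial>M)"
      using h by (intro nn_integral_bind[OF _ N]) auto
    also have "\<dots> = (\<integral>\<^sup>+x. ennreal (\<integral>y. h y \<partial>N x) \<partial>M)"
      using AE_int[OF h] by (intro nn_integral_cong_AE) (auto elim!: eventually_mono simp: nn_integral_eq_integral h0)
    also have "\<dots> = ennreal (\<integral>x. \<integral>y. h y \<partial>N x \<partial>M)"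
      by (intro nn_integral_eq_integral int_int h) (simp add: h0)
    finally show ?thesis
      by (simp add: integral_nonneg_AE h0)
  qed
  show "AE x in M. integrable (N x) f" "integrable M (\<lambda>x. \<integral>y. f y \<partial>N x)"
    by (intro AE_int int_int f int)+
  define p where "p y = max 0 (f y)" for y
  define n where "n y = max 0 (- f y)" for y
  have [measurable]: "p \<in> borel_measurable B" "n \<in> borel_measurable B" by (simp_all add: p_def[abs_def] n_def[abs_def])
  have pn: "integrable (M \<bind> N) p" "integrable (M \<bind> N) n" using int by (simp_all add: p_def[abs_def] n_def[abs_def])
  have p0: "0 \<le> p y" and n0: "0 \<le> n y" for y by (simp_all add: p_def n_def)
  have f_eq: "f y = p y - n y" for y by (simp add: p_def n_def)
  have "(\<integral>y. f y \<partial>(M \<bind> N)) = (\<integral>x. \<integral>y. p y \<partial>N x \<partial>M) - (\<integral>x. \<integral>y. n y \<partial>N x \<partial>M)"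
    unfolding f_eq using pn nonneg_case[OF _ pn(1) p0] nonneg_case[OF _ pn(2) n0] by simp
  also have "\<dots> = (\<integral>x. (\<integral>y. p y \<partial>N x) - (\<integral>y. n y \<partial>N x) \<partial>M)"
    using pn by (intro Bochner_Integration.integral_diff[symmetric] int_int) auto
  also have "\<dots> = (\<integral>x. \<integral>y. f y \<partial>N x \<partial>M)"
  proof (rule integral_cong_AE)
    show "AE x in M. (\<integral>y. p y \<partial>N x) - (\<integral>y. n y \<partial>N x) = (\<integral>y. f y \<partial>N x)"
      using AE_int[OF _ pn(1)] AE_int[OF _ pn(2)]
      by (auto simp: f_eq)
  qed (intro borel_measurable_diff meas_int; simp)+
  finally show "(\<integral>y. f y \<partial>(M \<bind> N)) = (\<integral>x. \<integral>y. f y \<partial>N x \<partial>M)" .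
qed

section \<open>Square-integrable functions\<close>

text \<open>
  Functions are not identified when they agree almost everywhere: a kernel acts on genuine
  functions, and its linearity on \<open>L\<^sup>2\<close> is an almost-everywhere statement.
\<close>

definition L2 :: "'a measure \<Rightarrow> ('a \<Rightarrow> real) set" where
  "L2 M = {f \<in> borel_measurable M. integrable M (\<lambda>x. (f x)\<^sup>2)}"

definition ip :: "'a measure \<Rightarrow> ('a \<Rightarrow> real) \<Rightarrow> ('a \<Rightarrow> real) \<Rightarrow> real" where
  "ip M f g = (\<integral>x. f x * g x \<partial>M)"

lemma L2_measurable: "f \<in> L2 M \<Longrightarrow> f \<in> borel_measurable M"
  by (simp add: L2_def)

lemma abs_mult_le_sum_squares: "\<bar>a * b\<bar> \<le> a\<^sup>2 + b\<^sup>2" for a b :: real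
proof -
  have "2 * (\<bar>a\<bar> * \<bar>b\<bar>) \<le> a\<^sup>2 + b\<^sup>2" using sum_squares_bound[of "\<bar>a\<bar>" "\<bar>b\<bar>"] by simp
  moreover have "0 \<le> \<bar>a\<bar> * \<bar>b\<bar>" by simp
  ultimately show ?thesis unfolding abs_mult by linarith
qed

lemma L2_integrable_mult:
  assumes f: "f \<in> L2 M" and g: "g \<in> L2 M"
  shows "integrable M (\<lambda>x. f x * g x)"
proof (rule Bochner_Integration.integrable_bound)
  show "integrable M (\<lambda>x. (f x)\<^sup>2 + (g x)\<^sup>2)" using f g by (simp add: L2_def)
  show "(\<lambda>x. f x * g x) \<in> borel_measurable M" using f g by (auto simp: L2_def)
  show "AE x in M. norm (f x * g x) \<le> norm ((f x)\<^sup>2 + (g x)\<^sup>2)"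
    using abs_mult_le_sum_squares by simp
qed

lemma L2_add: assumes "f \<in> L2 M" "g \<in> L2 M" shows "(\<lambda>x. f x + g x) \<in> L2 M"
proof -
  have "integrable M (\<lambda>x. (f x)\<^sup>2 + 2 * (f x * g x) + (g x)\<^sup>2)"
    using assms L2_integrable_mult[OF assms] by (simp add: L2_def)
  then show ?thesis using assms by (auto simp: L2_def power2_sum mult_ac add_ac)
qed

lemma L2_cmult: assumes "f \<in> L2 M" shows "(\<lambda>x. a * f x) \<in> L2 M"
  using assms by (auto simp: L2_def power_mult_distrib)

lemma L2_diff: assumes "f \<in> L2 M" "g \<in> L2 M" shows "(\<lambda>x. f x - g x) \<in> L2 M"
  using L2_add[OF assms(1) L2_cmult[OF assms(2), of "-1"]] by simp

lemma L2_sum: "(\<And>i. i \<in> I \<Longrightarrow> F i \<in> L2 M) \<Longrightarrow> (\<lambda>x. \<Sum>i\<in>I. a i * F i x) \<in> L2 M"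
proof (induction I rule: infinite_finite_induct)
  case (insert i I)
  then show ?case using L2_add[OF L2_cmult[of "F i" M "a i"], of "\<lambda>x. \<Sum>i\<in>I. a i * F i x"] by simp
qed (simp_all add: L2_def)

lemma ip_commute: "ip M f g = ip M g f"
  by (simp add: ip_def mult.commute)

lemma ip_self: "ip M f f = (\<integral>x. (f x)\<^sup>2 \<partial>M)"
  by (simp add: ip_def power2_eq_square)

lemma ip_self_nonneg: "0 \<le> ip M f f"
  by (simp add: ip_self)

lemma ip_cong_AE:
  assumes "f \<in> borel_measurable M" "f' \<in> borel_measurable M" "g \<in> borel_measurable M" "g' \<in> borel_measurable M"
    and "AE x in M. f x = f' x" "AE x in M. g x = g' x"
  shows "ip M f g = ip M f' g'"
  unfolding ip_def using assms by (intro integral_cong_AE) auto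

lemma ip_sum_sum:
  assumes "\<And>i. i \<in> I \<Longrightarrow> F i \<in> L2 M" "\<And>j. j \<in> J \<Longrightarrow> G j \<in> L2 M"
  shows "ip M (\<lambda>x. \<Sum>i\<in>I. a i * F i x) (\<lambda>x. \<Sum>j\<in>J. b j * G j x) = (\<Sum>i\<in>I. \<Sum>j\<in>J. a i * b j * ip M (F i) (G j))"
proof -
  have "ip M (\<lambda>x. \<Sum>i\<in>I. a i * F i x) (\<lambda>x. \<Sum>j\<in>J. b j * G j x) = (\<integral>x. (\<Sum>i\<in>I. \<Sum>j\<in>J. (a i * b j) * (F i x * G j x)) \<partial>M)"
    unfolding ip_def by (simp add: sum_product mult_ac)
  also have "\<dots> = (\<Sum>i\<in>I. \<Sum>j\<in>J. \<integral>x. (a i * b j) * (F i x * G j x) \<partial>M)"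
    using assms by (subst Bochner_Integration.integral_sum, intro Bochner_Integration.integrable_sum integrable_mult_right L2_integrable_mult, simp, simp)
       (intro sum.cong refl Bochner_Integration.integral_sum integrable_mult_right L2_integrable_mult, simp_all)
  finally show ?thesis by (simp add: ip_def)
qed

lemma abs_ip_le: assumes "f \<in> L2 M" "g \<in> L2 M" shows "\<bar>ip M f g\<bar> \<le> (ip M f f + ip M g g) / 2"
proof -
  have "\<bar>ip M f g\<bar> \<le> (\<integral>x. \<bar>f x * g x\<bar> \<partial>M)"
    unfolding ip_def by (rule integral_abs_bound)
  also have "\<dots> \<le> (\<integral>x. ((f x)\<^sup>2 + (g x)\<^sup>2) / 2 \<partial>M)"
  proof (rule integral_mono)
    have "\<bar>a * b\<bar> \<le> (a\<^sup>2 + b\<^sup>2) / 2" for a b :: real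
      using sum_squares_bound[of "\<bar>a\<bar>" "\<bar>b\<bar>"] by (simp add: abs_mult)
    then show "\<bar>f x * g x\<bar> \<le> ((f x)\<^sup>2 + (g x)\<^sup>2) / 2" for x .
    show "integrable M (\<lambda>x. \<bar>f x * g x\<bar>)" by (intro integrable_abs L2_integrable_mult assms)
  qed (use assms in \<open>auto simp: L2_def\<close>)
  also have "\<dots> = (ip M f f + ip M g g) / 2" using assms by (simp add: ip_self L2_def)
  finally show ?thesis .
qed

lemma ip_add_le:
  assumes a: "a \<in> L2 M" and b: "b \<in> L2 M"
  shows "ip M (\<lambda>x. a x + b x) (\<lambda>x. a x + b x) \<le> 2 * ip M a a + 2 * ip M b b"
proof -
  have le: "(u + v)\<^sup>2 \<le> 2 * u\<^sup>2 + 2 * v\<^sup>2" for u v :: real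
    using sum_squares_bound[of u v] by (simp add: power2_sum)
  have "(\<integral>x. (a x + b x)\<^sup>2 \<partial>M) \<le> (\<integral>x. 2 * (a x)\<^sup>2 + 2 * (b x)\<^sup>2 \<partial>M)"
    using a b L2_add[OF a b] le by (intro integral_mono) (auto simp: L2_def)
  also have "\<dots> = 2 * (\<integral>x. (a x)\<^sup>2 \<partial>M) + 2 * (\<integral>x. (b x)\<^sup>2 \<partial>M)"
    using a b by (simp add: L2_def)
  finally show ?thesis by (simp add: ip_self)
qed

section \<open>The operator of an invariant kernel\<close>

locale markov_kernel = prob_space \<pi> for \<pi> :: "'a measure" +
  fixes K :: "'a \<Rightarrow> 'a measure"
  assumes K_meas: "K \<in> \<pi> \<rightarrow>\<^sub>M prob_algebra \<pi>" and K_inv: "\<pi> \<bind> K = \<pi>"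
begin

abbreviation op :: "('a \<Rightarrow> real) \<Rightarrow> 'a \<Rightarrow> real" where "op \<equiv> kernel_op K"

lemma K_sub: "K \<in> \<pi> \<rightarrow>\<^sub>M subprob_algebra \<pi>"
  using K_meas by (rule measurable_prob_algebraD)

lemma K_prob: "x \<in> space \<pi> \<Longrightarrow> prob_space (K x)" and sets_K: "x \<in> space \<pi> \<Longrightarrow> sets (K x) = sets \<pi>"
  using measurable_space[OF K_meas] by (auto simp: space_prob_algebra)

lemma space_K: "x \<in> space \<pi> \<Longrightarrow> space (K x) = space \<pi>"
  using sets_K sets_eq_imp_space_eq by blast

lemma measurable_K: "x \<in> space \<pi> \<Longrightarrow> h \<in> measurable \<pi> N \<Longrightarrow> h \<in> measurable (K x) N"
  by (simp add: measurable_cong_sets[OF sets_K refl])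

lemma op_measurable [measurable]: "h \<in> borel_measurable \<pi> \<Longrightarrow> op h \<in> borel_measurable \<pi>"
  unfolding kernel_op_def[abs_def] by (rule measurable_compose[OF K_sub integral_measurable_subprob_algebra])

lemma AE_K: assumes [measurable]: "Measurable.pred \<pi> Q" and "AE y in \<pi>. Q y" shows "AE x in \<pi>. AE y in K x. Q y"
  using iffD1[OF AE_bind[OF K_sub assms(1), unfolded K_inv] assms(2)] .

lemma nn_integral_K: "h \<in> borel_measurable \<pi> \<Longrightarrow> (\<integral>\<^sup>+x. \<integral>\<^sup>+y. h y \<partial>K x \<partial>\<pi>) = (\<integral>\<^sup>+y. h y \<partial>\<pi>)"
  using nn_integral_bind[OF _ K_sub, of h] by (simp add: K_inv)

lemma
  fixes h :: "'a \<Rightarrow> real"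
  assumes h: "integrable \<pi> h"
  shows AE_integrable_K: "AE x in \<pi>. integrable (K x) h"
    and integrable_op: "integrable \<pi> (op h)"
    and integral_op: "(\<integral>x. op h x \<partial>\<pi>) = (\<integral>x. h x \<partial>\<pi>)"
proof -
  show "AE x in \<pi>. integrable (K x) h"
    using AE_integrable_bind[OF K_sub borel_measurable_integrable[OF h], unfolded K_inv, OF h not_empty] .
  show "integrable \<pi> (op h)"
    using integrable_integral_bind[OF K_sub borel_measurable_integrable[OF h], unfolded K_inv, OF h not_empty]
    unfolding kernel_op_def[abs_def] .
  show "(\<integral>x. op h x \<partial>\<pi>) = (\<integral>x. h x \<partial>\<pi>)"
    using integral_bind_integrable[OF K_sub borel_measurable_integrable[OF h], unfolded K_inv, OF h not_empty]
    unfolding kernel_op_def by (rule sym)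
qed

lemma L2_integrable: "h \<in> L2 \<pi> \<Longrightarrow> integrable \<pi> h"
  unfolding L2_def by (blast intro: square_integrable_imp_integrable)

lemma L2_const: "(\<lambda>_. c) \<in> L2 \<pi>" by (simp add: L2_def)

lemma op_cong_AE:
  assumes [measurable]: "g \<in> borel_measurable \<pi>" "h \<in> borel_measurable \<pi>" and "AE x in \<pi>. g x = h x"
  shows "AE x in \<pi>. op g x = op h x"
proof -
  have "AE x in \<pi>. AE y in K x. g y = h y" by (rule AE_K) (use assms in auto)
  then show ?thesis using AE_space
    unfolding kernel_op_def
  proof eventually_elim
    case (elim x)
    then show ?case by (intro integral_cong_AE measurable_K assms)
  qed
qed

text \<open>
  The difference of the two sides is the variance of \<open>h\<close> under \<open>K x\<close>.
\<close>

lemma AE_op_square_le: assumes h: "h \<in> L2 \<pi>" shows "AE x in \<pi>. (op h x)\<^sup>2 \<le> op (\<lambda>y. (h y)\<^sup>2) x"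
proof -
  have "AE x in \<pi>. integrable (K x) (\<lambda>y. (h y)\<^sup>2)" using h by (intro AE_integrable_K) (simp add: L2_def)
  then show ?thesis using AE_space
  proof eventually_elim
    case (elim x)
    interpret Kx: prob_space "K x" using elim K_prob by simp
    have meas: "h \<in> borel_measurable (K x)" by (intro measurable_K elim L2_measurable[OF h])
    have int: "integrable (K x) h" by (rule Kx.square_integrable_imp_integrable[OF meas elim(1)])
    have "0 \<le> Kx.variance h" by simp
    also have "Kx.variance h = op (\<lambda>y. (h y)\<^sup>2) x - (op h x)\<^sup>2"
      using Kx.variance_eq[OF int elim(1)] by (simp add: kernel_op_def)
    finally show ?case by simp
  qed
qed

lemma assumes h: "h \<in> L2 \<pi>" shows op_L2: "op h \<in> L2 \<pi>" and ip_op_le: "ip \<pi> (op h) (op h) \<le> ip \<pi> h h"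
proof -
  have h2: "integrable \<pi> (\<lambda>y. (h y)\<^sup>2)" and [measurable]: "h \<in> borel_measurable \<pi>" using h by (simp_all add: L2_def)
  have int: "integrable \<pi> (\<lambda>x. (op h x)\<^sup>2)"
    using AE_op_square_le[OF h] by (intro Bochner_Integration.integrable_bound[OF integrable_op[OF h2]]) auto
  then show "op h \<in> L2 \<pi>" by (simp add: L2_def)
  have "(\<integral>x. (op h x)\<^sup>2 \<partial>\<pi>) \<le> (\<integral>x. op (\<lambda>y. (h y)\<^sup>2) x \<partial>\<pi>)"
    by (intro integral_mono_AE int integrable_op h2 AE_op_square_le h)
  then show "ip \<pi> (op h) (op h) \<le> ip \<pi> h h" by (simp add: ip_self integral_op[OF h2])
qed

lemma op_pow_L2: "h \<in> L2 \<pi> \<Longrightarrow> (op ^^ n) h \<in> L2 \<pi>"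
  by (induction n) (auto intro: op_L2)

lemma op_sum_AE:
  assumes "\<And>i. i \<in> I \<Longrightarrow> integrable \<pi> (F i)"
  shows "AE x in \<pi>. op (\<lambda>y. \<Sum>i\<in>I. a i * F i y) x = (\<Sum>i\<in>I. a i * op (F i) x)"
proof (cases "finite I")
  case True
  then have "AE x in \<pi>. \<forall>i\<in>I. integrable (K x) (F i)"
    using assms AE_integrable_K by (intro AE_finite_allI) auto
  then show ?thesis
    by eventually_elim (simp add: kernel_op_def)
qed (simp add: kernel_op_def)

lemma op_diff_AE:
  assumes "integrable \<pi> g" "integrable \<pi> h"
  shows "AE x in \<pi>. op (\<lambda>y. g y - h y) x = op g x - op h x"
  using AE_integrable_K[OF assms(1)] AE_integrable_K[OF assms(2)]
  by eventually_elim (simp add: kernel_op_def)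

lemma op_pow_measurable [measurable]: "b \<in> borel_measurable \<pi> \<Longrightarrow> (op ^^ n) b \<in> borel_measurable \<pi>"
  by (induction n) auto

end

section \<open>Reversible kernels and their spectral measures\<close>

text \<open>
  Self-adjointness is the form in which reversibility is used; it passes to mixtures of powers of
  a kernel without further work on joint laws.
\<close>

locale reversible_kernel = markov_kernel +
  assumes self_adjoint: "f \<in> L2 \<pi> \<Longrightarrow> g \<in> L2 \<pi> \<Longrightarrow> ip \<pi> f (op g) = ip \<pi> (op f) g"
begin

lemma ip_op_pow:
  assumes "f \<in> L2 \<pi>" "g \<in> L2 \<pi>"
  shows "ip \<pi> ((op ^^ i) f) ((op ^^ j) g) = ip \<pi> f ((op ^^ (i + j)) g)"
proof (induction i arbitrary: j)
  case (Suc i)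
  have "ip \<pi> ((op ^^ Suc i) f) ((op ^^ j) g) = ip \<pi> ((op ^^ i) f) ((op ^^ Suc j) g)"
    using self_adjoint[OF op_pow_L2[OF assms(1), of i] op_pow_L2[OF assms(2), of j]] by simp
  then show ?case using Suc[of "Suc j"] by simp
qed simp

text \<open>
  The polynomial \<open>p(K)\<close> applied to \<open>h\<close>. It is defined on coefficients, since the operator \<open>K\<close> is linear
  only up to null sets.
\<close>

definition poly_op :: "real poly \<Rightarrow> ('a \<Rightarrow> real) \<Rightarrow> 'a \<Rightarrow> real" where
  "poly_op p h x = (\<Sum>i\<le>degree p. coeff p i * (op ^^ i) h x)"

text \<open>
  The linear functional \<open>p \<mapsto> \<langle>h, p(K) h\<rangle>\<close>, which the spectral measure of \<open>h\<close> represents.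
\<close>

definition poly_moment :: "('a \<Rightarrow> real) \<Rightarrow> real poly \<Rightarrow> real" where
  "poly_moment h p = (\<Sum>i\<le>degree p. coeff p i * ip \<pi> h ((op ^^ i) h))"

lemma poly_moment_le: "degree p \<le> N \<Longrightarrow> poly_moment h p = (\<Sum>i\<le>N. coeff p i * ip \<pi> h ((op ^^ i) h))"
  unfolding poly_moment_def by (intro sum.mono_neutral_left) (auto simp: coeff_eq_0)

lemma poly_moment_add: "poly_moment h (p + q) = poly_moment h p + poly_moment h q"
proof -
  let ?N = "max (degree p) (degree q)"
  have "poly_moment h p = (\<Sum>i\<le>?N. coeff p i * ip \<pi> h ((op ^^ i) h))" "poly_moment h q = (\<Sum>i\<le>?N. coeff q i * ip \<pi> h ((op ^^ i) h))"
    "poly_moment h (p + q) = (\<Sum>i\<le>?N. coeff (p + q) i * ip \<pi> h ((op ^^ i) h))"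
    by (intro poly_moment_le degree_add_le; simp)+
  then show ?thesis by (simp add: distrib_right sum.distrib)
qed

lemma poly_moment_smult: "poly_moment h (smult a p) = a * poly_moment h p"
  using poly_moment_le[of "smult a p" "degree p" h] by (simp add: poly_moment_def[of h p] degree_smult_le sum_distrib_left mult.assoc)

lemma poly_moment_pow: "poly_moment h ([:0, 1:] ^ n) = ip \<pi> h ((op ^^ n) h)"
proof -
  have "poly_moment h (monom 1 n) = (\<Sum>i\<le>n. coeff (monom 1 n) i * ip \<pi> h ((op ^^ i) h))"
    by (intro poly_moment_le degree_monom_le)
  also have "\<dots> = (\<Sum>i\<le>n. if i = n then ip \<pi> h ((op ^^ n) h) else 0)" by (intro sum.cong) auto
  finally show ?thesis by (simp add: monom_altdef)
qed

text \<open>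
  By self-adjointness, \<open>\<langle>K\<^sup>k p(K) h, K\<^sup>l q(K) h\<rangle> = \<langle>h, K\<^bsup>k+l\<^esup> (p q)(K) h\<rangle>\<close>. This turns statements about
  the norms of \<open>u = p(K) h\<close> and \<open>K u\<close> into positivity of the functional.
\<close>

lemma poly_moment_mult:
  assumes h: "h \<in> L2 \<pi>"
  shows "(\<Sum>i\<le>degree p. \<Sum>j\<le>degree q. coeff p i * coeff q j * ip \<pi> ((op ^^ (i + k)) h) ((op ^^ (j + l)) h)) =
         poly_moment h ([:0, 1:] ^ (k + l) * (p * q))"
proof -
  note L_sum = linear_functional_poly_eq_sum[of "poly_moment h", OF poly_moment_add poly_moment_smult]
  have repr: "p = (\<Sum>i\<le>degree p. smult (coeff p i) ([:0, 1:] ^ i))" for p :: "real poly"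
    using poly_as_sum_of_monoms[of p] by (simp add: monom_altdef)
  have "[:0, 1:] ^ (k + l) * (p * q) =
        (\<Sum>i\<le>degree p. smult (coeff p i) (\<Sum>j\<le>degree q. smult (coeff q j) ([:0, 1:] ^ (k + l + i + j))))"
  proof -
    have "[:0, 1:] ^ (k + l) * (p * q) = [:0, 1:] ^ (k + l) * ((\<Sum>i\<le>degree p. smult (coeff p i) ([:0, 1:] ^ i)) * (\<Sum>j\<le>degree q. smult (coeff q j) ([:0, 1:] ^ j)))"
      using repr[of p] repr[of q] by simp
    also have "\<dots> = (\<Sum>i\<le>degree p. \<Sum>j\<le>degree q. smult (coeff p i) (smult (coeff q j) ([:0, 1:] ^ (k + l) * ([:0, 1:] ^ i * [:0, 1:] ^ j))))"
      by (subst sum_product) (simp only: sum_distrib_left mult_smult_left mult_smult_right smult_smult mult_ac)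
    also have "\<dots> = (\<Sum>i\<le>degree p. smult (coeff p i) (\<Sum>j\<le>degree q. smult (coeff q j) ([:0, 1:] ^ (k + l + i + j))))"
      by (simp only: smult_sum_right power_add mult.assoc)
    finally show ?thesis .
  qed
  then have "poly_moment h ([:0, 1:] ^ (k + l) * (p * q)) =
        (\<Sum>i\<le>degree p. coeff p i * (\<Sum>j\<le>degree q. coeff q j * ip \<pi> h ((op ^^ (k + l + i + j)) h)))"
    by (simp only: L_sum poly_moment_pow)
  then show ?thesis
    by (simp add: ip_op_pow[OF h h] sum_distrib_left mult_ac add_ac)
qed

lemma poly_op_L2: "h \<in> L2 \<pi> \<Longrightarrow> poly_op p h \<in> L2 \<pi>"
  unfolding poly_op_def[abs_def] by (intro L2_sum op_pow_L2)

lemma ip_poly_op_poly_op: assumes h: "h \<in> L2 \<pi>" shows "ip \<pi> (poly_op p h) (poly_op q h) = poly_moment h (p * q)"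
  unfolding poly_op_def[abs_def] using poly_moment_mult[OF h, of p q 0 0] by (subst ip_sum_sum) (simp_all add: op_pow_L2[OF h])

lemma op_poly_op_AE: assumes h: "h \<in> L2 \<pi>"
  shows "AE x in \<pi>. op (poly_op p h) x = (\<Sum>i\<le>degree p. coeff p i * (op ^^ (i + 1)) h x)"
  unfolding poly_op_def[abs_def] using op_sum_AE[of "{..degree p}" "\<lambda>i. (op ^^ i) h" "coeff p"] by (simp add: L2_integrable op_pow_L2 h)

lemma ip_poly_op_op_poly_op: assumes h: "h \<in> L2 \<pi>" shows "ip \<pi> (poly_op p h) (op (poly_op p h)) = poly_moment h ([:0, 1:] * (p * p))"
proof -
  have "ip \<pi> (poly_op p h) (op (poly_op p h)) = ip \<pi> (\<lambda>x. \<Sum>i\<le>degree p. coeff p i * (op ^^ (i + 0)) h x) (\<lambda>x. \<Sum>i\<le>degree p. coeff p i * (op ^^ (i + 1)) h x)"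
    using op_poly_op_AE[OF h] L2_measurable[OF poly_op_L2[OF h]] L2_measurable[OF h]
    by (intro ip_cong_AE) (simp_all add: poly_op_def borel_measurable_sum del: funpow.simps)
  also have "\<dots> = poly_moment h ([:0, 1:] ^ (0 + 1) * (p * p))"
    unfolding poly_moment_mult[OF h, symmetric] by (intro ip_sum_sum op_pow_L2 h)
  finally show ?thesis by simp
qed

lemma ip_op_poly_op_op_poly_op: assumes h: "h \<in> L2 \<pi>" shows "ip \<pi> (op (poly_op p h)) (op (poly_op p h)) = poly_moment h ([:0, 1:] ^ 2 * (p * p))"
proof -
  have "ip \<pi> (op (poly_op p h)) (op (poly_op p h)) = ip \<pi> (\<lambda>x. \<Sum>i\<le>degree p. coeff p i * (op ^^ (i + 1)) h x) (\<lambda>x. \<Sum>i\<le>degree p. coeff p i * (op ^^ (i + 1)) h x)"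
    using op_poly_op_AE[OF h] L2_measurable[OF poly_op_L2[OF h]] L2_measurable[OF h]
    by (intro ip_cong_AE) (simp_all add: borel_measurable_sum del: funpow.simps)
  also have "\<dots> = poly_moment h ([:0, 1:] ^ (1 + 1) * (p * p))"
    unfolding poly_moment_mult[OF h, symmetric] by (intro ip_sum_sum op_pow_L2 h)
  finally show ?thesis by (simp add: numeral_2_eq_2)
qed

text \<open>
  With \<open>u = p(K) h\<close>, the four positivity hypotheses of the moment problem are \<open>\<parallel>u\<parallel>\<^sup>2 \<ge> 0\<close>,
  \<open>\<parallel>u\<parallel>\<^sup>2 \<plusminus> \<langle>u, K u\<rangle> \<ge> 0\<close> and \<open>\<parallel>u\<parallel>\<^sup>2 - \<parallel>K u\<parallel>\<^sup>2 \<ge> 0\<close>; all hold because \<open>K\<close> is a contraction.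
\<close>

lemma spectral_measure_exists:
  assumes h: "h \<in> L2 \<pi>"
  shows "\<exists>E. finite_measure E \<and> sets E = sets (restrict_space borel {-1..1}) \<and>
             (\<forall>n. ip \<pi> h ((op ^^ n) h) = (\<integral>x. x ^ n \<partial>E))"
proof -
  have "\<exists>E. finite_measure E \<and> sets E = sets (restrict_space borel {-1..1}) \<and>
             (\<forall>n. poly_moment h ([:0, 1:] ^ n) = (\<integral>x. x ^ n \<partial>E))"
  proof (rule interval_moment[OF poly_moment_add poly_moment_smult])
    fix p
    define u where "u = poly_op p h"
    have u: "u \<in> L2 \<pi>" by (simp add: u_def poly_op_L2 h)
    have 0: "ip \<pi> u u = poly_moment h (p * p)" by (simp add: u_def ip_poly_op_poly_op h)
    have 1: "ip \<pi> u (op u) = poly_moment h ([:0, 1:] * (p * p))" by (simp add: u_def ip_poly_op_op_poly_op h)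
    have 2: "ip \<pi> (op u) (op u) = poly_moment h ([:0, 1:]^2 * (p * p))" by (simp add: u_def ip_op_poly_op_op_poly_op h)
    have le: "\<bar>ip \<pi> u (op u)\<bar> \<le> ip \<pi> u u"
      using abs_ip_le[OF u op_L2[OF u]] ip_op_le[OF u] by simp
    show "0 \<le> poly_moment h (p * p)" using ip_self_nonneg[of \<pi> u] 0 by simp
    have "[:1, 1:] * (p * p) = p * p + [:0, 1:] * (p * p)" by (simp add: algebra_simps)
    then show "0 \<le> poly_moment h ([:1, 1:] * (p * p))" using le 0 1 by (simp only: poly_moment_add)
    have "[:1, -1:] * (p * p) = p * p + smult (-1) ([:0, 1:] * (p * p))" by (simp add: algebra_simps)
    then show "0 \<le> poly_moment h ([:1, -1:] * (p * p))" using le 0 1 by (simp only: poly_moment_add poly_moment_smult)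
    have "[:1, 0, -1:] * (p * p) = p * p + smult (-1) ([:0, 1:]^2 * (p * p))" by (simp add: algebra_simps power2_eq_square)
    then show "0 \<le> poly_moment h ([:1, 0, -1:] * (p * p))" using ip_op_le[OF u] 0 2 by (simp only: poly_moment_add poly_moment_smult)
  qed
  then show ?thesis by (simp only: poly_moment_pow)
qed

end

section \<open>The stationary chain\<close>

context markov_kernel
begin

abbreviation chain :: "(nat \<Rightarrow> 'a) measure" where "chain \<equiv> chain_law \<pi> K"

abbreviation path :: "nat \<Rightarrow> (nat \<Rightarrow> 'a) measure" where "path n \<equiv> Pi\<^sub>M {0..<n} (\<lambda>_. \<pi>)"

lemma prob_space_chain: "prob_space chain"
  by (rule distr_chain_law(1)[OF prob_space_axioms K_meas])

lemma sets_chain: "sets chain = sets (Pi\<^sub>M UNIV (\<lambda>_. \<pi>))"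
proof -
  interpret IT: Ionescu_Tulcea "chain_step \<pi> K" "\<lambda>_. \<pi>"
    by (rule Ionescu_Tulcea_chain_step[OF prob_space_axioms K_meas])
  show ?thesis unfolding chain_law_def by (rule IT.PF.sets_lim)
qed

lemma measurable_coord [measurable]: "(\<lambda>\<omega>. \<omega> i) \<in> chain \<rightarrow>\<^sub>M \<pi>"
  by (simp add: measurable_cong_sets[OF sets_chain refl])

lemma measurable_restrict_path: "(\<lambda>\<omega>. restrict \<omega> {0..<n}) \<in> chain \<rightarrow>\<^sub>M path n"
  by (simp add: measurable_cong_sets[OF sets_chain refl] measurable_restrict_subset)

text \<open>
  The law of the first \<open>n\<close> states, and the transition from it to the law of the first \<open>n + 1\<close> states.
\<close>

definition marginal :: "nat \<Rightarrow> (nat \<Rightarrow> 'a) measure" where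
  "marginal n = distr chain (path n) (\<lambda>\<omega>. restrict \<omega> {0..<n})"

definition extend :: "nat \<Rightarrow> (nat \<Rightarrow> 'a) \<Rightarrow> (nat \<Rightarrow> 'a) measure" where
  "extend n \<omega> = distr (chain_step \<pi> K n \<omega>) (path (Suc n)) (fun_upd \<omega> n)"

lemma marginal_Suc: "marginal (Suc n) = marginal n \<bind> extend n"
  unfolding marginal_def extend_def[abs_def] by (rule distr_chain_law(3)[OF prob_space_axioms K_meas])

lemma prob_space_marginal: "prob_space (marginal n)"
  unfolding marginal_def by (intro prob_space.prob_space_distr prob_space_chain measurable_restrict_path)

lemma sets_marginal: "sets (marginal n) = sets (path n)"
  by (simp add: marginal_def)

lemma measurable_chain_step: "chain_step \<pi> K n \<in> path n \<rightarrow>\<^sub>M subprob_algebra \<pi>"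
  using Ionescu_Tulcea.P[OF Ionescu_Tulcea_chain_step[OF prob_space_axioms K_meas]] .

lemma measurable_fun_upd_path: "(\<lambda>(\<omega>, y). fun_upd \<omega> n y) \<in> path n \<Otimes>\<^sub>M \<pi> \<rightarrow>\<^sub>M path (Suc n)"
  using measurable_add_dim[of n "{0..<n}" "\<lambda>_. \<pi>"] by (simp add: atLeast0_lessThan_Suc)

lemma measurable_extend: "extend n \<in> path n \<rightarrow>\<^sub>M subprob_algebra (path (Suc n))"
  unfolding extend_def[abs_def]
  by (rule measurable_distr2[OF measurable_fun_upd_path[unfolded split_def[symmetric]] measurable_chain_step])

lemma sets_chain_step: "\<omega> \<in> space (path n) \<Longrightarrow> sets (chain_step \<pi> K n \<omega>) = sets \<pi>"
  using measurable_space[OF measurable_chain_step] by (auto simp: space_subprob_algebra)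

lemma measurable_fun_upd_step:
  assumes "\<omega> \<in> space (path n)"
  shows "fun_upd \<omega> n \<in> chain_step \<pi> K n \<omega> \<rightarrow>\<^sub>M path (Suc n)"
  using measurable_Pair2[OF measurable_fun_upd_path assms]
  by (simp add: measurable_cong_sets[OF sets_chain_step[OF assms] refl])

lemma nn_integral_marginal_Suc:
  assumes h: "h \<in> borel_measurable (path (Suc n))"
  shows "(\<integral>\<^sup>+\<omega>. h \<omega> \<partial>marginal (Suc n)) = (\<integral>\<^sup>+\<omega>. \<integral>\<^sup>+y. h (fun_upd \<omega> n y) \<partial>chain_step \<pi> K n \<omega> \<partial>marginal n)"
proof -
  have "extend n \<in> marginal n \<rightarrow>\<^sub>M subprob_algebra (path (Suc n))"
    using measurable_extend by (simp add: measurable_cong_sets[OF sets_marginal refl])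
  then have "(\<integral>\<^sup>+\<omega>. h \<omega> \<partial>marginal (Suc n)) = (\<integral>\<^sup>+\<omega>. \<integral>\<^sup>+\<eta>. h \<eta> \<partial>extend n \<omega> \<partial>marginal n)"
    unfolding marginal_Suc by (intro nn_integral_bind[OF h])
  also have "\<dots> = (\<integral>\<^sup>+\<omega>. \<integral>\<^sup>+y. h (fun_upd \<omega> n y) \<partial>chain_step \<pi> K n \<omega> \<partial>marginal n)"
    unfolding extend_def
    by (intro nn_integral_cong nn_integral_distr measurable_fun_upd_step) (simp_all add: sets_eq_imp_space_eq[OF sets_marginal] h)
  finally show ?thesis .
qed

lemma nn_integral_coord_Suc:
  assumes [measurable]: "h \<in> borel_measurable \<pi>"
  shows "(\<integral>\<^sup>+\<omega>. h (\<omega> n) \<partial>chain) = (\<integral>\<^sup>+\<omega>. \<integral>\<^sup>+y. h y \<partial>chain_step \<pi> K n \<omega> \<partial>marginal n)"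
proof -
  have "(\<integral>\<^sup>+\<omega>. h (\<omega> n) \<partial>chain) = (\<integral>\<^sup>+\<omega>. h (\<omega> n) \<partial>marginal (Suc n))"
    unfolding marginal_def by (subst nn_integral_distr[OF measurable_restrict_path]) auto
  also have "\<dots> = (\<integral>\<^sup>+\<omega>. \<integral>\<^sup>+y. h y \<partial>chain_step \<pi> K n \<omega> \<partial>marginal n)"
    by (subst nn_integral_marginal_Suc) auto
  finally show ?thesis .
qed

lemma nn_integral_coord:
  assumes [measurable]: "h \<in> borel_measurable \<pi>"
  shows "(\<integral>\<^sup>+\<omega>. h (\<omega> n) \<partial>chain) = (\<integral>\<^sup>+x. h x \<partial>\<pi>)"
  using assms
proof (induction n arbitrary: h)
  case 0
  have "emeasure (marginal 0) (space (marginal 0)) = 1" using prob_space.emeasure_space_1[OF prob_space_marginal] .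
  then show ?case using nn_integral_coord_Suc[OF 0, of 0] by (simp add: chain_step_def)
next
  case (Suc n)
  note [measurable] = Suc.prems
  have meas: "(\<lambda>x. \<integral>\<^sup>+y. h y \<partial>K x) \<in> borel_measurable \<pi>"
    by (rule measurable_compose[OF K_sub nn_integral_measurable_subprob_algebra[OF Suc.prems]])
  have "(\<integral>\<^sup>+\<omega>. h (\<omega> (Suc n)) \<partial>chain) = (\<integral>\<^sup>+\<omega>. \<integral>\<^sup>+y. h y \<partial>K (\<omega> n) \<partial>marginal (Suc n))"
    using nn_integral_coord_Suc[OF Suc.prems, of "Suc n"] by (simp add: chain_step_def)
  also have "\<dots> = (\<integral>\<^sup>+\<omega>. \<integral>\<^sup>+y. h y \<partial>K (\<omega> n) \<partial>chain)"
    unfolding marginal_def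
    by (subst nn_integral_distr[OF measurable_restrict_path]) (auto intro!: measurable_compose[OF _ meas])
  also have "\<dots> = (\<integral>\<^sup>+x. \<integral>\<^sup>+y. h y \<partial>K x \<partial>\<pi>)" by (rule Suc.IH[OF meas])
  also have "\<dots> = (\<integral>\<^sup>+x. h x \<partial>\<pi>)" by (rule nn_integral_K[OF Suc.prems])
  finally show ?case .
qed

lemma distr_coord: "distr chain \<pi> (\<lambda>\<omega>. \<omega> n) = \<pi>"
proof (rule measure_eqI)
  fix A assume "A \<in> sets (distr chain \<pi> (\<lambda>\<omega>. \<omega> n))"
  then have [measurable]: "A \<in> sets \<pi>" by simp
  have "emeasure (distr chain \<pi> (\<lambda>\<omega>. \<omega> n)) A = (\<integral>\<^sup>+x. indicator A x \<partial>distr chain \<pi> (\<lambda>\<omega>. \<omega> n))" by simp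
  also have "\<dots> = (\<integral>\<^sup>+\<omega>. indicator A (\<omega> n) \<partial>chain)" by (rule nn_integral_distr) auto
  also have "\<dots> = emeasure \<pi> A" by (subst nn_integral_coord) auto
  finally show "emeasure (distr chain \<pi> (\<lambda>\<omega>. \<omega> n)) A = emeasure \<pi> A" .
qed simp

lemma integral_coord: "h \<in> borel_measurable \<pi> \<Longrightarrow> (\<integral>\<omega>. h (\<omega> n) \<partial>chain) = (\<integral>x. h x \<partial>\<pi>)" for h :: "'a \<Rightarrow> real"
  using integral_distr[OF measurable_coord[of n], of h] by (simp add: distr_coord)

lemma integrable_coord: "integrable \<pi> h \<Longrightarrow> integrable chain (\<lambda>\<omega>. h (\<omega> n))" for h :: "'a \<Rightarrow> real"
  using integrable_distr[OF measurable_coord[of n], of h] by (simp add: distr_coord)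

lemma AE_coord: "AE x in \<pi>. Q x \<Longrightarrow> AE \<omega> in chain. Q (\<omega> n)"
  using AE_distrD[OF measurable_coord[of n], of Q] by (simp only: distr_coord)

lemma L2_coord: "h \<in> L2 \<pi> \<Longrightarrow> (\<lambda>\<omega>. h (\<omega> n)) \<in> L2 chain"
  using integrable_coord[of "\<lambda>x. (h x)\<^sup>2" n] by (auto simp: L2_def)

text \<open>
  The Markov property. Only the product has to be integrable, so that it applies to products of
  square-integrable functions.
\<close>

lemma chain_markov:
  fixes b :: "'a \<Rightarrow> real"
  assumes Y [measurable]: "Y \<in> borel_measurable (path (Suc k))" and b [measurable]: "b \<in> borel_measurable \<pi>"
    and int: "integrable chain (\<lambda>\<omega>. Y (restrict \<omega> {0..<Suc k}) * b (\<omega> (Suc k)))"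
  shows "(\<integral>\<omega>. Y (restrict \<omega> {0..<Suc k}) * b (\<omega> (Suc k)) \<partial>chain) = (\<integral>\<omega>. Y (restrict \<omega> {0..<Suc k}) * op b (\<omega> k) \<partial>chain)"
proof -
  define H where "H \<omega> = Y (restrict \<omega> {0..<Suc k}) * b (\<omega> (Suc k))" for \<omega>
  have restr: "(\<lambda>\<omega>. restrict \<omega> {0..<Suc k}) \<in> path (Suc (Suc k)) \<rightarrow>\<^sub>M path (Suc k)"
    by (rule measurable_restrict_subset) auto
  have H [measurable]: "H \<in> borel_measurable (path (Suc (Suc k)))"
    unfolding H_def[abs_def] by (intro borel_measurable_times measurable_compose[OF restr Y] measurable_compose[OF _ b]) auto
  have H_restrict: "H (restrict \<omega> {0..<Suc (Suc k)}) = H \<omega>" for \<omega>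
    by (simp add: H_def Int_absorb1 restrict_restrict Int_absorb2 subset_eq)
  have ext: "extend (Suc k) \<in> marginal (Suc k) \<rightarrow>\<^sub>M subprob_algebra (path (Suc (Suc k)))"
    using measurable_extend by (simp add: measurable_cong_sets[OF sets_marginal refl])
  have "integrable (marginal (Suc (Suc k))) H"
    unfolding marginal_def using int
    by (subst integrable_distr_eq[OF measurable_restrict_path H]) (simp only: H_restrict, simp add: H_def)
  then have int': "integrable (marginal (Suc k) \<bind> extend (Suc k)) H" by (simp only: marginal_Suc)
  have ne: "space (marginal (Suc k)) \<noteq> {}" using prob_space.not_empty[OF prob_space_marginal] .
  have "(\<integral>\<omega>. Y (restrict \<omega> {0..<Suc k}) * b (\<omega> (Suc k)) \<partial>chain) = (\<integral>\<omega>. H (restrict \<omega> {0..<Suc (Suc k)}) \<partial>chain)"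
    unfolding H_restrict by (simp add: H_def)
  also have "\<dots> = (\<integral>\<omega>. H \<omega> \<partial>marginal (Suc (Suc k)))"
    unfolding marginal_def by (rule integral_distr[OF measurable_restrict_path H, symmetric])
  also have "\<dots> = (\<integral>\<omega>. \<integral>\<eta>. H \<eta> \<partial>extend (Suc k) \<omega> \<partial>marginal (Suc k))"
    unfolding marginal_Suc[of "Suc k"] by (rule integral_bind_integrable[OF ext H int' ne])
  also have "\<dots> = (\<integral>\<omega>. Y \<omega> * op b (\<omega> k) \<partial>marginal (Suc k))"
  proof (rule Bochner_Integration.integral_cong[OF refl])
    fix \<omega> assume "\<omega> \<in> space (marginal (Suc k))"
    then have \<omega>: "\<omega> \<in> space (path (Suc k))" by (simp add: sets_eq_imp_space_eq[OF sets_marginal])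
    have upd: "restrict (fun_upd \<omega> (Suc k) y) {0..<Suc k} = \<omega>" for y
      using \<omega> by (auto simp: space_PiM PiE_def extensional_def restrict_def fun_eq_iff)
    have "(\<integral>\<eta>. H \<eta> \<partial>extend (Suc k) \<omega>) = (\<integral>y. H (fun_upd \<omega> (Suc k) y) \<partial>chain_step \<pi> K (Suc k) \<omega>)"
      unfolding extend_def by (rule integral_distr[OF measurable_fun_upd_step[OF \<omega>] H])
    also have "\<dots> = (\<integral>y. Y \<omega> * b y \<partial>K (\<omega> k))"
      by (simp add: H_def upd chain_step_def)
    also have "\<dots> = Y \<omega> * op b (\<omega> k)" by (simp add: kernel_op_def)
    finally show "(\<integral>\<eta>. H \<eta> \<partial>extend (Suc k) \<omega>) = Y \<omega> * op b (\<omega> k)" .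
  qed
  also have "\<dots> = (\<integral>\<omega>. Y (restrict \<omega> {0..<Suc k}) * op b (restrict \<omega> {0..<Suc k} k) \<partial>chain)"
    unfolding marginal_def by (rule integral_distr[OF measurable_restrict_path]) (auto intro!: measurable_compose[OF _ op_measurable[OF b]])
  finally show ?thesis by simp
qed

text \<open>
  Repeated use of the Markov property moves the second function back to time \<open>i\<close>, one application of
  the operator per step.
\<close>

lemma chain_covariance:
  assumes a: "a \<in> L2 \<pi>" and b: "b \<in> L2 \<pi>"
  shows "(\<integral>\<omega>. a (\<omega> i) * b (\<omega> (i + k)) \<partial>chain) = ip \<pi> a ((op ^^ k) b)"
  using b
proof (induction k arbitrary: b)
  case 0
  have "(\<lambda>x. a x * b x) \<in> borel_measurable \<pi>" using L2_measurable[OF a] L2_measurable[OF 0] by simp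
  from integral_coord[OF this, of i] show ?case by (simp add: ip_def)
next
  case (Suc k)
  have "(\<integral>\<omega>. a (restrict \<omega> {0..<Suc (i + k)} i) * b (\<omega> (Suc (i + k))) \<partial>chain) =
        (\<integral>\<omega>. a (restrict \<omega> {0..<Suc (i + k)} i) * op b (\<omega> (i + k)) \<partial>chain)"
  proof (rule chain_markov[where Y="\<lambda>\<eta>. a (\<eta> i)"])
    show "(\<lambda>\<eta>. a (\<eta> i)) \<in> borel_measurable (path (Suc (i + k)))"
      by (rule measurable_compose[OF _ L2_measurable[OF a]]) simp
    show "integrable chain (\<lambda>\<omega>. a (restrict \<omega> {0..<Suc (i + k)} i) * b (\<omega> (Suc (i + k))))"
      using L2_integrable_mult[OF L2_coord[OF a, of i] L2_coord[OF Suc.prems, of "Suc (i + k)"]] by simp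
  qed (rule L2_measurable[OF Suc.prems])
  then show ?case using Suc.IH[OF op_L2[OF Suc.prems]] by (simp add: funpow_swap1)
qed

definition part_sum :: "('a \<Rightarrow> real) \<Rightarrow> nat \<Rightarrow> (nat \<Rightarrow> 'a) \<Rightarrow> real" where
  "part_sum h n \<omega> = (\<Sum>i<n. h (\<omega> i))"

lemma part_sum_measurable [measurable]: "h \<in> borel_measurable \<pi> \<Longrightarrow> part_sum h n \<in> borel_measurable chain"
  unfolding part_sum_def[abs_def] by (intro borel_measurable_sum measurable_compose[OF measurable_coord])

lemma part_sum_L2: "h \<in> L2 \<pi> \<Longrightarrow> part_sum h n \<in> L2 chain"
  unfolding part_sum_def[abs_def] using L2_sum[of "{..<n}" "\<lambda>i \<omega>. h (\<omega> i)" chain "\<lambda>_. 1"] L2_coord[of h] by simp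

lemma second_moment_part_sum:
  assumes h: "h \<in> L2 \<pi>"
  shows "(\<integral>\<omega>. (part_sum h n \<omega>)\<^sup>2 \<partial>chain) = (\<Sum>i<n. \<Sum>j<n. ip \<pi> h ((op ^^ ((i - j) + (j - i))) h))"
proof -
  have "(\<integral>\<omega>. (part_sum h n \<omega>)\<^sup>2 \<partial>chain) = ip chain (\<lambda>\<omega>. \<Sum>i<n. 1 * h (\<omega> i)) (\<lambda>\<omega>. \<Sum>i<n. 1 * h (\<omega> i))"
    by (simp add: ip_self part_sum_def)
  also have "\<dots> = (\<Sum>i<n. \<Sum>j<n. ip chain (\<lambda>\<omega>. h (\<omega> i)) (\<lambda>\<omega>. h (\<omega> j)))"
    using L2_coord[OF h] by (subst ip_sum_sum) auto
  also have "\<dots> = (\<Sum>i<n. \<Sum>j<n. ip \<pi> h ((op ^^ ((i - j) + (j - i))) h))"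
  proof (intro sum.cong refl)
    fix i j
    have le: "ip chain (\<lambda>\<omega>. h (\<omega> i)) (\<lambda>\<omega>. h (\<omega> j)) = ip \<pi> h ((op ^^ (j - i)) h)" if "i \<le> j" for i j
      using chain_covariance[OF h h, of i "j - i"] that by (simp add: ip_def)
    show "ip chain (\<lambda>\<omega>. h (\<omega> i)) (\<lambda>\<omega>. h (\<omega> j)) = ip \<pi> h ((op ^^ ((i - j) + (j - i))) h)"
    proof (cases "i \<le> j")
      case True then show ?thesis using le[of i j] by simp
    next
      case False then show ?thesis using le[of j i] by (simp add: ip_commute)
    qed
  qed
  finally show ?thesis .
qed

lemma sqrt_ergodic_avg:
  "sqrt (real n) * (ergodic_avg f n \<omega> - c) = part_sum (\<lambda>x. f x - c) n \<omega> / sqrt (real n)"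
proof (cases "n = 0")
  case False
  then have "sqrt (real n) * (ergodic_avg f n \<omega> - c) = sqrt (real n) * part_sum (\<lambda>x. f x - c) n \<omega> / real n"
    by (simp add: ergodic_avg_def part_sum_def sum_subtractf field_simps)
  also have "\<dots> = part_sum (\<lambda>x. f x - c) n \<omega> / sqrt (real n)"
    using False by (simp add: field_simps)
  finally show ?thesis .
qed (simp add: part_sum_def)

lemma var_avg_eq:
  assumes f: "f \<in> L2 \<pi>"
  shows "real n * var_avg \<pi> K f n = (\<integral>\<omega>. (part_sum (\<lambda>x. f x - (\<integral>x. f x \<partial>\<pi>)) n \<omega>)\<^sup>2 \<partial>chain) / real n"
proof (cases "n = 0")
  case False
  have "(\<integral>\<omega>. ergodic_avg f n \<omega> \<partial>chain) = (\<Sum>i<n. \<integral>\<omega>. f (\<omega> i) \<partial>chain) / n"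
    unfolding ergodic_avg_def using integrable_coord[OF L2_integrable[OF f]] by simp
  also have "\<dots> = (\<integral>x. f x \<partial>\<pi>)" using False by (simp add: integral_coord L2_measurable[OF f])
  finally have "var_avg \<pi> K f n = (\<integral>\<omega>. (ergodic_avg f n \<omega> - (\<integral>x. f x \<partial>\<pi>))\<^sup>2 \<partial>chain)"
    by (simp add: var_avg_def)
  also have "\<dots> = (\<integral>\<omega>. (part_sum (\<lambda>x. f x - (\<integral>x. f x \<partial>\<pi>)) n \<omega>)\<^sup>2 / (real n)\<^sup>2 \<partial>chain)"
    using False by (intro Bochner_Integration.integral_cong) (simp_all add: ergodic_avg_def part_sum_def sum_subtractf field_simps)
  finally show ?thesis by (simp add: power2_eq_square)
qed (simp add: part_sum_def)

end

section \<open>Averages of powers\<close>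

text \<open>
  Passing from \<open>n\<close> to \<open>n + 1\<close> adds \<open>1 + 2 (y + \<dots> + y\<^sup>n)\<close> to the double sum, a geometric sum after
  multiplication by \<open>1 - y\<close>. The exponent is \<open>|i - j|\<close>, written with truncated subtraction.
\<close>

lemma toeplitz_power_sum:
  fixes y :: real
  shows "(1 - y) * (\<Sum>i<n. \<Sum>j<n. y ^ ((i - j) + (j - i))) = real n * (1 + y) - 2 * y * (\<Sum>j<n. y ^ j)"
proof (induction n)
  case (Suc n)
  have rev: "(\<Sum>i<n. y ^ (n - i)) = y * (\<Sum>j<n. y ^ j)"
  proof -
    have "(\<Sum>i<n. y ^ (n - i)) = (\<Sum>i<n. y * y ^ (n - Suc i))"
      by (intro sum.cong refl) (metis Suc_diff_Suc lessThan_iff power_Suc)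
    also have "\<dots> = y * (\<Sum>j<n. y ^ j)" by (simp add: sum_distrib_left[symmetric] sum.nat_diff_reindex)
    finally show ?thesis .
  qed
  have geo: "(1 - y) * (\<Sum>j<n. y ^ j) = 1 - y ^ n" by (rule one_diff_power_eq[symmetric])
  have "(\<Sum>i<Suc n. \<Sum>j<Suc n. y ^ ((i - j) + (j - i))) =
        (\<Sum>i<n. \<Sum>j<n. y ^ ((i - j) + (j - i))) + 2 * (\<Sum>i<n. y ^ (n - i)) + 1"
    by (simp add: sum.distrib)
  moreover have "(1 - y) * (A + 2 * (y * B) + 1) = (1 - y) * A + 2 * y * ((1 - y) * B) + (1 - y)" for A B :: real
    by (simp add: algebra_simps)
  ultimately have "(1 - y) * (\<Sum>i<Suc n. \<Sum>j<Suc n. y ^ ((i - j) + (j - i))) =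
        real n * (1 + y) - 2 * y * (\<Sum>j<n. y ^ j) + 2 * y * ((1 - y) * (\<Sum>j<n. y ^ j)) + (1 - y)"
    unfolding rev Suc.IH[symmetric] by (simp only:)
  then show ?case unfolding geo by (simp add: algebra_simps)
qed simp

lemma space_restrict_interval: "sets E = sets (restrict_space borel {-1..1::real}) \<Longrightarrow> space E = {-1..1}"
  using sets_eq_imp_space_eq[of E] by (simp add: space_restrict_space)

lemma measurable_interval:
  "sets E = sets (restrict_space borel {-1..1::real}) \<Longrightarrow> h \<in> borel_measurable borel \<Longrightarrow> h \<in> borel_measurable E"
  by (simp add: measurable_cong_sets[of E] measurable_restrict_space1)

lemma integrable_interval_bounded:
  fixes h :: "real \<Rightarrow> real"
  assumes E: "finite_measure E" "sets E = sets (restrict_space borel {-1..1})"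
    and "h \<in> borel_measurable borel" "\<And>x. -1 \<le> x \<Longrightarrow> x \<le> 1 \<Longrightarrow> \<bar>h x\<bar> \<le> B"
  shows "integrable E h"
  by (rule finite_measure.integrable_const_bound[OF E(1), of _ B])
     (use assms in \<open>auto intro!: AE_I2 measurable_interval simp: space_restrict_interval\<close>)

lemma integrable_interval_continuous:
  fixes h :: "real \<Rightarrow> real"
  assumes E: "finite_measure E" "sets E = sets (restrict_space borel {-1..1})" and h: "continuous_on UNIV h"
  shows "integrable E h"
proof -
  have "compact (h ` {-1..1})" by (intro compact_continuous_image continuous_on_subset[OF h]) auto
  then obtain B where B: "\<And>x. x \<in> h ` {-1..1} \<Longrightarrow> norm x \<le> B" using compact_imp_bounded bounded_iff by metis
  show ?thesis
    using B by (intro integrable_interval_bounded[OF E, of _ B] borel_measurable_continuous_onI h) auto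
qed

text \<open>
  If \<open>h\<close> has spectral measure \<open>E\<close>, the second moment of \<open>S\<^sub>n(h) / \<surd>n\<close> is the integral of this function
  over \<open>E\<close>.
\<close>

definition toeplitz :: "nat \<Rightarrow> real \<Rightarrow> real" where
  "toeplitz n y = (\<Sum>i<n. \<Sum>j<n. y ^ ((i - j) + (j - i))) / real n"

lemma continuous_on_toeplitz [continuous_intros]: "continuous_on A (toeplitz n)"
  unfolding toeplitz_def[abs_def] divide_inverse by (intro continuous_intros)

text \<open>
  The polynomial \<open>(1 + x + \<dots> + x\<^bsup>n-1\<^esup>) / n\<close>: applied to the operator it is the ergodic average, and as
  a function it governs the convergence of \<open>toeplitz\<close> (see \<open>toeplitz_cesaro\<close>).
\<close>

definition cesaro :: "nat \<Rightarrow> real poly" where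
  "cesaro n = smult (1 / real n) (\<Sum>k<n. [:0, 1:] ^ k)"

lemma poly_cesaro: "poly (cesaro n) x = (\<Sum>k<n. x ^ k) / real n"
  by (simp add: cesaro_def poly_sum)

lemma abs_poly_cesaro_le: assumes "\<bar>x\<bar> \<le> 1" shows "\<bar>poly (cesaro n) x\<bar> \<le> 1"
proof -
  have "\<bar>\<Sum>k<n. x ^ k\<bar> \<le> (\<Sum>k<n. \<bar>x ^ k\<bar>)" by (rule sum_abs)
  also have "\<dots> \<le> (\<Sum>k<n. 1)" using assms by (intro sum_mono) (simp add: power_abs power_le_one)
  finally show ?thesis by (simp add: poly_cesaro divide_le_eq)
qed

lemma poly_cesaro_tendsto: assumes "-1 \<le> x" "x < 1" shows "(\<lambda>n. poly (cesaro n) x) \<longlonglongrightarrow> 0"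
proof (rule Lim_null_comparison)
  show "(\<lambda>n. 2 / (1 - x) / real n) \<longlonglongrightarrow> 0" by real_asymp
  show "\<forall>\<^sub>F n in sequentially. norm (poly (cesaro n) x) \<le> 2 / (1 - x) / real n"
  proof (intro always_eventually allI)
    fix n
    have eq: "(\<Sum>k<n. x ^ k) = (1 - x ^ n) / (1 - x)" using assms by (simp add: sum_gp_strict)
    have "\<bar>x ^ n\<bar> \<le> 1" using assms by (simp add: power_abs power_le_one)
    then have "\<bar>1 - x ^ n\<bar> \<le> 2" by linarith
    then have "\<bar>(1 - x ^ n) / (1 - x)\<bar> \<le> 2 / (1 - x)" using assms by (simp add: abs_divide divide_right_mono)
    then show "norm (poly (cesaro n) x) \<le> 2 / (1 - x) / real n"
      using divide_right_mono[of "\<bar>(1 - x ^ n) / (1 - x)\<bar>" "2 / (1 - x)" "real n"] by (simp add: poly_cesaro eq abs_divide abs_mult)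
  qed
qed

lemma toeplitz_cesaro: "n > 0 \<Longrightarrow> (1 - y) * toeplitz n y = (1 + y) - 2 * y * poly (cesaro n) y"
  using toeplitz_power_sum[of y n] by (simp add: toeplitz_def poly_cesaro field_simps)

lemma abs_toeplitz_le: assumes "-1 \<le> y" "y \<le> 1" shows "\<bar>(1 - y) * toeplitz n y\<bar> \<le> 4"
proof (cases "n = 0")
  case False
  have "\<bar>y * poly (cesaro n) y\<bar> \<le> 1 * 1"
    unfolding abs_mult using assms abs_poly_cesaro_le[of y n] by (intro mult_mono) auto
  then have "\<bar>(1 + y) - 2 * y * poly (cesaro n) y\<bar> \<le> 4" using assms by (simp add: abs_le_iff)
  then show ?thesis using False by (simp add: toeplitz_cesaro)
qed (simp add: toeplitz_def)

lemma toeplitz_nonneg: assumes "-1 \<le> y" "y \<le> 1" shows "0 \<le> toeplitz n y"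
proof (cases "n = 0 \<or> y = 1")
  case True
  then show ?thesis by (auto simp: toeplitz_def)
next
  case False
  have c: "\<bar>poly (cesaro n) y\<bar> \<le> 1" using assms by (intro abs_poly_cesaro_le) auto
  have "0 \<le> (1 + y) - 2 * y * poly (cesaro n) y"
  proof (cases "y \<ge> 0")
    case True
    then have "y * poly (cesaro n) y \<le> y * 1" using c by (intro mult_left_mono) auto
    then show ?thesis using assms by simp
  next
    case y: False
    have "poly (cesaro n) y = (1 - y ^ n) / (1 - y) / real n"
      using y by (simp add: poly_cesaro sum_gp_strict)
    moreover have "\<bar>y ^ n\<bar> \<le> 1" unfolding power_abs using assms by (intro power_le_one) auto
    then have "y ^ n \<le> 1" by linarith
    ultimately have "0 \<le> poly (cesaro n) y" using assms by simp
    then have "y * poly (cesaro n) y \<le> 0" using y by (simp add: mult_nonpos_nonneg)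
    then show ?thesis using assms by simp
  qed
  then have "0 \<le> (1 - y) * toeplitz n y" using False by (subst toeplitz_cesaro) auto
  then show ?thesis using False assms by (simp add: zero_le_mult_iff)
qed

lemma toeplitz_tendsto:
  assumes "-1 \<le> y" "y < 1"
  shows "(\<lambda>n. toeplitz n y) \<longlonglongrightarrow> (1 + y) / (1 - y)"
proof -
  have "(\<lambda>n. ((1 + y) - 2 * y * poly (cesaro n) y) / (1 - y)) \<longlonglongrightarrow> ((1 + y) - 2 * y * 0) / (1 - y)"
    using assms by (intro tendsto_intros poly_cesaro_tendsto) auto
  moreover have "\<forall>\<^sub>F n in sequentially. ((1 + y) - 2 * y * poly (cesaro n) y) / (1 - y) = toeplitz n y"
    using eventually_gt_at_top[of 0]
  proof eventually_elim
    case (elim n)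
    from toeplitz_cesaro[OF this, of y] show ?case using assms by (simp add: field_simps)
  qed
  ultimately show ?thesis by (simp add: tendsto_cong)
qed

section \<open>Asymptotic variance\<close>

context markov_kernel
begin

lemma part_sum_cong_AE:
  assumes "AE x in \<pi>. g x = h x"
  shows "AE \<omega> in chain. part_sum g n \<omega> = part_sum h n \<omega>"
proof -
  have "AE \<omega> in chain. \<forall>i\<in>{..<n}. g (\<omega> i) = h (\<omega> i)"
    using AE_coord[OF assms] by (intro AE_finite_allI) auto
  then show ?thesis by eventually_elim (simp add: part_sum_def)
qed

text \<open>
  For \<open>h\<close> with \<open>\<pi> h = 0\<close> this is the variance of \<open>S\<^sub>n(h) / \<surd>n\<close>.
\<close>

definition scaled_var :: "('a \<Rightarrow> real) \<Rightarrow> nat \<Rightarrow> real" where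
  "scaled_var h n = (\<integral>\<omega>. (part_sum h n \<omega>)\<^sup>2 \<partial>chain) / real n"

lemma scaled_var_nonneg: "0 \<le> scaled_var h n" by (simp add: scaled_var_def)

lemma scaled_var_cong_AE:
  assumes "g \<in> borel_measurable \<pi>" "h \<in> borel_measurable \<pi>" "AE x in \<pi>. g x = h x"
  shows "scaled_var g n = scaled_var h n"
  unfolding scaled_var_def using part_sum_cong_AE[OF assms(3), of n] assms
  by (intro arg_cong[where f="\<lambda>z. z / real n"] integral_cong_AE) auto

lemma scaled_var_add_le:
  assumes "g \<in> L2 \<pi>" "h \<in> L2 \<pi>"
  shows "scaled_var (\<lambda>x. g x + h x) n \<le> 2 * scaled_var g n + 2 * scaled_var h n"
proof -
  have "part_sum (\<lambda>x. g x + h x) n = (\<lambda>\<omega>. part_sum g n \<omega> + part_sum h n \<omega>)"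
    by (simp add: part_sum_def sum.distrib fun_eq_iff)
  then show ?thesis
    using ip_add_le[OF part_sum_L2[OF assms(1), of n] part_sum_L2[OF assms(2), of n]]
    by (simp add: scaled_var_def ip_self add_divide_distrib[symmetric] divide_right_mono)
qed

end

context reversible_kernel
begin

text \<open>
  This agrees with \<open>is_spectral_measure\<close> except that \<open>h\<close> is not centred first, which keeps the
  operator calculus linear.
\<close>

definition spectral :: "('a \<Rightarrow> real) \<Rightarrow> real measure \<Rightarrow> bool" where
  "spectral h E \<longleftrightarrow> finite_measure E \<and> sets E = sets (restrict_space borel {-1..1}) \<and>
     (\<forall>n. ip \<pi> h ((op ^^ n) h) = (\<integral>x. x ^ n \<partial>E))"

lemma spectralD: assumes "spectral h E" shows spectral_finite: "finite_measure E"
  and spectral_sets: "sets E = sets (restrict_space borel {-1..1})" and spectral_moment: "ip \<pi> h ((op ^^ n) h) = (\<integral>x. x ^ n \<partial>E)"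
  using assms by (auto simp: spectral_def)

lemma spectral_space: "spectral h E \<Longrightarrow> space E = {-1..1}"
  by (rule space_restrict_interval[OF spectral_sets])

lemma spectral_exists: "h \<in> L2 \<pi> \<Longrightarrow> \<exists>E. spectral h E"
  unfolding spectral_def by (rule spectral_measure_exists)

lemma spectral_integrable: "spectral h E \<Longrightarrow> continuous_on UNIV k \<Longrightarrow> integrable E k" for k :: "real \<Rightarrow> real"
  using integrable_interval_continuous[OF spectral_finite spectral_sets] by blast

lemma poly_moment_spectral: assumes "spectral h E" shows "poly_moment h p = (\<integral>x. poly p x \<partial>E)"
proof -
  have "(\<integral>x. poly p x \<partial>E) = (\<Sum>i\<le>degree p. coeff p i * (\<integral>x. x ^ i \<partial>E))"
    unfolding poly_altdef
    by (subst Bochner_Integration.integral_sum) (auto intro!: spectral_integrable[OF assms] continuous_intros)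
  then show ?thesis using spectral_moment[OF assms] by (simp add: poly_moment_def)
qed

lemma op_pow_poly_op_AE:
  assumes h: "h \<in> L2 \<pi>"
  shows "AE x in \<pi>. (op ^^ n) (poly_op p h) x = (\<Sum>i\<le>degree p. coeff p i * (op ^^ (i + n)) h x)"
proof (induction n)
  case 0 show ?case by (simp add: poly_op_def)
next
  case (Suc n)
  have "AE x in \<pi>. op ((op ^^ n) (poly_op p h)) x = op (\<lambda>x. \<Sum>i\<le>degree p. coeff p i * (op ^^ (i + n)) h x) x"
    using Suc L2_measurable[OF op_pow_L2[OF poly_op_L2[OF h]]] L2_measurable[OF L2_sum[OF op_pow_L2[OF h]]]
    by (intro op_cong_AE)
  moreover have "AE x in \<pi>. op (\<lambda>x. \<Sum>i\<le>degree p. coeff p i * (op ^^ (i + n)) h x) x = (\<Sum>i\<le>degree p. coeff p i * op ((op ^^ (i + n)) h) x)"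
    by (intro op_sum_AE L2_integrable op_pow_L2 h)
  ultimately show ?case by eventually_elim simp
qed

lemma ip_poly_op_op_pow_poly_op:
  assumes h: "h \<in> L2 \<pi>"
  shows "ip \<pi> (poly_op p h) ((op ^^ n) (poly_op p h)) = poly_moment h ([:0, 1:] ^ n * (p * p))"
proof -
  have "ip \<pi> (poly_op p h) ((op ^^ n) (poly_op p h)) = ip \<pi> (\<lambda>x. \<Sum>i\<le>degree p. coeff p i * (op ^^ (i + 0)) h x) (\<lambda>x. \<Sum>i\<le>degree p. coeff p i * (op ^^ (i + n)) h x)"
    using op_pow_poly_op_AE[OF h, of n p] L2_measurable[OF op_pow_L2[OF poly_op_L2[OF h]]] L2_measurable[OF L2_sum[OF op_pow_L2[OF h]]] L2_measurable[OF poly_op_L2[OF h]]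
    by (intro ip_cong_AE) (simp_all add: poly_op_def)
  also have "\<dots> = poly_moment h ([:0, 1:] ^ (0 + n) * (p * p))"
    unfolding poly_moment_mult[OF h, symmetric] by (intro ip_sum_sum op_pow_L2 h)
  finally show ?thesis by simp
qed

text \<open>
  The spectral measure of \<open>p(K) h\<close> has density \<open>p\<^sup>2\<close> with respect to that of \<open>h\<close>.
\<close>

lemma scaled_var_poly_op:
  assumes h: "h \<in> L2 \<pi>" and E: "spectral h E"
  shows "scaled_var (poly_op p h) n = (\<integral>x. toeplitz n x * (poly p x)\<^sup>2 \<partial>E)"
proof -
  have "(\<integral>\<omega>. (part_sum (poly_op p h) n \<omega>)\<^sup>2 \<partial>chain) = (\<Sum>i<n. \<Sum>j<n. \<integral>x. x ^ ((i - j) + (j - i)) * (poly p x)\<^sup>2 \<partial>E)"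
  proof -
    have "(\<lambda>x. x ^ k * (poly p x)\<^sup>2) = poly ([:0, 1:] ^ k * (p * p))" for k
      by (rule ext) (simp add: power2_eq_square)
    then show ?thesis
      by (simp only: second_moment_part_sum[OF poly_op_L2[OF h]] ip_poly_op_op_pow_poly_op[OF h] poly_moment_spectral[OF E])
  qed
  also have "\<dots> = (\<integral>x. (\<Sum>i<n. \<Sum>j<n. x ^ ((i - j) + (j - i)) * (poly p x)\<^sup>2) \<partial>E)"
    by (subst Bochner_Integration.integral_sum, intro spectral_integrable[OF E] continuous_intros)
       (intro sum.cong refl Bochner_Integration.integral_sum[symmetric] spectral_integrable[OF E] continuous_intros)
  finally have "(\<integral>\<omega>. (part_sum (poly_op p h) n \<omega>)\<^sup>2 \<partial>chain) = (\<integral>x. (\<Sum>i<n. \<Sum>j<n. x ^ ((i - j) + (j - i)) * (poly p x)\<^sup>2) \<partial>E)" .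
  then show ?thesis by (simp add: scaled_var_def toeplitz_def sum_distrib_right)
qed

lemma poly_op_1 [simp]: "poly_op 1 h = h"
  by (simp add: poly_op_def[abs_def])

lemma scaled_var_spectral:
  assumes h: "h \<in> L2 \<pi>" and E: "spectral h E"
  shows "scaled_var h n = (\<integral>x. toeplitz n x \<partial>E)"
  using scaled_var_poly_op[OF h E, of 1 n] by simp

lemma poly_op_le: "degree p \<le> N \<Longrightarrow> poly_op p h x = (\<Sum>i\<le>N. coeff p i * (op ^^ i) h x)"
  unfolding poly_op_def by (intro sum.mono_neutral_left) (auto simp: coeff_eq_0)

lemma poly_op_diff: "poly_op (p - q) h x = poly_op p h x - poly_op q h x"
proof -
  let ?N = "max (degree p) (degree q)"
  have "poly_op p h x = (\<Sum>i\<le>?N. coeff p i * (op ^^ i) h x)" "poly_op q h x = (\<Sum>i\<le>?N. coeff q i * (op ^^ i) h x)"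
    "poly_op (p - q) h x = (\<Sum>i\<le>?N. coeff (p - q) i * (op ^^ i) h x)"
    by (intro poly_op_le degree_diff_le; simp)+
  then show ?thesis by (simp add: left_diff_distrib sum_subtractf)
qed

lemma op_poly_op_eq_AE:
  assumes h: "h \<in> L2 \<pi>"
  shows "AE x in \<pi>. op (poly_op p h) x = poly_op ([:0, 1:] * p) h x"
  using op_poly_op_AE[OF h, of p]
proof eventually_elim
  case (elim x)
  have "poly_op ([:0, 1:] * p) h x = (\<Sum>i\<le>Suc (degree p). coeff ([:0, 1:] * p) i * (op ^^ i) h x)"
    by (intro poly_op_le) (simp add: degree_pCons_le)
  also have "\<dots> = (\<Sum>i\<le>degree p. coeff p i * (op ^^ (i + 1)) h x)"
    by (subst sum.atMost_Suc_shift) simp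
  finally show ?case using elim by simp
qed

text \<open>
  The polynomial \<open>1 - (1 + x + \<dots> + x\<^bsup>n-1\<^esup>) / n\<close> vanishes at \<open>1\<close>, so it is divisible by \<open>1 - x\<close>. On the
  operator side this solves the Poisson equation for \<open>h - A\<^sub>n h\<close>.
\<close>

lemma cesaro_remainder_AE:
  assumes h: "h \<in> L2 \<pi>" and n: "n > 0"
  obtains q where "AE x in \<pi>. h x - poly_op (cesaro n) h x = poly_op q h x - op (poly_op q h) x"
proof -
  have "poly (1 - cesaro n) 1 = 0" using n by (simp add: poly_cesaro)
  then obtain q where q: "1 - cesaro n = [:-1, 1:] * q" by (metis poly_eq_0_iff_dvd dvd_def)
  have "1 - cesaro n = (- q) - [:0, 1:] * (- q)" unfolding q by simp
  then have "h x - poly_op (cesaro n) h x = poly_op (- q) h x - poly_op ([:0, 1:] * (- q)) h x" for x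
    by (metis poly_op_diff poly_op_1)
  then have "AE x in \<pi>. h x - poly_op (cesaro n) h x = poly_op (- q) h x - op (poly_op (- q) h) x"
    using op_poly_op_eq_AE[OF h, of "- q"] by (auto elim!: eventually_mono)
  then show ?thesis by (rule that)
qed

lemma ip_cesaro:
  assumes h: "h \<in> L2 \<pi>" and E: "spectral h E"
  shows "ip \<pi> (poly_op (cesaro n) h) (poly_op (cesaro n) h) = (\<integral>x. (poly (cesaro n) x)\<^sup>2 \<partial>E)"
  using ip_poly_op_poly_op[OF h, of "cesaro n" "cesaro n"] poly_moment_spectral[OF E] by (simp add: power2_eq_square)

lemma coboundary_eq_poly_op_AE:
  assumes h: "h \<in> L2 \<pi>"
  shows "AE x in \<pi>. h x - op h x = poly_op [:1, -1:] h x"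
proof -
  have "[:1, -1:] = 1 - [:0, 1:] * (1 :: real poly)" by (simp add: one_pCons)
  then have "poly_op [:1, -1:] h x = poly_op 1 h x - poly_op ([:0, 1:] * 1) h x" for x by (metis poly_op_diff)
  then show ?thesis using op_poly_op_eq_AE[OF h, of 1] by (auto elim!: eventually_mono)
qed

lemma scaled_var_coboundary:
  assumes h: "h \<in> L2 \<pi>" and E: "spectral h E"
  shows "scaled_var (\<lambda>x. h x - op h x) n = (\<integral>x. toeplitz n x * (1 - x)\<^sup>2 \<partial>E)"
proof -
  have "scaled_var (\<lambda>x. h x - op h x) n = scaled_var (poly_op [:1, -1:] h) n"
    using coboundary_eq_poly_op_AE[OF h] L2_measurable[OF poly_op_L2[OF h]] L2_measurable[OF h]
    by (intro scaled_var_cong_AE) auto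
  then show ?thesis by (simp add: scaled_var_poly_op[OF h E])
qed

text \<open>
  In spectral terms, \<open>T\<^sub>n(x) (1 - x)\<^sup>2 \<le> 4 (1 - x) \<le> 8\<close>.
\<close>

lemma scaled_var_coboundary_le:
  assumes h: "h \<in> L2 \<pi>"
  shows "scaled_var (\<lambda>x. h x - op h x) n \<le> 8 * ip \<pi> h h"
proof -
  obtain E where E: "spectral h E" using spectral_exists[OF h] by blast
  have "scaled_var (\<lambda>x. h x - op h x) n = (\<integral>x. toeplitz n x * (1 - x)\<^sup>2 \<partial>E)"
    by (rule scaled_var_coboundary[OF h E])
  also have "\<dots> \<le> (\<integral>x. 8 * x ^ 0 \<partial>E)"
  proof (rule integral_mono)
    fix x assume "x \<in> space E"
    then have x: "-1 \<le> x" "x \<le> 1" using spectral_space[OF E] by auto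
    have "toeplitz n x * (1 - x)\<^sup>2 = (1 - x) * ((1 - x) * toeplitz n x)"
      by (simp add: power2_eq_square)
    also have "\<dots> \<le> (1 - x) * 4" using x abs_toeplitz_le[OF x, of n] by (intro mult_left_mono) auto
    also have "\<dots> \<le> 8" using x by simp
    finally show "toeplitz n x * (1 - x)\<^sup>2 \<le> 8 * x ^ 0" by simp
  qed (intro spectral_integrable[OF E] continuous_intros)+
  also have "\<dots> = 8 * ip \<pi> h h" unfolding integral_mult_right_zero using spectral_moment[OF E, of 0] by simp
  finally show ?thesis .
qed

text \<open>
  The limit is the second moment \<open>\<parallel>h\<parallel>\<^sup>2 - \<parallel>K h\<parallel>\<^sup>2\<close> of the martingale difference \<open>h(X\<^sub>1) - K h(X\<^sub>0)\<close>, and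
  it is also \<open>\<integral> (1 - x\<^sup>2) dE\<close>.
\<close>

lemma scaled_var_coboundary_tendsto:
  assumes h: "h \<in> L2 \<pi>"
  shows "(\<lambda>n. scaled_var (\<lambda>x. h x - op h x) n) \<longlonglongrightarrow> ip \<pi> h h - ip \<pi> (op h) (op h)"
proof -
  obtain E where E: "spectral h E" using spectral_exists[OF h] by blast
  have lim: "(\<lambda>n. \<integral>x. toeplitz n x * (1 - x)\<^sup>2 \<partial>E) \<longlonglongrightarrow> (\<integral>x. 1 - x ^ 2 \<partial>E)"
  proof (rule integral_dominated_convergence[where w="\<lambda>_. 8"])
    show "integrable E (\<lambda>_. 8 :: real)" by (intro spectral_integrable[OF E] continuous_intros)
    show "AE x in E. (\<lambda>n. toeplitz n x * (1 - x)\<^sup>2) \<longlonglongrightarrow> 1 - x ^ 2"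
    proof (rule AE_I2)
      fix x assume "x \<in> space E"
      then have x: "-1 \<le> x" "x \<le> 1" using spectral_space[OF E] by auto
      show "(\<lambda>n. toeplitz n x * (1 - x)\<^sup>2) \<longlonglongrightarrow> 1 - x ^ 2"
      proof (cases "x = 1")
        case False
        then have "(\<lambda>n. toeplitz n x * (1 - x)\<^sup>2) \<longlonglongrightarrow> (1 + x) / (1 - x) * (1 - x)\<^sup>2"
          using x by (intro tendsto_mult toeplitz_tendsto tendsto_const) auto
        also have "(1 + x) / (1 - x) * (1 - x)\<^sup>2 = 1 - x ^ 2" using False by (simp add: power2_eq_square field_simps)
        finally show ?thesis .
      qed simp
    qed
    show "AE x in E. norm (toeplitz n x * (1 - x)\<^sup>2) \<le> 8" for n
    proof (rule AE_I2)
      fix x assume "x \<in> space E"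
      then have x: "-1 \<le> x" "x \<le> 1" using spectral_space[OF E] by auto
      have "norm (toeplitz n x * (1 - x)\<^sup>2) = \<bar>1 - x\<bar> * \<bar>(1 - x) * toeplitz n x\<bar>"
        by (simp add: power2_eq_square abs_mult)
      also have "\<dots> \<le> 2 * 4" using x abs_toeplitz_le[OF x, of n] by (intro mult_mono) auto
      finally show "norm (toeplitz n x * (1 - x)\<^sup>2) \<le> 8" by simp
    qed
  qed (intro borel_measurable_integrable spectral_integrable[OF E] continuous_intros)+
  have "(\<integral>x. 1 - x ^ 2 \<partial>E) = (\<integral>x. x ^ 0 \<partial>E) - (\<integral>x. x ^ 2 \<partial>E)"
    by (subst Bochner_Integration.integral_diff[symmetric]) (auto intro!: spectral_integrable[OF E] continuous_intros)
  also have "\<dots> = ip \<pi> h h - ip \<pi> (op h) (op h)"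
    using spectral_moment[OF E, of 0] spectral_moment[OF E, of 2] ip_op_pow[OF h h, of 1 1] by (simp add: numeral_2_eq_2)
  finally show ?thesis using lim unfolding scaled_var_coboundary[OF h E] by simp
qed

end

section \<open>Characteristic functions of bounded martingales\<close>

lemma norm_iexp_diff_le: "cmod (iexp a - iexp b) \<le> \<bar>a - b\<bar>"
proof -
  have "iexp a - iexp b = iexp b * (iexp (a - b) - 1)"
    by (simp add: algebra_simps exp_add[symmetric])
  then have "cmod (iexp a - iexp b) = cmod (iexp (a - b) - 1)"
    by (simp add: norm_mult)
  also have "\<dots> \<le> \<bar>a - b\<bar>" using iexp_approx1[of "a - b" 0] by simp
  finally show ?thesis .
qed

lemma norm_iexp_second_order:
  "cmod (iexp x - (1 + \<i> * complex_of_real x - complex_of_real (x\<^sup>2 / 2))) \<le> \<bar>x\<bar> ^ 3"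
proof -
  have "cmod (iexp x - (\<Sum>k\<le>2. (\<i> * x) ^ k / fact k)) \<le> \<bar>x\<bar> ^ 3 / fact 3"
    using iexp_approx1[of x 2] by (simp add: eval_nat_numeral)
  also have "\<dots> \<le> \<bar>x\<bar> ^ 3"
  proof -
    have "fact 3 = (6 :: real)" by (simp add: eval_nat_numeral)
    then show ?thesis using zero_le_power[of "\<bar>x\<bar>" 3] by simp
  qed
  also have "(\<Sum>k\<le>2. (\<i> * complex_of_real x) ^ k / fact k) = 1 + \<i> * complex_of_real x - complex_of_real (x\<^sup>2 / 2)"
    by (simp add: numeral_2_eq_2 power2_eq_square mult_ac)
  finally show ?thesis .
qed

lemma exp_minus_second_order:
  fixes a :: real assumes "a \<ge> 0" shows "\<bar>exp (- a) - (1 - a)\<bar> \<le> a\<^sup>2"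
proof -
  have 1: "1 - a \<le> exp (- a)" using exp_ge_add_one_self[of "- a"] by simp
  have "exp (- a) \<le> 1 - a + a\<^sup>2"
  proof -
    have "1 \<le> (1 + a) * (1 - a + a\<^sup>2)"
      using assms by (simp add: algebra_simps power2_eq_square)
    also have "\<dots> \<le> exp a * (1 - a + a\<^sup>2)"
    proof (rule mult_right_mono)
      show "1 + a \<le> exp a" by (rule exp_ge_add_one_self)
      show "0 \<le> 1 - a + a\<^sup>2" using sum_squares_bound[of 1 a] assms by (simp add: power2_eq_square)
    qed
    finally show ?thesis by (simp add: exp_minus field_simps)
  qed
  with 1 show ?thesis by simp
qed

lemma abs_exp_minus_diff_le:
  fixes a b :: real assumes "0 \<le> a" "0 \<le> b" shows "\<bar>exp (- a) - exp (- b)\<bar> \<le> \<bar>a - b\<bar>"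
proof -
  have *: "exp (- a) - exp (- b) \<le> b - a" if "0 \<le> a" "a \<le> b" for a b :: real
  proof -
    have "exp (- a) - exp (- b) = exp (- a) * (1 - exp (a - b))" by (simp add: algebra_simps exp_add[symmetric])
    also have "\<dots> \<le> 1 * (b - a)"
    proof (rule mult_mono)
      show "1 - exp (a - b) \<le> b - a" using exp_ge_add_one_self[of "a - b"] by linarith
    qed (use that in auto)
    finally show ?thesis by simp
  qed
  show ?thesis
  proof (cases "a \<le> b")
    case True
    then have "exp (- b) \<le> exp (- a)" by simp
    then show ?thesis using *[of a b] True assms by simp
  next
    case False
    then have "exp (- a) \<le> exp (- b)" by simp
    then show ?thesis using *[of b a] False assms by simp
  qed
qed

lemma summation_by_parts:
  fixes y :: "nat \<Rightarrow> 'b :: comm_ring"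
  shows "(\<Sum>k<Suc n. y k * (q k - q (Suc k))) = y 0 * q 0 - y n * q (Suc n) + (\<Sum>k<n. (y (Suc k) - y k) * q (Suc k))"
  by (induction n) (simp_all add: algebra_simps)

text \<open>
  Summation by parts: if \<open>y\<close> varies slowly, a sum of increments of a bounded sequence with weights \<open>y\<close>
  stays small compared with the number of terms.
\<close>

lemma norm_sum_telescope_le:
  fixes y :: "nat \<Rightarrow> complex" and q :: "nat \<Rightarrow> real"
  assumes y: "\<And>k. k < n \<Longrightarrow> cmod (y k) \<le> 1" and d: "\<And>k. Suc k < n \<Longrightarrow> cmod (y (Suc k) - y k) \<le> d"
    and q: "\<And>k. k \<le> n \<Longrightarrow> \<bar>q k\<bar> \<le> Q" and d0: "0 \<le> d"
  shows "cmod (\<Sum>k<n. y k * complex_of_real (q k - q (Suc k))) \<le> Q * (2 + real n * d)"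
proof (cases n)
  case 0
  then show ?thesis using q[of 0] by simp
next
  case (Suc m)
  have Q0: "0 \<le> Q" using q[of 0] by simp
  have le: "cmod (a * complex_of_real (q k)) \<le> c * Q" if "cmod a \<le> c" "k \<le> n" for a k c
    unfolding norm_mult using that q[of k] by (intro mult_mono) (auto intro: order_trans[OF norm_ge_zero])
  have "(\<Sum>k<n. y k * complex_of_real (q k - q (Suc k))) =
        y 0 * complex_of_real (q 0) - y m * complex_of_real (q (Suc m)) + (\<Sum>k<m. (y (Suc k) - y k) * complex_of_real (q (Suc k)))"
    unfolding Suc of_real_diff by (rule summation_by_parts)
  also have "cmod \<dots> \<le> cmod (y 0 * complex_of_real (q 0)) + cmod (y m * complex_of_real (q (Suc m)))
        + cmod (\<Sum>k<m. (y (Suc k) - y k) * complex_of_real (q (Suc k)))"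
    by (intro order_trans[OF norm_triangle_ineq] add_mono norm_triangle_ineq4 order_refl)
  also have "\<dots> \<le> 1 * Q + 1 * Q + (\<Sum>k<m. d * Q)"
    using Suc by (intro add_mono le y order_trans[OF norm_sum] sum_mono d) auto
  also have "\<dots> = Q * (2 + real m * d)" by (simp add: algebra_simps)
  also have "\<dots> \<le> Q * (2 + real n * d)"
    using Suc Q0 d0 by (intro mult_left_mono add_left_mono mult_right_mono) auto
  finally show ?thesis .
qed

lemma (in prob_space) expectation_abs_le_sqrt:
  fixes X :: "'a \<Rightarrow> real"
  assumes X: "X \<in> borel_measurable M" and int: "integrable M (\<lambda>x. (X x)\<^sup>2)"
  shows "(\<integral>x. \<bar>X x\<bar> \<partial>M) \<le> sqrt (\<integral>x. (X x)\<^sup>2 \<partial>M)"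
proof (rule real_le_rsqrt)
  have "integrable M X" by (rule square_integrable_imp_integrable[OF X int])
  then have "variance (\<lambda>x. \<bar>X x\<bar>) = (\<integral>x. (X x)\<^sup>2 \<partial>M) - (\<integral>x. \<bar>X x\<bar> \<partial>M)\<^sup>2"
    using int by (subst variance_eq) auto
  moreover have "0 \<le> variance (\<lambda>x. \<bar>X x\<bar>)" by simp
  ultimately show "(\<integral>x. \<bar>X x\<bar> \<partial>M)\<^sup>2 \<le> (\<integral>x. (X x)\<^sup>2 \<partial>M)" by linarith
qed

lemma (in prob_space) norm_char_diff_le:
  assumes [measurable]: "X \<in> borel_measurable M" "Y \<in> borel_measurable M"
    and int: "integrable M (\<lambda>x. (X x - Y x)\<^sup>2)"
  shows "cmod ((\<integral>x. iexp (t * X x) \<partial>M) - (\<integral>x. iexp (t * Y x) \<partial>M)) \<le> \<bar>t\<bar> * sqrt (\<integral>x. (X x - Y x)\<^sup>2 \<partial>M)"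
proof -
  have Z: "integrable M (\<lambda>x. X x - Y x)"
    by (rule square_integrable_imp_integrable) (use int in auto)
  have int_iexp: "integrable M (\<lambda>x. iexp (t * V x))" if [measurable]: "V \<in> borel_measurable M" for V
    by (rule integrable_const_bound[where B=1]) auto
  have "(\<integral>x. iexp (t * X x) \<partial>M) - (\<integral>x. iexp (t * Y x) \<partial>M) = (\<integral>x. iexp (t * X x) - iexp (t * Y x) \<partial>M)"
    by (intro Bochner_Integration.integral_diff[symmetric] int_iexp) auto
  also have "cmod \<dots> \<le> (\<integral>x. cmod (iexp (t * X x) - iexp (t * Y x)) \<partial>M)"
    by (rule integral_norm_bound)
  also have "\<dots> \<le> (\<integral>x. \<bar>t\<bar> * \<bar>X x - Y x\<bar> \<partial>M)"
  proof (rule integral_mono)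
    show "integrable M (\<lambda>x. cmod (iexp (t * X x) - iexp (t * Y x)))"
      by (intro integrable_norm Bochner_Integration.integrable_diff int_iexp) auto
    show "integrable M (\<lambda>x. \<bar>t\<bar> * \<bar>X x - Y x\<bar>)" using Z by simp
    show "cmod (iexp (t * X x) - iexp (t * Y x)) \<le> \<bar>t\<bar> * \<bar>X x - Y x\<bar>" for x
      using norm_iexp_diff_le[of "t * X x" "t * Y x"] by (simp add: abs_mult[symmetric] right_diff_distrib)
  qed
  also have "\<dots> = \<bar>t\<bar> * (\<integral>x. \<bar>X x - Y x\<bar> \<partial>M)" by simp
  also have "\<dots> \<le> \<bar>t\<bar> * sqrt (\<integral>x. (X x - Y x)\<^sup>2 \<partial>M)"
    by (intro mult_left_mono expectation_abs_le_sqrt int) auto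
  finally show ?thesis .
qed

text \<open>
  A quantitative martingale central limit theorem. Hypothesis \<open>orth1\<close> says that the \<open>D k\<close> are
  martingale differences; \<open>orth2\<close> says that the conditional variances exceed \<open>\<sigma>2\<close> by an increment
  \<open>q k - q (k + 1)\<close> of a bounded sequence plus a small error \<open>e k\<close>, so that they average out. Both are
  tested only against the exponentials \<open>Y k\<close> of the partial sums.

  With \<open>l = exp (- s\<^sup>2 \<sigma>2 / 2)\<close>, the difference \<open>E[Y n] - l\<^sup>n\<close> telescopes into the terms
  \<open>l\<^bsup>n-k-1\<^esup> E[Y k (exp (i s D k) - l)]\<close>. A second-order expansion of the bracket leaves a cubic
  remainder, a term removed by \<open>orth1\<close>, and \<open>s\<^sup>2 / 2\<close> times \<open>(D k)\<^sup>2 - \<sigma>2\<close>. By \<open>orth2\<close> the last one is an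
  increment of \<open>q\<close>, to be summed by parts against the slowly varying weights, plus \<open>e k\<close>.
\<close>

lemma (in prob_space) bounded_martingale_char_estimate:
  fixes D q e :: "nat \<Rightarrow> 'a \<Rightarrow> real" and s \<sigma>2 C Q \<eta> :: real
  defines "Y k \<omega> \<equiv> iexp (s * (\<Sum>j<k. D j \<omega>))"
  assumes meas [measurable]: "\<And>k. D k \<in> borel_measurable M" "\<And>k. q k \<in> borel_measurable M" "\<And>k. e k \<in> borel_measurable M"
    and D_bound: "\<And>k \<omega>. \<omega> \<in> space M \<Longrightarrow> \<bar>D k \<omega>\<bar> \<le> C"
    and q_bound: "\<And>k \<omega>. \<omega> \<in> space M \<Longrightarrow> \<bar>q k \<omega>\<bar> \<le> Q"
    and e_int: "\<And>k. integrable M (e k)" and e_bound: "\<And>k. (\<integral>\<omega>. \<bar>e k \<omega>\<bar> \<partial>M) \<le> \<eta>"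
    and \<sigma>2: "0 \<le> \<sigma>2"
    and orth1: "\<And>k. (\<integral>\<omega>. Y k \<omega> * complex_of_real (D k \<omega>) \<partial>M) = 0"
    and orth2: "\<And>k. (\<integral>\<omega>. Y k \<omega> * complex_of_real ((D k \<omega>)\<^sup>2 - \<sigma>2 - (q k \<omega> - q (Suc k) \<omega>) - e k \<omega>) \<partial>M) = 0"
  shows "cmod ((\<integral>\<omega>. Y n \<omega> \<partial>M) - complex_of_real (exp (- (s\<^sup>2 * \<sigma>2 / 2)) ^ n)) \<le>
           real n * ((C * \<bar>s\<bar>) ^ 3 + (s\<^sup>2 * \<sigma>2 / 2)\<^sup>2) + s\<^sup>2 / 2 * (Q * (2 + real n * (C * \<bar>s\<bar> + s\<^sup>2 * \<sigma>2 / 2)) + real n * \<eta>)"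
proof -
  define a where "a = s\<^sup>2 * \<sigma>2 / 2"
  have a0: "0 \<le> a" using \<sigma>2 by (simp add: a_def)
  define l where "l = exp (- a)"
  have l: "0 < l" "l \<le> 1" using a0 by (simp_all add: l_def)
  define y where "y k \<omega> = complex_of_real (l ^ (n - Suc k)) * Y k \<omega>" for k \<omega>
  have Y1: "cmod (Y k \<omega>) = 1" for k \<omega> by (simp add: Y_def)
  have y1: "cmod (y k \<omega>) \<le> 1" for k \<omega> using l by (simp add: y_def norm_mult Y1 norm_power power_le_one)
  have [measurable]: "Y k \<in> borel_measurable M" for k unfolding Y_def[abs_def] by measurable
  have [measurable]: "y k \<in> borel_measurable M" for k unfolding y_def[abs_def] by measurable
  have int_bounded: "integrable M h" if "h \<in> borel_measurable M" "\<And>\<omega>. \<omega> \<in> space M \<Longrightarrow> norm (h \<omega>) \<le> B" for h :: "'a \<Rightarrow> complex" and B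
    using that by (intro integrable_const_bound[where B=B]) auto
  have Y_Suc: "Y (Suc k) \<omega> = Y k \<omega> * iexp (s * D k \<omega>)" for k \<omega>
    by (simp add: Y_def algebra_simps exp_add[symmetric])
  \<comment> \<open>The remainder of the second-order expansion, both of \<open>exp (i s D k)\<close> and of \<open>l\<close>.\<close>
  define r where "r k \<omega> = iexp (s * D k \<omega>) - complex_of_real l - \<i> * complex_of_real (s * D k \<omega>)
      + complex_of_real (s\<^sup>2 / 2 * ((D k \<omega>)\<^sup>2 - \<sigma>2))" for k \<omega>
  have [measurable]: "r k \<in> borel_measurable M" for k unfolding r_def[abs_def] by measurable
  have sD: "\<bar>s * D k \<omega>\<bar> \<le> C * \<bar>s\<bar>" if "\<omega> \<in> space M" for k \<omega>
    using mult_left_mono[OF D_bound[OF that, of k], of "\<bar>s\<bar>"] by (simp add: abs_mult mult.commute[of C])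
  have r_bound: "cmod (r k \<omega>) \<le> (C * \<bar>s\<bar>) ^ 3 + a\<^sup>2" if "\<omega> \<in> space M" for k \<omega>
  proof -
    define A where "A = iexp (s * D k \<omega>) - (1 + \<i> * complex_of_real (s * D k \<omega>) - complex_of_real ((s * D k \<omega>)\<^sup>2 / 2))"
    define b where "b = exp (- a) - (1 - a)"
    have "r k \<omega> = A - complex_of_real b"
      by (simp add: A_def b_def r_def l_def a_def power_mult_distrib algebra_simps diff_divide_distrib)
    also have "cmod \<dots> \<le> cmod A + \<bar>b\<bar>"
      using norm_triangle_ineq4[of A "complex_of_real b"] by simp
    also have "\<dots> \<le> \<bar>s * D k \<omega>\<bar> ^ 3 + \<bar>exp (- a) - (1 - a)\<bar>"
      using norm_iexp_second_order[of "s * D k \<omega>"] by (simp only: A_def b_def add_right_mono)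
    also have "\<dots> \<le> (C * \<bar>s\<bar>) ^ 3 + a\<^sup>2"
      using sD[OF that, of k] by (intro add_mono power_mono exp_minus_second_order a0) auto
    finally show ?thesis .
  qed
  define Z where "Z k = (\<integral>\<omega>. Y k \<omega> \<partial>M)" for k
  have step: "complex_of_real (l ^ (n - Suc k)) * Z (Suc k) - complex_of_real (l ^ (n - k)) * Z k =
      (\<integral>\<omega>. y k \<omega> * r k \<omega> \<partial>M) - complex_of_real (s\<^sup>2 / 2) * (\<integral>\<omega>. y k \<omega> * complex_of_real (q k \<omega> - q (Suc k) \<omega>) \<partial>M)
      - complex_of_real (s\<^sup>2 / 2) * (\<integral>\<omega>. y k \<omega> * complex_of_real (e k \<omega>) \<partial>M)" if k: "k < n" for k
  proof -
    define c where "c = complex_of_real (l ^ (n - Suc k))"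
    have c: "complex_of_real (l ^ (n - k)) = c * complex_of_real l"
      using k unfolding c_def by (metis Suc_diff_Suc mult.commute of_real_mult power_Suc)
    have i1: "integrable M (\<lambda>\<omega>. Y k \<omega> * complex_of_real (D k \<omega>))"
      using D_bound by (intro int_bounded[of _ C]) (auto simp: norm_mult Y1)
    have i2: "integrable M (\<lambda>\<omega>. Y k \<omega> * complex_of_real ((D k \<omega>)\<^sup>2 - \<sigma>2 - (q k \<omega> - q (Suc k) \<omega>) - e k \<omega>))"
    proof (rule Bochner_Integration.integrable_bound)
      have D2: "integrable M (\<lambda>\<omega>. (D k \<omega>)\<^sup>2)"
      proof (rule integrable_const_bound[where B="C\<^sup>2"])
        show "AE \<omega> in M. norm ((D k \<omega>)\<^sup>2) \<le> C\<^sup>2"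
          using power_mono[OF D_bound[of _ k], of _ 2] by (intro AE_I2) simp
      qed measurable
      have qi: "integrable M (q k)" for k
        using q_bound by (intro integrable_const_bound[where B=Q]) auto
      show "integrable M (\<lambda>\<omega>. (D k \<omega>)\<^sup>2 - \<sigma>2 - (q k \<omega> - q (Suc k) \<omega>) - e k \<omega>)"
        using D2 qi e_int by simp
      show "AE \<omega> in M. norm (Y k \<omega> * complex_of_real ((D k \<omega>)\<^sup>2 - \<sigma>2 - (q k \<omega> - q (Suc k) \<omega>) - e k \<omega>))
             \<le> norm ((D k \<omega>)\<^sup>2 - \<sigma>2 - (q k \<omega> - q (Suc k) \<omega>) - e k \<omega>)"
        by (simp only: norm_mult Y1 norm_of_real real_norm_def mult_1_left order_refl) simp
    qed measurable
    have i3: "integrable M (\<lambda>\<omega>. Y k \<omega> * r k \<omega>)"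
      using r_bound by (intro int_bounded[of _ "(C * \<bar>s\<bar>) ^ 3 + a\<^sup>2"]) (auto simp: norm_mult Y1)
    have i4: "integrable M (\<lambda>\<omega>. Y k \<omega> * complex_of_real (q k \<omega> - q (Suc k) \<omega>))"
    proof (rule int_bounded[of _ "2 * Q"])
      show "norm (Y k \<omega> * complex_of_real (q k \<omega> - q (Suc k) \<omega>)) \<le> 2 * Q" if "\<omega> \<in> space M" for \<omega>
        using q_bound[OF that, of k] q_bound[OF that, of "Suc k"] by (simp only: norm_mult Y1 norm_of_real mult_1_left)
    qed measurable
    have i5: "integrable M (\<lambda>\<omega>. Y k \<omega> * complex_of_real (e k \<omega>))"
      by (rule Bochner_Integration.integrable_bound[OF e_int[of k]]) (auto simp: norm_mult Y1)
    have i6: "integrable M (Y k)" for k by (rule int_bounded[of _ 1]) (auto simp: Y1)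
    define \<kappa> where "\<kappa> = complex_of_real (s\<^sup>2 / 2)"
    define Iq where "Iq = (\<integral>\<omega>. Y k \<omega> * complex_of_real (q k \<omega> - q (Suc k) \<omega>) \<partial>M)"
    define Ie where "Ie = (\<integral>\<omega>. Y k \<omega> * complex_of_real (e k \<omega>) \<partial>M)"
    define Ir where "Ir = (\<integral>\<omega>. Y k \<omega> * r k \<omega> \<partial>M)"
    have pt: "Y (Suc k) \<omega> - complex_of_real l * Y k \<omega> = Y k \<omega> * r k \<omega> + \<i> * s * (Y k \<omega> * complex_of_real (D k \<omega>))
        - \<kappa> * (Y k \<omega> * complex_of_real ((D k \<omega>)\<^sup>2 - \<sigma>2 - (q k \<omega> - q (Suc k) \<omega>) - e k \<omega>))
        - \<kappa> * (Y k \<omega> * complex_of_real (q k \<omega> - q (Suc k) \<omega>)) - \<kappa> * (Y k \<omega> * complex_of_real (e k \<omega>))" for \<omega>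
      by (simp add: Y_Suc r_def \<kappa>_def algebra_simps diff_divide_distrib)
    have "Z (Suc k) - complex_of_real l * Z k = (\<integral>\<omega>. Y (Suc k) \<omega> - complex_of_real l * Y k \<omega> \<partial>M)"
      using i6 by (simp add: Z_def)
    also have "\<dots> = Ir + \<i> * s * 0 - \<kappa> * 0 - \<kappa> * Iq - \<kappa> * Ie"
    proof -
      have lin: "(\<integral>\<omega>. h1 \<omega> + c1 * h2 \<omega> - \<kappa> * h3 \<omega> - \<kappa> * h4 \<omega> - \<kappa> * h5 \<omega> \<partial>M) =
          (\<integral>\<omega>. h1 \<omega> \<partial>M) + c1 * (\<integral>\<omega>. h2 \<omega> \<partial>M) - \<kappa> * (\<integral>\<omega>. h3 \<omega> \<partial>M) - \<kappa> * (\<integral>\<omega>. h4 \<omega> \<partial>M) - \<kappa> * (\<integral>\<omega>. h5 \<omega> \<partial>M)"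
        if "integrable M h1" "integrable M h2" "integrable M h3" "integrable M h4" "integrable M h5"
        for h1 h2 h3 h4 h5 :: "'a \<Rightarrow> complex" and c1
        using that by simp
      show ?thesis unfolding pt lin[OF i3 i1 i2 i4 i5] orth1 orth2 Ir_def Iq_def Ie_def ..
    qed
    finally have "c * (Z (Suc k) - complex_of_real l * Z k) = c * (Ir - \<kappa> * Iq - \<kappa> * Ie)" by simp
    then have "c * Z (Suc k) - c * complex_of_real l * Z k = c * Ir - \<kappa> * (c * Iq) - \<kappa> * (c * Ie)"
      by (simp add: algebra_simps)
    moreover have "c * (\<integral>\<omega>. Y k \<omega> * h \<omega> \<partial>M) = (\<integral>\<omega>. y k \<omega> * h \<omega> \<partial>M)" for h :: "'a \<Rightarrow> complex"
      unfolding y_def c_def mult.assoc by (rule integral_mult_right_zero[symmetric])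
    ultimately show ?thesis unfolding c c_def[symmetric] Ir_def Iq_def Ie_def \<kappa>_def by (simp only:)
  qed
  define R where "R = (\<Sum>k<n. \<integral>\<omega>. y k \<omega> * r k \<omega> \<partial>M)"
  define T where "T = (\<Sum>k<n. \<integral>\<omega>. y k \<omega> * complex_of_real (q k \<omega> - q (Suc k) \<omega>) \<partial>M)"
  define E where "E = (\<Sum>k<n. \<integral>\<omega>. y k \<omega> * complex_of_real (e k \<omega>) \<partial>M)"
  have "Z n - complex_of_real (l ^ n) = (\<Sum>k<n. complex_of_real (l ^ (n - Suc k)) * Z (Suc k) - complex_of_real (l ^ (n - k)) * Z k)"
  proof -
    have "Z 0 = 1" using prob_space by (simp add: Z_def Y_def)
    then show ?thesis by (subst sum_lessThan_telescope[of "\<lambda>k. complex_of_real (l ^ (n - k)) * Z k"]) simp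
  qed
  also have "\<dots> = R - complex_of_real (s\<^sup>2 / 2) * T - complex_of_real (s\<^sup>2 / 2) * E"
    unfolding R_def T_def E_def sum_distrib_left sum_subtractf[symmetric]
    by (rule sum.cong[OF refl], rule step) simp
  also have "cmod \<dots> \<le> cmod R + s\<^sup>2 / 2 * cmod T + s\<^sup>2 / 2 * cmod E"
  proof -
    have "cmod (R - complex_of_real (s\<^sup>2 / 2) * T - complex_of_real (s\<^sup>2 / 2) * E)
        \<le> cmod R + cmod (complex_of_real (s\<^sup>2 / 2) * T) + cmod (complex_of_real (s\<^sup>2 / 2) * E)"
      by (intro order_trans[OF norm_triangle_ineq4] add_mono norm_triangle_ineq4 order_refl)
    moreover have "cmod (complex_of_real (s\<^sup>2 / 2) * z) = s\<^sup>2 / 2 * cmod z" for z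
      unfolding norm_mult norm_of_real by simp
    ultimately show ?thesis by (simp only:)
  qed
  also have "\<dots> \<le> real n * ((C * \<bar>s\<bar>) ^ 3 + a\<^sup>2) + s\<^sup>2 / 2 * (Q * (2 + real n * (C * \<bar>s\<bar> + a))) + s\<^sup>2 / 2 * (real n * \<eta>)"
  proof (intro add_mono mult_left_mono)
    have norm_int: "cmod (\<integral>\<omega>. h \<omega> \<partial>M) \<le> B" if "h \<in> borel_measurable M" "\<And>\<omega>. \<omega> \<in> space M \<Longrightarrow> cmod (h \<omega>) \<le> B" for h B
    proof -
      have "cmod (\<integral>\<omega>. h \<omega> \<partial>M) \<le> (\<integral>\<omega>. cmod (h \<omega>) \<partial>M)" by (rule integral_norm_bound)
      also have "\<dots> \<le> (\<integral>\<omega>. B \<partial>M)" using that int_bounded[OF that] by (intro integral_mono) auto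
      finally show ?thesis using prob_space by simp
    qed
    have "cmod R \<le> (\<Sum>k<n. (C * \<bar>s\<bar>) ^ 3 + a\<^sup>2)"
      unfolding R_def
    proof (intro order_trans[OF norm_sum] sum_mono norm_int)
      fix k \<omega> assume "\<omega> \<in> space M"
      then show "cmod (y k \<omega> * r k \<omega>) \<le> (C * \<bar>s\<bar>) ^ 3 + a\<^sup>2"
        using mult_mono[OF y1[of k \<omega>] r_bound[of \<omega> k]] by (simp add: norm_mult)
    qed measurable
    then show "cmod R \<le> real n * ((C * \<bar>s\<bar>) ^ 3 + a\<^sup>2)" by simp
    have "cmod E \<le> (\<Sum>k<n. \<eta>)"
      unfolding E_def
    proof (intro order_trans[OF norm_sum] sum_mono)
      fix k
      have "cmod (\<integral>\<omega>. y k \<omega> * complex_of_real (e k \<omega>) \<partial>M) \<le> (\<integral>\<omega>. cmod (y k \<omega> * complex_of_real (e k \<omega>)) \<partial>M)"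
        by (rule integral_norm_bound)
      also have "\<dots> \<le> (\<integral>\<omega>. \<bar>e k \<omega>\<bar> \<partial>M)"
      proof (rule integral_mono)
        have le: "cmod (y k \<omega> * complex_of_real (e k \<omega>)) \<le> \<bar>e k \<omega>\<bar>" for \<omega>
          using mult_right_mono[OF y1[of k \<omega>], of "\<bar>e k \<omega>\<bar>"] by (simp add: norm_mult)
        then show "cmod (y k \<omega> * complex_of_real (e k \<omega>)) \<le> \<bar>e k \<omega>\<bar>" for \<omega> .
        show "integrable M (\<lambda>\<omega>. cmod (y k \<omega> * complex_of_real (e k \<omega>)))"
          by (rule Bochner_Integration.integrable_bound[OF e_int[of k]]) (use le in auto)
      qed (use e_int in simp)
      also have "\<dots> \<le> \<eta>" by (rule e_bound)
      finally show "cmod (\<integral>\<omega>. y k \<omega> * complex_of_real (e k \<omega>) \<partial>M) \<le> \<eta>" .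
    qed
    then show "cmod E \<le> real n * \<eta>" by simp
    have "T = (\<integral>\<omega>. (\<Sum>k<n. y k \<omega> * complex_of_real (q k \<omega> - q (Suc k) \<omega>)) \<partial>M)"
      unfolding T_def
    proof (rule Bochner_Integration.integral_sum[symmetric], rule int_bounded[of _ "2 * Q"])
      fix k \<omega> assume \<omega>: "\<omega> \<in> space M"
      have "\<bar>q k \<omega> - q (Suc k) \<omega>\<bar> \<le> 2 * Q"
        using q_bound[OF \<omega>, of k] q_bound[OF \<omega>, of "Suc k"] by linarith
      then show "cmod (y k \<omega> * complex_of_real (q k \<omega> - q (Suc k) \<omega>)) \<le> 2 * Q"
        using mult_mono[OF y1[of k \<omega>], of "\<bar>q k \<omega> - q (Suc k) \<omega>\<bar>" "2 * Q"] by (simp only: norm_mult norm_of_real) simp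
    qed measurable
    also have "cmod \<dots> \<le> Q * (2 + real n * (C * \<bar>s\<bar> + a))"
    proof (rule norm_int)
      fix \<omega> assume \<omega>: "\<omega> \<in> space M"
      show "cmod (\<Sum>k<n. y k \<omega> * complex_of_real (q k \<omega> - q (Suc k) \<omega>)) \<le> Q * (2 + real n * (C * \<bar>s\<bar> + a))"
      proof (rule norm_sum_telescope_le)
        fix k assume k: "Suc k < n"
        then have "n - Suc k = Suc (n - Suc (Suc k))" by simp
        then have "y (Suc k) \<omega> - y k \<omega> = complex_of_real (l ^ (n - Suc (Suc k))) * Y k \<omega> * (iexp (s * D k \<omega>) - complex_of_real l)"
          by (simp only: y_def Y_Suc power_Suc of_real_mult) (simp add: algebra_simps)
        then have "cmod (y (Suc k) \<omega> - y k \<omega>) = l ^ (n - Suc (Suc k)) * cmod (iexp (s * D k \<omega>) - complex_of_real l)"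
          using l by (simp add: norm_mult Y1 norm_power)
        also have "\<dots> \<le> 1 * cmod (iexp (s * D k \<omega>) - complex_of_real l)"
          using l by (intro mult_right_mono) (auto simp: power_le_one)
        also have "\<dots> \<le> cmod (iexp (s * D k \<omega>) - 1) + cmod (complex_of_real l - 1)"
          using norm_triangle_ineq4[of "iexp (s * D k \<omega>) - 1" "complex_of_real l - 1"] by simp
        also have "\<dots> \<le> C * \<bar>s\<bar> + a"
        proof (rule add_mono)
          show "cmod (iexp (s * D k \<omega>) - 1) \<le> C * \<bar>s\<bar>"
            using norm_iexp_diff_le[of "s * D k \<omega>" 0] sD[OF \<omega>, of k] by simp
          have "cmod (complex_of_real l - 1) = \<bar>l - 1\<bar>" by (metis norm_of_real of_real_1 of_real_diff)
          also have "\<dots> \<le> a" using abs_exp_minus_diff_le[of a 0] a0 by (simp add: l_def)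
          finally show "cmod (complex_of_real l - 1) \<le> a" .
        qed
        finally show "cmod (y (Suc k) \<omega> - y k \<omega>) \<le> C * \<bar>s\<bar> + a" .
      next
        have "0 \<le> C" using D_bound[OF \<omega>, of 0] by simp
        then show "0 \<le> C * \<bar>s\<bar> + a" using a0 by simp
      qed (use y1 q_bound \<omega> in auto)
    qed measurable
    finally show "cmod T \<le> Q * (2 + real n * (C * \<bar>s\<bar> + a))" .
  qed auto
  finally show ?thesis by (simp only: Z_def l_def a_def distrib_left add.assoc)
qed

section \<open>Bounded functions and approximation\<close>

context markov_kernel
begin

lemma op_bounded:
  assumes h: "h \<in> borel_measurable \<pi>" "\<And>x. x \<in> space \<pi> \<Longrightarrow> \<bar>h x\<bar> \<le> B" and x: "x \<in> space \<pi>"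
  shows "\<bar>op h x\<bar> \<le> B"
proof -
  interpret Kx: prob_space "K x" by (rule K_prob[OF x])
  have int: "integrable (K x) h"
    using h by (intro Kx.integrable_const_bound[where B=B] measurable_K x AE_I2) (auto simp: space_K[OF x])
  have "\<bar>op h x\<bar> \<le> (\<integral>y. \<bar>h y\<bar> \<partial>K x)" unfolding kernel_op_def by (rule integral_abs_bound)
  also have "\<dots> \<le> (\<integral>y. B \<partial>K x)"
    using int h by (intro integral_mono) (auto simp: space_K[OF x])
  finally show ?thesis using Kx.prob_space by simp
qed

lemma op_pow_bounded:
  assumes h: "h \<in> borel_measurable \<pi>" "\<And>x. x \<in> space \<pi> \<Longrightarrow> \<bar>h x\<bar> \<le> B" and x: "x \<in> space \<pi>"
  shows "\<bar>(op ^^ n) h x\<bar> \<le> B"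
  using x by (induction n arbitrary: x) (auto intro!: h op_bounded op_pow_measurable)

lemma L2_bounded:
  assumes h: "h \<in> borel_measurable \<pi>" "\<And>x. x \<in> space \<pi> \<Longrightarrow> \<bar>h x\<bar> \<le> B"
  shows "h \<in> L2 \<pi>"
proof -
  have "integrable \<pi> (\<lambda>x. (h x)\<^sup>2)"
  proof (rule integrable_const_bound[where B="B\<^sup>2"])
    show "AE x in \<pi>. norm ((h x)\<^sup>2) \<le> B\<^sup>2"
      using power_mono[OF h(2), of _ 2] by (intro AE_I2) simp
  qed (use h in measurable)
  then show ?thesis using h by (simp add: L2_def)
qed

lemma space_chain: "\<omega> \<in> space chain \<Longrightarrow> \<omega> i \<in> space \<pi>"
  using sets_eq_imp_space_eq[OF sets_chain] by (auto simp: space_PiM PiE_iff)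

lemma restrict_space_path: "\<omega> \<in> space chain \<Longrightarrow> restrict \<omega> {0..<n} \<in> space (path n)"
  using space_chain by (auto simp: space_PiM)

text \<open>
  The increments \<open>b(X\<^sub>k\<^sub>+\<^sub>1) - K b(X\<^sub>k)\<close> are orthogonal to bounded functions of the past.
\<close>

lemma chain_martingale_orthogonal:
  fixes Y :: "(nat \<Rightarrow> 'a) \<Rightarrow> complex"
  assumes Y [measurable]: "Y \<in> borel_measurable (path (Suc k))" and Y_bound: "\<And>\<eta>. \<eta> \<in> space (path (Suc k)) \<Longrightarrow> cmod (Y \<eta>) \<le> C"
    and b [measurable]: "b \<in> borel_measurable \<pi>" and b_bound: "\<And>x. x \<in> space \<pi> \<Longrightarrow> \<bar>b x\<bar> \<le> B"
  shows "(\<integral>\<omega>. Y (restrict \<omega> {0..<Suc k}) * complex_of_real (b (\<omega> (Suc k)) - op b (\<omega> k)) \<partial>chain) = 0"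
    and "integrable chain (\<lambda>\<omega>. Y (restrict \<omega> {0..<Suc k}) * complex_of_real (b (\<omega> (Suc k)) - op b (\<omega> k)))"
proof -
  interpret chain: prob_space chain by (rule prob_space_chain)
  have [measurable]: "(\<lambda>\<omega>. Y (restrict \<omega> {0..<Suc k})) \<in> borel_measurable chain"
    by (rule measurable_compose[OF measurable_restrict_path Y])
  have [measurable]: "(\<lambda>\<omega>. b (\<omega> i)) \<in> borel_measurable chain" "(\<lambda>\<omega>. op b (\<omega> i)) \<in> borel_measurable chain" for i
    by (intro measurable_compose[OF measurable_coord] b op_measurable)+
  have bound: "cmod (Y (restrict \<omega> {0..<Suc k})) \<le> C" if "\<omega> \<in> space chain" for \<omega>
    by (rule Y_bound[OF restrict_space_path[OF that]])
  have int1: "integrable chain (\<lambda>\<omega>. Y (restrict \<omega> {0..<Suc k}) * complex_of_real (h \<omega>))"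
    if [measurable]: "h \<in> borel_measurable chain" and h: "\<And>\<omega>. \<omega> \<in> space chain \<Longrightarrow> \<bar>h \<omega>\<bar> \<le> B" for h
  proof (rule chain.integrable_const_bound[where B="C * B"])
    show "AE \<omega> in chain. norm (Y (restrict \<omega> {0..<Suc k}) * complex_of_real (h \<omega>)) \<le> C * B"
      unfolding norm_mult norm_of_real using bound h
      by (intro AE_I2 mult_mono) (auto intro: order_trans[OF norm_ge_zero])
  qed measurable
  have ib: "integrable chain (\<lambda>\<omega>. Y (restrict \<omega> {0..<Suc k}) * complex_of_real (b (\<omega> (Suc k))))"
    using b_bound space_chain by (intro int1) auto
  have io: "integrable chain (\<lambda>\<omega>. Y (restrict \<omega> {0..<Suc k}) * complex_of_real (op b (\<omega> k)))"
    using op_bounded[OF b b_bound] space_chain by (intro int1) auto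
  have main: "(\<integral>\<omega>. Z (restrict \<omega> {0..<Suc k}) * b (\<omega> (Suc k)) \<partial>chain) = (\<integral>\<omega>. Z (restrict \<omega> {0..<Suc k}) * op b (\<omega> k) \<partial>chain)"
    if "integrable chain (\<lambda>\<omega>. Z (restrict \<omega> {0..<Suc k}) * b (\<omega> (Suc k)))" "Z \<in> borel_measurable (path (Suc k))" for Z
    using that by (intro chain_markov b)
  have "(\<integral>\<omega>. Y (restrict \<omega> {0..<Suc k}) * complex_of_real (b (\<omega> (Suc k))) \<partial>chain) =
        (\<integral>\<omega>. Y (restrict \<omega> {0..<Suc k}) * complex_of_real (op b (\<omega> k)) \<partial>chain)"
  proof (rule complex_eqI)
    have Re_mult: "Re (z * complex_of_real r) = Re z * r" and Im_mult: "Im (z * complex_of_real r) = Im z * r" for z r by simp_all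
    have 1: "integrable chain (\<lambda>\<omega>. Re (Y (restrict \<omega> {0..<Suc k})) * b (\<omega> (Suc k)))"
      using integrable_Re[OF ib] by (simp only: Re_mult)
    have 2: "integrable chain (\<lambda>\<omega>. Im (Y (restrict \<omega> {0..<Suc k})) * b (\<omega> (Suc k)))"
      using integrable_Im[OF ib] by (simp only: Im_mult)
    show "Re (\<integral>\<omega>. Y (restrict \<omega> {0..<Suc k}) * complex_of_real (b (\<omega> (Suc k))) \<partial>chain) =
        Re (\<integral>\<omega>. Y (restrict \<omega> {0..<Suc k}) * complex_of_real (op b (\<omega> k)) \<partial>chain)"
      unfolding integral_Re[OF ib, symmetric] integral_Re[OF io, symmetric] Re_mult
      by (rule main[of "\<lambda>\<eta>. Re (Y \<eta>)", OF 1]) measurable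
    show "Im (\<integral>\<omega>. Y (restrict \<omega> {0..<Suc k}) * complex_of_real (b (\<omega> (Suc k))) \<partial>chain) =
        Im (\<integral>\<omega>. Y (restrict \<omega> {0..<Suc k}) * complex_of_real (op b (\<omega> k)) \<partial>chain)"
      unfolding integral_Im[OF ib, symmetric] integral_Im[OF io, symmetric] Im_mult
      by (rule main[of "\<lambda>\<eta>. Im (Y \<eta>)", OF 2]) measurable
  qed
  then show "(\<integral>\<omega>. Y (restrict \<omega> {0..<Suc k}) * complex_of_real (b (\<omega> (Suc k)) - op b (\<omega> k)) \<partial>chain) = 0"
    unfolding of_real_diff right_diff_distrib using ib io by simp
  show "integrable chain (\<lambda>\<omega>. Y (restrict \<omega> {0..<Suc k}) * complex_of_real (b (\<omega> (Suc k)) - op b (\<omega> k)))"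
    unfolding of_real_diff right_diff_distrib using ib io by (rule Bochner_Integration.integrable_diff)
qed

lemma L2_truncate:
  assumes u: "u \<in> L2 \<pi>" and \<epsilon>: "\<epsilon> > 0"
  obtains u' B where "u' \<in> borel_measurable \<pi>" "\<And>x. \<bar>u' x\<bar> \<le> B" "ip \<pi> (\<lambda>x. u x - u' x) (\<lambda>x. u x - u' x) < \<epsilon>"
proof -
  define v where "v N x = (if \<bar>u x\<bar> \<le> real N then u x else 0)" for N x
  have [measurable]: "u \<in> borel_measurable \<pi>" by (rule L2_measurable[OF u])
  have v_meas [measurable]: "v N \<in> borel_measurable \<pi>" for N unfolding v_def[abs_def] by measurable
  have "(\<lambda>N. \<integral>x. (u x - v N x)\<^sup>2 \<partial>\<pi>) \<longlonglongrightarrow> (\<integral>x. 0 \<partial>\<pi>)"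
  proof (rule integral_dominated_convergence[where w="\<lambda>x. (u x)\<^sup>2"])
    show "integrable \<pi> (\<lambda>x. (u x)\<^sup>2)" using u by (simp add: L2_def)
    show "AE x in \<pi>. (\<lambda>N. (u x - v N x)\<^sup>2) \<longlonglongrightarrow> 0"
    proof (rule AE_I2)
      fix x
      obtain N0 where N0: "\<bar>u x\<bar> \<le> real N0" using real_arch_simple by blast
      have "\<forall>\<^sub>F N in sequentially. (u x - v N x)\<^sup>2 = 0"
        using eventually_ge_at_top[of N0] by eventually_elim (use N0 in \<open>simp add: v_def\<close>)
      then show "(\<lambda>N. (u x - v N x)\<^sup>2) \<longlonglongrightarrow> 0" by (rule tendsto_eventually)
    qed
  qed (auto simp: v_def)
  then have "\<forall>\<^sub>F N in sequentially. ip \<pi> (\<lambda>x. u x - v N x) (\<lambda>x. u x - v N x) < \<epsilon>"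
    using \<epsilon> by (auto simp: ip_self dest: order_tendstoD(2))
  then obtain N where N: "ip \<pi> (\<lambda>x. u x - v N x) (\<lambda>x. u x - v N x) < \<epsilon>"
    by (auto simp: eventually_sequentially)
  show ?thesis by (rule that[of "v N" "real N"]) (use N v_meas in \<open>auto simp: v_def\<close>)
qed

text \<open>
  Functions whose difference has small asymptotic variance have close asymptotic variances. Since
  \<open>a\<^sup>2 - b\<^sup>2 = (a - b) (a + b)\<close>, this follows from the arithmetic-geometric inequality with weight
  \<open>c = \<surd>\<epsilon>\<close>, chosen so that both resulting terms are of order \<open>\<surd>\<epsilon>\<close>.
\<close>

lemma scaled_var_close:
  assumes g: "g \<in> L2 \<pi>" and h: "h \<in> L2 \<pi>" and \<epsilon>: "\<epsilon> > 0" and le: "scaled_var (\<lambda>x. g x - h x) n \<le> \<epsilon>"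
  shows "\<bar>scaled_var g n - scaled_var h n\<bar> \<le> sqrt \<epsilon> * (1 / 2 + 4 * scaled_var g n + \<epsilon>)"
proof -
  define c where "c = sqrt \<epsilon>"
  have c: "c > 0" "c * c = \<epsilon>" using \<epsilon> by (simp_all add: c_def)
  define X where "X = part_sum g n" define Y where "Y = part_sum h n"
  have gh: "part_sum (\<lambda>x. g x - h x) n \<omega> = X \<omega> - Y \<omega>" for \<omega> by (simp add: X_def Y_def part_sum_def sum_subtractf)
  have pt: "\<bar>a\<^sup>2 - b\<^sup>2\<bar> \<le> (1 / (2 * c) + c) * (a - b)\<^sup>2 + 4 * c * a\<^sup>2" for a b :: real
  proof -
    have "\<bar>a\<^sup>2 - b\<^sup>2\<bar> = \<bar>a - b\<bar> * \<bar>a + b\<bar>" by (simp add: abs_mult[symmetric] power2_eq_square algebra_simps)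
    also have "2 * c * (\<bar>a - b\<bar> * \<bar>a + b\<bar>) \<le> \<bar>a - b\<bar>\<^sup>2 + (c * \<bar>a + b\<bar>)\<^sup>2"
      using sum_squares_bound[of "\<bar>a - b\<bar>" "c * \<bar>a + b\<bar>"] by (simp add: mult_ac)
    then have "\<bar>a - b\<bar> * \<bar>a + b\<bar> \<le> ((a - b)\<^sup>2 + c\<^sup>2 * (a + b)\<^sup>2) / (2 * c)"
      using c by (simp add: field_simps power_mult_distrib)
    also have "\<dots> \<le> ((a - b)\<^sup>2 + c\<^sup>2 * (8 * a\<^sup>2 + 2 * (a - b)\<^sup>2)) / (2 * c)"
    proof -
      have "0 \<le> (a - b + 2 * a)\<^sup>2" by simp
      then have "(a + b)\<^sup>2 \<le> 8 * a\<^sup>2 + 2 * (a - b)\<^sup>2" by (simp add: power2_eq_square algebra_simps)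
      then show ?thesis using c by (intro divide_right_mono add_left_mono mult_left_mono) auto
    qed
    also have "\<dots> = (1 / (2 * c) + c) * (a - b)\<^sup>2 + 4 * c * a\<^sup>2"
      using c(1) by (simp add: field_simps power2_eq_square)
    finally show ?thesis .
  qed
  have sq: "integrable chain (\<lambda>\<omega>. (X \<omega>)\<^sup>2)" "integrable chain (\<lambda>\<omega>. (Y \<omega>)\<^sup>2)" "integrable chain (\<lambda>\<omega>. (X \<omega> - Y \<omega>)\<^sup>2)"
    using part_sum_L2[OF g, of n] part_sum_L2[OF h, of n] part_sum_L2[OF L2_diff[OF g h], of n]
    by (simp_all add: L2_def X_def Y_def gh[unfolded X_def Y_def])
  have "\<bar>(\<integral>\<omega>. (X \<omega>)\<^sup>2 \<partial>chain) - (\<integral>\<omega>. (Y \<omega>)\<^sup>2 \<partial>chain)\<bar> = \<bar>\<integral>\<omega>. (X \<omega>)\<^sup>2 - (Y \<omega>)\<^sup>2 \<partial>chain\<bar>"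
    using sq by simp
  also have "\<dots> \<le> (\<integral>\<omega>. \<bar>(X \<omega>)\<^sup>2 - (Y \<omega>)\<^sup>2\<bar> \<partial>chain)" by (rule integral_abs_bound)
  also have "\<dots> \<le> (\<integral>\<omega>. (1 / (2 * c) + c) * (X \<omega> - Y \<omega>)\<^sup>2 + 4 * c * (X \<omega>)\<^sup>2 \<partial>chain)"
    using sq by (intro integral_mono pt) auto
  also have "\<dots> = (1 / (2 * c) + c) * (\<integral>\<omega>. (X \<omega> - Y \<omega>)\<^sup>2 \<partial>chain) + 4 * c * (\<integral>\<omega>. (X \<omega>)\<^sup>2 \<partial>chain)"
    using sq by simp
  finally have "\<bar>(\<integral>\<omega>. (X \<omega>)\<^sup>2 \<partial>chain) - (\<integral>\<omega>. (Y \<omega>)\<^sup>2 \<partial>chain)\<bar> / real n \<le>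
      ((1 / (2 * c) + c) * (\<integral>\<omega>. (X \<omega> - Y \<omega>)\<^sup>2 \<partial>chain) + 4 * c * (\<integral>\<omega>. (X \<omega>)\<^sup>2 \<partial>chain)) / real n"
    by (rule divide_right_mono) simp
  then have "\<bar>scaled_var g n - scaled_var h n\<bar> \<le> (1 / (2 * c) + c) * scaled_var (\<lambda>x. g x - h x) n + 4 * c * scaled_var g n"
    unfolding scaled_var_def gh X_def[symmetric] Y_def[symmetric]
    by (simp only: diff_divide_distrib[symmetric] abs_divide abs_of_nat add_divide_distrib times_divide_eq_right)
  also have "\<dots> \<le> (1 / (2 * c) + c) * (c * c) + 4 * c * scaled_var g n"
    using le c by (intro add_right_mono mult_left_mono) auto
  also have "\<dots> = c * (1 / 2 + 4 * scaled_var g n + \<epsilon>)"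
    using c by (simp add: field_simps)
  finally show ?thesis by (simp add: c_def)
qed

end

context reversible_kernel
begin

lemma scaled_var_tendsto:
  assumes h: "h \<in> L2 \<pi>" and E: "spectral h E" and ne: "AE x in E. x \<noteq> 1" and int: "integrable E (\<lambda>x. 1 / (1 - x))"
  shows "(\<lambda>n. scaled_var h n) \<longlonglongrightarrow> (\<integral>x. (1 + x) / (1 - x) \<partial>E)"
  unfolding scaled_var_spectral[OF h E]
proof (rule integral_dominated_convergence[where w="\<lambda>x. 4 * (1 / (1 - x))"])
  note meas = measurable_interval[OF spectral_sets[OF E]]
  show "(\<lambda>x. (1 + x) / (1 - x)) \<in> borel_measurable E" by (rule meas) measurable
  show "toeplitz n \<in> borel_measurable E" for n
    by (intro meas borel_measurable_continuous_onI continuous_intros)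
  show "integrable E (\<lambda>x. 4 * (1 / (1 - x)))" using int by (rule integrable_mult_right)
  show "AE x in E. (\<lambda>n. toeplitz n x) \<longlonglongrightarrow> (1 + x) / (1 - x)"
    using ne AE_space by eventually_elim (use spectral_space[OF E] in \<open>auto intro!: toeplitz_tendsto\<close>)
  show "AE x in E. norm (toeplitz n x) \<le> 4 * (1 / (1 - x))" for n
    using ne AE_space
  proof eventually_elim
    case (elim x)
    then have x: "-1 \<le> x" "x < 1" using spectral_space[OF E] by auto
    then show ?case using abs_toeplitz_le[of x n] by (simp add: abs_mult field_simps)
  qed
qed

text \<open>
  The variance of \<open>S\<^sub>n(A\<^sub>N h) / \<surd>n\<close> is at most \<open>\<integral> 4 a\<^sub>N\<^sup>2 / (1 - x) dE\<close> for every \<open>n\<close>, where \<open>a\<^sub>N\<close> is the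
  polynomial \<open>cesaro N\<close>; by dominated convergence this is small for large \<open>N\<close>.
\<close>

lemma scaled_var_cesaro_le:
  assumes h: "h \<in> L2 \<pi>" and E: "spectral h E" and ne: "AE x in E. x \<noteq> 1" and int: "integrable E (\<lambda>x. 1 / (1 - x))"
    and \<epsilon>: "\<epsilon> > 0"
  obtains N where "N > 0" "\<And>n. scaled_var (poly_op (cesaro N) h) n \<le> \<epsilon>"
proof -
  note meas = measurable_interval[OF spectral_sets[OF E]]
  have dom: "AE x in E. norm (4 * (poly (cesaro N) x)\<^sup>2 / (1 - x)) \<le> 4 * (1 / (1 - x))" for N
    using ne AE_space
  proof eventually_elim
    case (elim x)
    then have x: "-1 \<le> x" "x < 1" using spectral_space[OF E] by auto
    then have "\<bar>poly (cesaro N) x\<bar>\<^sup>2 \<le> 1" using abs_poly_cesaro_le[of x N] by (intro power_le_one) auto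
    then show ?case using x by (simp add: abs_mult divide_right_mono)
  qed
  have int': "integrable E (\<lambda>x. 4 * (poly (cesaro N) x)\<^sup>2 / (1 - x))" for N
  proof (rule Bochner_Integration.integrable_bound[OF integrable_mult_right[OF int, of 4]])
    show "(\<lambda>x. 4 * (poly (cesaro N) x)\<^sup>2 / (1 - x)) \<in> borel_measurable E" by (rule meas) measurable
    show "AE x in E. norm (4 * (poly (cesaro N) x)\<^sup>2 / (1 - x)) \<le> norm (4 * (1 / (1 - x)))"
      using dom[of N] by eventually_elim (erule order_trans, simp only: real_norm_def abs_ge_self)
  qed
  have bound: "scaled_var (poly_op (cesaro N) h) n \<le> (\<integral>x. 4 * (poly (cesaro N) x)\<^sup>2 / (1 - x) \<partial>E)" for N n
    unfolding scaled_var_poly_op[OF h E]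
  proof (rule integral_mono_AE[OF _ int'])
    show "integrable E (\<lambda>x. toeplitz n x * (poly (cesaro N) x)\<^sup>2)"
      by (intro spectral_integrable[OF E] continuous_intros)
    show "AE x in E. toeplitz n x * (poly (cesaro N) x)\<^sup>2 \<le> 4 * (poly (cesaro N) x)\<^sup>2 / (1 - x)"
      using ne AE_space
    proof eventually_elim
      case (elim x)
      then have x: "-1 \<le> x" "x < 1" using spectral_space[OF E] by auto
      then have "toeplitz n x \<le> 4 / (1 - x)" using abs_toeplitz_le[of x n] by (simp add: field_simps)
      from mult_right_mono[OF this, of "(poly (cesaro N) x)\<^sup>2"] show ?case by simp
    qed
  qed
  have "(\<lambda>N. \<integral>x. 4 * (poly (cesaro N) x)\<^sup>2 / (1 - x) \<partial>E) \<longlonglongrightarrow> (\<integral>x. 0 \<partial>E)"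
  proof (rule integral_dominated_convergence[where w="\<lambda>x. 4 * (1 / (1 - x))"])
    show "(\<lambda>x. 4 * (poly (cesaro N) x)\<^sup>2 / (1 - x)) \<in> borel_measurable E" for N by (rule meas) measurable
    show "integrable E (\<lambda>x. 4 * (1 / (1 - x)))" using int by (rule integrable_mult_right)
    show "AE x in E. (\<lambda>N. 4 * (poly (cesaro N) x)\<^sup>2 / (1 - x)) \<longlonglongrightarrow> 0"
      using ne AE_space
    proof eventually_elim
      case (elim x)
      then have x: "-1 \<le> x" "x < 1" using spectral_space[OF E] by auto
      have "(\<lambda>N. 4 * (poly (cesaro N) x)\<^sup>2 / (1 - x)) \<longlonglongrightarrow> 4 * 0\<^sup>2 / (1 - x)"
        using x by (intro tendsto_intros poly_cesaro_tendsto) auto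
      then show ?case by simp
    qed
    show "AE x in E. norm (4 * (poly (cesaro N) x)\<^sup>2 / (1 - x)) \<le> 4 * (1 / (1 - x))" for N by (rule dom)
  qed simp
  then have "\<forall>\<^sub>F N in sequentially. (\<integral>x. 4 * (poly (cesaro N) x)\<^sup>2 / (1 - x) \<partial>E) < \<epsilon>"
    using \<epsilon> by (auto dest: order_tendstoD(2))
  then have "\<forall>\<^sub>F N in sequentially. (\<integral>x. 4 * (poly (cesaro N) x)\<^sup>2 / (1 - x) \<partial>E) < \<epsilon> \<and> N > 0"
    using eventually_gt_at_top[of 0] by eventually_elim simp
  then obtain N where N: "(\<integral>x. 4 * (poly (cesaro N) x)\<^sup>2 / (1 - x) \<partial>E) < \<epsilon>" "N > 0"
    by (auto simp: eventually_sequentially)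
  show ?thesis by (rule that[OF N(2)], rule order_trans[OF bound less_imp_le[OF N(1)]])
qed

text \<open>
  The decomposition \<open>h = A\<^sub>N h + (1 - K) u\<close>, followed by a truncation of \<open>u\<close>. Both errors are
  controlled uniformly in \<open>n\<close>.
\<close>

lemma approx_bounded_coboundary:
  assumes h: "h \<in> L2 \<pi>" and E: "spectral h E" and ne: "AE x in E. x \<noteq> 1" and int: "integrable E (\<lambda>x. 1 / (1 - x))"
    and \<epsilon>: "\<epsilon> > 0"
  obtains u B where "u \<in> borel_measurable \<pi>" "\<And>x. \<bar>u x\<bar> \<le> B" "\<And>n. scaled_var (\<lambda>x. h x - (u x - op u x)) n \<le> \<epsilon>"
proof -
  obtain N where N: "N > 0" "\<And>n. scaled_var (poly_op (cesaro N) h) n \<le> \<epsilon> / 4"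
    using scaled_var_cesaro_le[OF h E ne int, of "\<epsilon> / 4"] \<epsilon> by auto
  obtain p where p: "AE x in \<pi>. h x - poly_op (cesaro N) h x = poly_op p h x - op (poly_op p h) x"
    using cesaro_remainder_AE[OF h N(1)] .
  have v: "poly_op p h \<in> L2 \<pi>" by (rule poly_op_L2[OF h])
  obtain u B where u: "u \<in> borel_measurable \<pi>" "\<And>x. \<bar>u x\<bar> \<le> B"
    and close: "ip \<pi> (\<lambda>x. poly_op p h x - u x) (\<lambda>x. poly_op p h x - u x) < \<epsilon> / 32"
    using L2_truncate[OF v, of "\<epsilon> / 32"] \<epsilon> by auto
  have u2: "u \<in> L2 \<pi>" using u by (intro L2_bounded[of u B]) auto
  define d where "d x = poly_op p h x - u x" for x
  have d2: "d \<in> L2 \<pi>" unfolding d_def[abs_def] by (rule L2_diff[OF v u2])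
  have "scaled_var (\<lambda>x. h x - (u x - op u x)) n \<le> \<epsilon>" for n
  proof -
    have "scaled_var (\<lambda>x. h x - (u x - op u x)) n = scaled_var (\<lambda>x. poly_op (cesaro N) h x + (d x - op d x)) n"
    proof (rule scaled_var_cong_AE)
      show "AE x in \<pi>. h x - (u x - op u x) = poly_op (cesaro N) h x + (d x - op d x)"
        using p op_diff_AE[OF L2_integrable[OF v] L2_integrable[OF u2]]
        by eventually_elim (simp add: d_def[abs_def])
    qed (use L2_measurable[OF h] u L2_measurable[OF d2] L2_measurable[OF poly_op_L2[OF h]] in measurable)
    also have "\<dots> \<le> 2 * scaled_var (poly_op (cesaro N) h) n + 2 * scaled_var (\<lambda>x. d x - op d x) n"
      by (intro scaled_var_add_le poly_op_L2 h L2_diff d2 op_L2)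
    also have "\<dots> \<le> 2 * (\<epsilon> / 4) + 2 * (8 * (\<epsilon> / 32))"
      using N(2)[of n] scaled_var_coboundary_le[OF d2, of n] close by (simp add: d_def[abs_def])
    finally show ?thesis by simp
  qed
  with u show ?thesis by (rule that)
qed

end

section \<open>The central limit theorem for reversible kernels\<close>

text \<open>
  Ergodicity of the stationary chain in the sense of the mean ergodic theorem: the ergodic
  averages of a bounded centred function \<open>w\<close> tend to \<open>0\<close> in \<open>L\<^sup>2\<close> exactly when its spectral measure has
  no atom at \<open>1\<close>.
\<close>

locale mean_ergodic_kernel = reversible_kernel +
  assumes no_atom: "w \<in> borel_measurable \<pi> \<Longrightarrow> (\<And>x. x \<in> space \<pi> \<Longrightarrow> \<bar>w x\<bar> \<le> B) \<Longrightarrow> (\<integral>x. w x \<partial>\<pi>) = 0 \<Longrightarrow>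
    spectral w E \<Longrightarrow> AE x in E. x \<noteq> 1"
begin

lemma ip_cesaro_tendsto:
  assumes w: "w \<in> borel_measurable \<pi>" "\<And>x. x \<in> space \<pi> \<Longrightarrow> \<bar>w x\<bar> \<le> B" "(\<integral>x. w x \<partial>\<pi>) = 0"
  shows "(\<lambda>m. ip \<pi> (poly_op (cesaro m) w) (poly_op (cesaro m) w)) \<longlonglongrightarrow> 0"
proof -
  have w2: "w \<in> L2 \<pi>" by (rule L2_bounded[OF w(1,2)])
  obtain E where E: "spectral w E" using spectral_exists[OF w2] by blast
  have ne: "AE x in E. x \<noteq> 1" by (rule no_atom[OF w E])
  have "(\<lambda>m. \<integral>x. (poly (cesaro m) x)\<^sup>2 \<partial>E) \<longlonglongrightarrow> (\<integral>x. 0 \<partial>E)"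
  proof (rule integral_dominated_convergence[where w="\<lambda>x. 1"])
    show "(\<lambda>x. (poly (cesaro m) x)\<^sup>2) \<in> borel_measurable E" for m
      by (rule measurable_interval[OF spectral_sets[OF E]]) measurable
    show "integrable E (\<lambda>_. 1 :: real)" by (intro spectral_integrable[OF E] continuous_intros)
    show "AE x in E. (\<lambda>m. (poly (cesaro m) x)\<^sup>2) \<longlonglongrightarrow> 0"
      using ne AE_space
    proof eventually_elim
      case (elim x)
      then have "(\<lambda>m. poly (cesaro m) x) \<longlonglongrightarrow> 0" using spectral_space[OF E] by (intro poly_cesaro_tendsto) auto
      from tendsto_power[OF this, of 2] show ?case by simp
    qed
    show "AE x in E. norm ((poly (cesaro m) x)\<^sup>2) \<le> 1" for m
    proof (rule AE_I2)
      fix x assume "x \<in> space E"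
      then have "\<bar>poly (cesaro m) x\<bar>\<^sup>2 \<le> 1" using spectral_space[OF E] abs_poly_cesaro_le[of x m] by (intro power_le_one) auto
      then show "norm ((poly (cesaro m) x)\<^sup>2) \<le> 1" by simp
    qed
  qed simp
  then show ?thesis by (simp add: ip_cesaro[OF w2 E])
qed

text \<open>
  The partial sums of \<open>u - K u\<close> are, up to \<open>u(X\<^sub>0) - u(X\<^sub>n)\<close>, sums of the bounded martingale differences
  \<open>D k = u(X\<^sub>k\<^sub>+\<^sub>1) - K u(X\<^sub>k)\<close>. Their conditional variance at \<open>X\<^sub>k = x\<close> exceeds its mean \<open>s2\<close> by a bounded
  centred function \<open>w(x)\<close>. The mean ergodic theorem writes \<open>w = q - K q + e\<close> with \<open>q\<close> bounded and
  \<open>e = A\<^sub>m w\<close> small in \<open>L\<^sup>2\<close>, which is what the martingale estimate requires. First \<open>n\<close> tends to infinity,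
  then \<open>m\<close>.
\<close>

lemma char_coboundary_tendsto:
  assumes u: "u \<in> borel_measurable \<pi>" "\<And>x. \<bar>u x\<bar> \<le> B"
  defines "s2 \<equiv> ip \<pi> u u - ip \<pi> (op u) (op u)"
  shows "(\<lambda>n. \<integral>\<omega>. iexp (t * (part_sum (\<lambda>x. u x - op u x) n \<omega> / sqrt (real n))) \<partial>chain)
           \<longlonglongrightarrow> complex_of_real (exp (- (t\<^sup>2 * s2 / 2)))"
proof -
  interpret chain: prob_space chain by (rule prob_space_chain)
  note [measurable] = u(1)
  have u2: "u \<in> L2 \<pi>" using u by (intro L2_bounded[of u B]) auto
  have s2: "0 \<le> s2" using ip_op_le[OF u2] by (simp add: s2_def)
  have B0: "0 \<le> B" using u(2)[of undefined] by linarith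
  have op_u: "\<bar>op u x\<bar> \<le> B" if "x \<in> space \<pi>" for x by (rule op_bounded[OF u that])
  have usq: "\<bar>(u x)\<^sup>2\<bar> \<le> B\<^sup>2" for x using power_mono[OF u(2)[of x], of 2] by simp
  have op_usq: "\<bar>op (\<lambda>y. (u y)\<^sup>2) x\<bar> \<le> B\<^sup>2" if "x \<in> space \<pi>" for x
    by (rule op_bounded[OF _ usq that]) measurable
  define w where "w x = op (\<lambda>y. (u y)\<^sup>2) x - (op u x)\<^sup>2 - s2" for x
  have w_meas [measurable]: "w \<in> borel_measurable \<pi>" unfolding w_def[abs_def] by measurable
  have w_bound: "\<bar>w x\<bar> \<le> 2 * B\<^sup>2 + s2" if "x \<in> space \<pi>" for x
  proof -
    have "\<bar>(op u x)\<^sup>2\<bar> \<le> B\<^sup>2" using power_mono[OF op_u[OF that], of 2] by simp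
    then show ?thesis using op_usq[OF that] s2 unfolding w_def by linarith
  qed
  have w2: "w \<in> L2 \<pi>" by (rule L2_bounded[OF w_meas w_bound])
  have w_mean: "(\<integral>x. w x \<partial>\<pi>) = 0"
  proof -
    have 1: "integrable \<pi> (\<lambda>y. (u y)\<^sup>2)" "integrable \<pi> (\<lambda>x. (op u x)\<^sup>2)"
      using u2 op_L2[OF u2] by (simp_all add: L2_def)
    show ?thesis
      unfolding w_def using 1 integrable_op[OF 1(1)] integral_op[OF 1(1)] prob_space by (simp add: s2_def ip_self)
  qed
  define D where "D k \<omega> = u (\<omega> (Suc k)) - op u (\<omega> k)" for k and \<omega> :: "nat \<Rightarrow> 'a"
  have D_bound: "\<bar>D k \<omega>\<bar> \<le> 2 * B" if "\<omega> \<in> space chain" for k \<omega>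
    using u(2)[of "\<omega> (Suc k)"] op_u[OF space_chain[OF that], of k] unfolding D_def by linarith
  have D_meas [measurable]: "D k \<in> borel_measurable chain" for k
    unfolding D_def[abs_def] by (intro borel_measurable_diff measurable_compose[OF measurable_coord] u op_measurable)
  have sum_D: "part_sum (\<lambda>x. u x - op u x) n \<omega> = (\<Sum>k<n. D k \<omega>) + u (\<omega> 0) - u (\<omega> n)" for n \<omega>
    unfolding part_sum_def by (induction n) (simp_all add: D_def)
  define \<phi> where "\<phi> n = (\<integral>\<omega>. iexp (t * ((\<Sum>k<n. D k \<omega>) / sqrt (real n))) \<partial>chain)" for n
  define L where "L = complex_of_real (exp (- (t\<^sup>2 * s2 / 2)))"
  have estimate: "\<exists>Q. \<forall>n>0. cmod (\<phi> n - L) \<le> ((2 * B * \<bar>t\<bar>) ^ 3 + t\<^sup>2 * Q * B * \<bar>t\<bar>) / sqrt (real n)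
      + ((t\<^sup>2 * s2 / 2)\<^sup>2 + t\<^sup>2 * Q + t\<^sup>2 / 2 * Q * (t\<^sup>2 * s2 / 2)) / real n + t\<^sup>2 / 2 * sqrt (ip \<pi> (poly_op (cesaro m) w) (poly_op (cesaro m) w))"
    if m: "m > 0" for m
  proof -
    obtain p where p: "AE x in \<pi>. w x - poly_op (cesaro m) w x = poly_op p w x - op (poly_op p w) x"
      using cesaro_remainder_AE[OF w2 m] .
    define q where "q = poly_op p w"
    define e where "e = poly_op (cesaro m) w"
    have [measurable]: "q \<in> borel_measurable \<pi>" "e \<in> borel_measurable \<pi>"
      unfolding q_def e_def by (intro L2_measurable poly_op_L2 w2)+
    have e2: "e \<in> L2 \<pi>" unfolding e_def by (intro poly_op_L2 w2)
    define Q where "Q = (\<Sum>i\<le>degree p. \<bar>coeff p i\<bar> * (2 * B\<^sup>2 + s2))"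
    have q_bound: "\<bar>q x\<bar> \<le> Q" if "x \<in> space \<pi>" for x
      unfolding q_def poly_op_def Q_def
      by (rule order_trans[OF sum_abs], intro sum_mono) (use op_pow_bounded[OF w_meas w_bound that] in \<open>auto simp: abs_mult intro: mult_left_mono\<close>)
    define \<eta> where "\<eta> = sqrt (ip \<pi> e e)"
    have e_bound: "(\<integral>\<omega>. \<bar>e (\<omega> k)\<bar> \<partial>chain) \<le> \<eta>" for k
    proof -
      have "(\<integral>\<omega>. \<bar>e (\<omega> k)\<bar> \<partial>chain) = (\<integral>x. \<bar>e x\<bar> \<partial>\<pi>)" by (rule integral_coord) measurable
      also have "\<dots> \<le> \<eta>"
        unfolding \<eta>_def ip_self using e2 by (intro expectation_abs_le_sqrt) (auto simp: L2_def)
      finally show ?thesis .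
    qed
    have "cmod (\<phi> n - L) \<le> ((2 * B * \<bar>t\<bar>) ^ 3 + t\<^sup>2 * Q * B * \<bar>t\<bar>) / sqrt (real n)
      + ((t\<^sup>2 * s2 / 2)\<^sup>2 + t\<^sup>2 * Q + t\<^sup>2 / 2 * Q * (t\<^sup>2 * s2 / 2)) / real n + t\<^sup>2 / 2 * \<eta>" if n: "n > 0" for n
    proof -
      define d where "d = sqrt (real n)"
      have d: "d > 0" "real n = d * d" using n by (simp_all add: d_def)
      define s where "s = t / d"
      define Y where "Y k \<eta> = iexp (s * (\<Sum>j<k. D j \<eta>))" for k and \<eta> :: "nat \<Rightarrow> 'a"
      have Y_meas [measurable]: "Y k \<in> borel_measurable (path (Suc k))" for k
      proof -
        have "(\<lambda>\<eta>. \<Sum>j<k. D j \<eta>) \<in> borel_measurable (path (Suc k))"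
          unfolding D_def
          by (intro borel_measurable_sum borel_measurable_diff measurable_compose[OF _ u(1)] measurable_compose[OF _ op_measurable[OF u(1)]] measurable_component_singleton) auto
        then show ?thesis unfolding Y_def[abs_def] by measurable
      qed
      have Y_restrict: "Y k (restrict \<omega> {0..<Suc k}) = Y k \<omega>" for k \<omega>
        by (simp add: Y_def D_def)
      have Y1: "cmod (Y k \<omega>) = 1" for k \<omega> by (simp add: Y_def)
      have orth: "(\<integral>\<omega>. (Y k \<omega> * z (\<omega> k)) * complex_of_real (b (\<omega> (Suc k)) - op b (\<omega> k)) \<partial>chain) = 0 \<and>
           integrable chain (\<lambda>\<omega>. (Y k \<omega> * z (\<omega> k)) * complex_of_real (b (\<omega> (Suc k)) - op b (\<omega> k)))"
        if z [measurable]: "z \<in> borel_measurable \<pi>" and zC: "\<And>x. x \<in> space \<pi> \<Longrightarrow> cmod (z x) \<le> C"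
          and b: "b \<in> borel_measurable \<pi>" "\<And>x. x \<in> space \<pi> \<Longrightarrow> \<bar>b x\<bar> \<le> C'" for z :: "'a \<Rightarrow> complex" and b C C' k
      proof -
        have meas: "(\<lambda>\<eta>. Y k \<eta> * z (\<eta> k)) \<in> borel_measurable (path (Suc k))"
          by (intro borel_measurable_times Y_meas measurable_compose[OF _ z] measurable_component_singleton) auto
        have bnd: "cmod (Y k \<eta> * z (\<eta> k)) \<le> C" if "\<eta> \<in> space (path (Suc k))" for \<eta>
          using that zC[of "\<eta> k"] by (auto simp: norm_mult Y1 space_PiM PiE_iff)
        show ?thesis
          using chain_martingale_orthogonal[OF meas bnd b] by (simp add: Y_restrict)
      qed
      have orth1: "(\<integral>\<omega>. Y k \<omega> * complex_of_real (D k \<omega>) \<partial>chain) = 0" for k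
        using orth[of "\<lambda>_. 1" 1 u B k] u by (simp add: D_def)
      have orth2: "(\<integral>\<omega>. Y k \<omega> * complex_of_real ((D k \<omega>)\<^sup>2 - s2 - (q (\<omega> k) - q (\<omega> (Suc k))) - e (\<omega> k)) \<partial>chain) = 0" for k
      proof -
        \<comment> \<open>The three martingale parts of \<open>(D k)\<^sup>2 - s2 - (q k - q (k + 1)) - e k\<close>: from \<open>u\<^sup>2\<close>, from the cross term
          \<open>- 2 K u(X\<^sub>k) u(X\<^sub>k\<^sub>+\<^sub>1)\<close>, and from \<open>q\<close>.\<close>
        define A1 where "A1 \<omega> = (Y k \<omega> * 1) * complex_of_real ((u (\<omega> (Suc k)))\<^sup>2 - op (\<lambda>y. (u y)\<^sup>2) (\<omega> k))" for \<omega>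
        define A2 where "A2 \<omega> = (Y k \<omega> * complex_of_real (- 2 * op u (\<omega> k))) * complex_of_real (u (\<omega> (Suc k)) - op u (\<omega> k))" for \<omega>
        define A3 where "A3 \<omega> = (Y k \<omega> * 1) * complex_of_real (q (\<omega> (Suc k)) - op q (\<omega> k))" for \<omega>
        have A1: "(\<integral>\<omega>. A1 \<omega> \<partial>chain) = 0" "integrable chain A1"
          using orth[of "\<lambda>_. 1" 1 "\<lambda>y. (u y)\<^sup>2" "B\<^sup>2" k] usq unfolding A1_def[abs_def] by auto
        have A2: "(\<integral>\<omega>. A2 \<omega> \<partial>chain) = 0" "integrable chain A2"
          using orth[of "\<lambda>x. complex_of_real (- 2 * op u x)" "2 * B" u B k] u op_u unfolding A2_def[abs_def] by (auto simp: norm_mult)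
        have A3: "(\<integral>\<omega>. A3 \<omega> \<partial>chain) = 0" "integrable chain A3"
          using orth[of "\<lambda>_. 1" 1 q Q k] q_bound unfolding A3_def[abs_def] by auto
        have "(\<integral>\<omega>. Y k \<omega> * complex_of_real ((D k \<omega>)\<^sup>2 - s2 - (q (\<omega> k) - q (\<omega> (Suc k))) - e (\<omega> k)) \<partial>chain) = (\<integral>\<omega>. A1 \<omega> + A2 \<omega> + A3 \<omega> \<partial>chain)"
        proof (rule integral_cong_AE)
          have [measurable]: "Y k \<in> borel_measurable chain" by (simp add: Y_def[abs_def])
          have [measurable]: "(\<lambda>\<omega>. b (\<omega> i)) \<in> borel_measurable chain" if "b \<in> borel_measurable \<pi>" for b :: "'a \<Rightarrow> real" and i
            by (rule measurable_compose[OF measurable_coord that])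
          show "(\<lambda>\<omega>. Y k \<omega> * complex_of_real ((D k \<omega>)\<^sup>2 - s2 - (q (\<omega> k) - q (\<omega> (Suc k))) - e (\<omega> k))) \<in> borel_measurable chain"
            by measurable
          show "(\<lambda>\<omega>. A1 \<omega> + A2 \<omega> + A3 \<omega>) \<in> borel_measurable chain"
            using A1 A2 A3 by (intro borel_measurable_add borel_measurable_integrable)
          have "AE \<omega> in chain. w (\<omega> k) - e (\<omega> k) = q (\<omega> k) - op q (\<omega> k)"
            using AE_coord[OF p, of k] by (simp add: q_def e_def)
          then show "AE \<omega> in chain. Y k \<omega> * complex_of_real ((D k \<omega>)\<^sup>2 - s2 - (q (\<omega> k) - q (\<omega> (Suc k))) - e (\<omega> k)) = A1 \<omega> + A2 \<omega> + A3 \<omega>"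
          proof eventually_elim
            case (elim \<omega>)
            then have e: "e (\<omega> k) = op (\<lambda>y. (u y)\<^sup>2) (\<omega> k) - (op u (\<omega> k))\<^sup>2 - s2 - q (\<omega> k) + op q (\<omega> k)" by (simp add: w_def)
            have "(D k \<omega>)\<^sup>2 - s2 - (q (\<omega> k) - q (\<omega> (Suc k))) - e (\<omega> k) =
               ((u (\<omega> (Suc k)))\<^sup>2 - op (\<lambda>y. (u y)\<^sup>2) (\<omega> k)) + (- 2 * op u (\<omega> k)) * (u (\<omega> (Suc k)) - op u (\<omega> k)) + (q (\<omega> (Suc k)) - op q (\<omega> k))"
              unfolding e by (simp add: D_def power2_eq_square algebra_simps)
            then show ?case unfolding A1_def A2_def A3_def by (simp only: of_real_add of_real_mult distrib_left mult_1_right mult.assoc)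
          qed
        qed
        also have "\<dots> = 0" using A1 A2 A3 by simp
        finally show ?thesis .
      qed
      have "cmod ((\<integral>\<omega>. iexp (s * (\<Sum>j<n. D j \<omega>)) \<partial>chain) - complex_of_real (exp (- (s\<^sup>2 * s2 / 2)) ^ n)) \<le>
           real n * ((2 * B * \<bar>s\<bar>) ^ 3 + (s\<^sup>2 * s2 / 2)\<^sup>2) + s\<^sup>2 / 2 * (Q * (2 + real n * (2 * B * \<bar>s\<bar> + s\<^sup>2 * s2 / 2)) + real n * \<eta>)"
      proof (rule chain.bounded_martingale_char_estimate[where q="\<lambda>k \<omega>. q (\<omega> k)" and e="\<lambda>k \<omega>. e (\<omega> k)"])
        show "integrable chain (\<lambda>\<omega>. e (\<omega> k))" for k by (rule integrable_coord[OF L2_integrable[OF e2]])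
      qed (use orth1 orth2 D_bound q_bound space_chain e_bound s2 in
           \<open>auto simp: Y_def intro: measurable_compose[OF measurable_coord]\<close>)
      also have "exp (- (s\<^sup>2 * s2 / 2)) ^ n = exp (- (t\<^sup>2 * s2 / 2))"
        unfolding exp_of_nat_mult[symmetric] s_def using d by (simp add: power2_eq_square)
      also have "(\<integral>\<omega>. iexp (s * (\<Sum>j<n. D j \<omega>)) \<partial>chain) = \<phi> n" by (simp add: \<phi>_def s_def d_def)
      also have "real n * ((2 * B * \<bar>s\<bar>) ^ 3 + (s\<^sup>2 * s2 / 2)\<^sup>2) + s\<^sup>2 / 2 * (Q * (2 + real n * (2 * B * \<bar>s\<bar> + s\<^sup>2 * s2 / 2)) + real n * \<eta>) =
          ((2 * B * \<bar>t\<bar>) ^ 3 + t\<^sup>2 * Q * B * \<bar>t\<bar>) / d + ((t\<^sup>2 * s2 / 2)\<^sup>2 + t\<^sup>2 * Q + t\<^sup>2 / 2 * Q * (t\<^sup>2 * s2 / 2)) / real n + t\<^sup>2 / 2 * \<eta>"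
      proof -
        have "\<bar>s\<bar> = \<bar>t\<bar> / d" using d by (simp add: s_def)
        then show ?thesis unfolding d(2) s_def using d(1)
          by (simp add: field_simps power2_eq_square power3_eq_cube)
      qed
      finally show ?thesis unfolding L_def d_def .
    qed
    then show ?thesis unfolding \<eta>_def e_def by blast
  qed
  have "\<phi> \<longlonglongrightarrow> L"
  proof (rule tendstoI)
    fix \<epsilon> :: real assume "\<epsilon> > 0"
    have "(\<lambda>m. t\<^sup>2 / 2 * sqrt (ip \<pi> (poly_op (cesaro m) w) (poly_op (cesaro m) w))) \<longlonglongrightarrow> t\<^sup>2 / 2 * sqrt 0"
      by (intro tendsto_intros ip_cesaro_tendsto[OF w_meas w_bound w_mean])
    then have "\<forall>\<^sub>F m in sequentially. t\<^sup>2 / 2 * sqrt (ip \<pi> (poly_op (cesaro m) w) (poly_op (cesaro m) w)) < \<epsilon> / 2"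
      by (rule order_tendstoD(2)) (use \<open>\<epsilon> > 0\<close> in simp)
    then have "\<forall>\<^sub>F m in sequentially. t\<^sup>2 / 2 * sqrt (ip \<pi> (poly_op (cesaro m) w) (poly_op (cesaro m) w)) < \<epsilon> / 2 \<and> m > 0"
      using eventually_gt_at_top[of 0] by eventually_elim simp
    then obtain m where m: "m > 0" and small: "t\<^sup>2 / 2 * sqrt (ip \<pi> (poly_op (cesaro m) w) (poly_op (cesaro m) w)) < \<epsilon> / 2"
      by (auto simp: eventually_sequentially)
    from estimate[OF m] obtain c1 c2 where est: "\<And>n. n > 0 \<Longrightarrow> cmod (\<phi> n - L) \<le> c1 / sqrt (real n) + c2 / real n
        + t\<^sup>2 / 2 * sqrt (ip \<pi> (poly_op (cesaro m) w) (poly_op (cesaro m) w))" by blast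
    have "(\<lambda>n. c1 / sqrt (real n) + c2 / real n) \<longlonglongrightarrow> 0" by real_asymp
    then have "\<forall>\<^sub>F n in sequentially. c1 / sqrt (real n) + c2 / real n < \<epsilon> / 2"
      using \<open>\<epsilon> > 0\<close> by (intro order_tendstoD(2)) auto
    then show "\<forall>\<^sub>F n in sequentially. dist (\<phi> n) L < \<epsilon>"
      using eventually_gt_at_top[of 0]
    proof eventually_elim
      case (elim n)
      then show ?case using est[of n] small unfolding dist_norm by linarith
    qed
  qed
  moreover have "(\<lambda>n. (\<integral>\<omega>. iexp (t * (part_sum (\<lambda>x. u x - op u x) n \<omega> / sqrt (real n))) \<partial>chain) - \<phi> n) \<longlonglongrightarrow> 0"
  proof (rule Lim_null_comparison)
    show "(\<lambda>n. \<bar>t\<bar> * (2 * B) / sqrt (real n)) \<longlonglongrightarrow> 0" by real_asymp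
    show "\<forall>\<^sub>F n in sequentially. norm ((\<integral>\<omega>. iexp (t * (part_sum (\<lambda>x. u x - op u x) n \<omega> / sqrt (real n))) \<partial>chain) - \<phi> n)
        \<le> \<bar>t\<bar> * (2 * B) / sqrt (real n)"
    proof (intro always_eventually allI)
      fix n
      define X where "X \<omega> = part_sum (\<lambda>x. u x - op u x) n \<omega> / sqrt (real n)" for \<omega>
      define M where "M \<omega> = (\<Sum>k<n. D k \<omega>) / sqrt (real n)" for \<omega>
      have [measurable]: "X \<in> borel_measurable chain" "M \<in> borel_measurable chain"
        unfolding X_def[abs_def] M_def[abs_def] by measurable
      have le: "(X \<omega> - M \<omega>)\<^sup>2 \<le> (2 * B / sqrt (real n))\<^sup>2" for \<omega>
      proof -
        have "\<bar>u (\<omega> 0) - u (\<omega> n)\<bar> \<le> 2 * B" using u(2)[of "\<omega> 0"] u(2)[of "\<omega> n"] by linarith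
        then have "\<bar>X \<omega> - M \<omega>\<bar> \<le> 2 * B / sqrt (real n)"
          by (simp add: X_def M_def sum_D diff_divide_distrib[symmetric] abs_divide divide_right_mono)
        from power_mono[OF this, of 2] show ?thesis by simp
      qed
      have int: "integrable chain (\<lambda>\<omega>. (X \<omega> - M \<omega>)\<^sup>2)"
        by (rule chain.integrable_const_bound[where B="(2 * B / sqrt (real n))\<^sup>2"]) (use le in auto)
      have "(\<integral>\<omega>. (X \<omega> - M \<omega>)\<^sup>2 \<partial>chain) \<le> (\<integral>\<omega>. (2 * B / sqrt (real n))\<^sup>2 \<partial>chain)"
        by (intro integral_mono int le) simp
      then have "sqrt (\<integral>\<omega>. (X \<omega> - M \<omega>)\<^sup>2 \<partial>chain) \<le> 2 * B / sqrt (real n)"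
        using B0 by (intro real_le_lsqrt) (simp_all add: chain.prob_space)
      from mult_left_mono[OF this, of "\<bar>t\<bar>"]
      show "norm ((\<integral>\<omega>. iexp (t * (part_sum (\<lambda>x. u x - op u x) n \<omega> / sqrt (real n))) \<partial>chain) - \<phi> n)
        \<le> \<bar>t\<bar> * (2 * B) / sqrt (real n)"
        using chain.norm_char_diff_le[of X M t, OF _ _ int] by (simp add: X_def M_def \<phi>_def)
    qed
  qed
  ultimately show ?thesis unfolding L_def[symmetric] by (rule Lim_transform)
qed

text \<open>
  Approximation by bounded coboundaries changes the characteristic functions by at most \<open>|t| \<surd>\<epsilon>\<close>,
  uniformly in \<open>n\<close>, and the limiting variances by a multiple of \<open>\<surd>\<epsilon>\<close>.
\<close>

lemma char_tendsto:
  assumes h: "h \<in> L2 \<pi>" and E: "spectral h E" and ne: "AE x in E. x \<noteq> 1" and int: "integrable E (\<lambda>x. 1 / (1 - x))"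
  defines "v \<equiv> (\<integral>x. (1 + x) / (1 - x) \<partial>E)"
  shows "(\<lambda>n. \<integral>\<omega>. iexp (t * (part_sum h n \<omega> / sqrt (real n))) \<partial>chain) \<longlonglongrightarrow> complex_of_real (exp (- (t\<^sup>2 * v / 2)))"
proof (rule tendstoI)
  interpret chain: prob_space chain by (rule prob_space_chain)
  fix \<epsilon>' :: real assume \<epsilon>': "\<epsilon>' > 0"
  have V: "scaled_var h \<longlonglongrightarrow> v" unfolding v_def by (rule scaled_var_tendsto[OF h E ne int])
  have v0: "0 \<le> v" by (rule LIMSEQ_le_const[OF V]) (use scaled_var_nonneg in auto)
  \<comment> \<open>The sum of both approximation errors; it vanishes as \<open>\<epsilon>\<close> tends to \<open>0\<close>.\<close>
  define c where "c \<epsilon> = \<bar>t\<bar> * sqrt \<epsilon> + t\<^sup>2 / 2 * (sqrt \<epsilon> * (1 / 2 + 4 * v + \<epsilon>))" for \<epsilon>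
  have "(c \<longlongrightarrow> c 0) (at_right 0)"
    unfolding c_def by (intro tendsto_intros)
  then have "\<forall>\<^sub>F \<epsilon> in at_right 0. c \<epsilon> < \<epsilon>' / 2"
    by (rule order_tendstoD(2)) (use \<epsilon>' in \<open>simp add: c_def\<close>)
  then have "\<forall>\<^sub>F \<epsilon> in at_right 0. c \<epsilon> < \<epsilon>' / 2 \<and> 0 < \<epsilon>"
    using eventually_at_right_less[of 0] by eventually_elim simp
  then obtain \<epsilon> where \<epsilon>: "\<epsilon> > 0" "c \<epsilon> < \<epsilon>' / 2"
    using eventually_happens'[OF trivial_limit_at_right_real] by blast
  obtain u B where u: "u \<in> borel_measurable \<pi>" "\<And>x. \<bar>u x\<bar> \<le> B"
    and close: "\<And>n. scaled_var (\<lambda>x. h x - (u x - op u x)) n \<le> \<epsilon>"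
    using approx_bounded_coboundary[OF h E ne int \<epsilon>(1)] by blast
  have u2: "u \<in> L2 \<pi>" using u by (intro L2_bounded[of u B]) auto
  define k where "k x = u x - op u x" for x
  have k2: "k \<in> L2 \<pi>" unfolding k_def[abs_def] by (intro L2_diff op_L2 u2)
  define s2 where "s2 = ip \<pi> u u - ip \<pi> (op u) (op u)"
  have s2: "0 \<le> s2" using ip_op_le[OF u2] by (simp add: s2_def)
  have "(\<lambda>n. \<bar>scaled_var h n - scaled_var k n\<bar>) \<longlonglongrightarrow> \<bar>v - s2\<bar>"
    unfolding s2_def k_def[abs_def] by (intro tendsto_intros V scaled_var_coboundary_tendsto u2)
  moreover have "(\<lambda>n. sqrt \<epsilon> * (1 / 2 + 4 * scaled_var h n + \<epsilon>)) \<longlonglongrightarrow> sqrt \<epsilon> * (1 / 2 + 4 * v + \<epsilon>)"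
    by (intro tendsto_intros V)
  ultimately have vs: "\<bar>v - s2\<bar> \<le> sqrt \<epsilon> * (1 / 2 + 4 * v + \<epsilon>)"
    using scaled_var_close[OF h k2 \<epsilon>(1)] close by (intro LIMSEQ_le) (auto simp: k_def)
  have diff: "cmod ((\<integral>\<omega>. iexp (t * (part_sum h n \<omega> / sqrt (real n))) \<partial>chain) - (\<integral>\<omega>. iexp (t * (part_sum k n \<omega> / sqrt (real n))) \<partial>chain))
      \<le> \<bar>t\<bar> * sqrt \<epsilon>" for n
  proof -
    have eq: "(part_sum h n \<omega> / sqrt (real n) - part_sum k n \<omega> / sqrt (real n))\<^sup>2 = (part_sum (\<lambda>x. h x - k x) n \<omega>)\<^sup>2 / real n" for \<omega>
      by (simp add: part_sum_def sum_subtractf diff_divide_distrib[symmetric] power_divide)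
    have sq: "integrable chain (\<lambda>\<omega>. (part_sum (\<lambda>x. h x - k x) n \<omega>)\<^sup>2)"
      using part_sum_L2[OF L2_diff[OF h k2], of n] by (simp add: L2_def)
    have "cmod ((\<integral>\<omega>. iexp (t * (part_sum h n \<omega> / sqrt (real n))) \<partial>chain) - (\<integral>\<omega>. iexp (t * (part_sum k n \<omega> / sqrt (real n))) \<partial>chain))
      \<le> \<bar>t\<bar> * sqrt (\<integral>\<omega>. (part_sum h n \<omega> / sqrt (real n) - part_sum k n \<omega> / sqrt (real n))\<^sup>2 \<partial>chain)"
    proof (rule chain.norm_char_diff_le)
      show "integrable chain (\<lambda>\<omega>. (part_sum h n \<omega> / sqrt (real n) - part_sum k n \<omega> / sqrt (real n))\<^sup>2)"
        unfolding eq using sq by simp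
    qed (use L2_measurable[OF h] L2_measurable[OF k2] in measurable)
    also have "\<dots> = \<bar>t\<bar> * sqrt (scaled_var (\<lambda>x. h x - k x) n)"
      unfolding eq by (simp add: scaled_var_def)
    also have "\<dots> \<le> \<bar>t\<bar> * sqrt \<epsilon>"
      using close[of n] by (intro mult_left_mono) (auto simp: k_def)
    finally show ?thesis .
  qed
  have diff_exp: "cmod (complex_of_real (exp (- (t\<^sup>2 * s2 / 2))) - complex_of_real (exp (- (t\<^sup>2 * v / 2)))) \<le> t\<^sup>2 / 2 * (sqrt \<epsilon> * (1 / 2 + 4 * v + \<epsilon>))"
  proof -
    have "cmod (complex_of_real (exp (- (t\<^sup>2 * s2 / 2))) - complex_of_real (exp (- (t\<^sup>2 * v / 2)))) = \<bar>exp (- (t\<^sup>2 * s2 / 2)) - exp (- (t\<^sup>2 * v / 2))\<bar>"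
      by (metis norm_of_real of_real_diff)
    also have "\<dots> \<le> \<bar>t\<^sup>2 * s2 / 2 - t\<^sup>2 * v / 2\<bar>" using s2 v0 by (intro abs_exp_minus_diff_le) auto
    also have "\<dots> = t\<^sup>2 / 2 * \<bar>v - s2\<bar>"
    proof -
      have "t\<^sup>2 * s2 / 2 - t\<^sup>2 * v / 2 = - (t\<^sup>2 / 2 * (v - s2))" by (simp add: algebra_simps diff_divide_distrib)
      then show ?thesis by (simp only: abs_minus abs_mult) simp
    qed
    also have "\<dots> \<le> t\<^sup>2 / 2 * (sqrt \<epsilon> * (1 / 2 + 4 * v + \<epsilon>))" by (intro mult_left_mono vs) simp
    finally show ?thesis .
  qed
  have "\<forall>\<^sub>F n in sequentially. dist (\<integral>\<omega>. iexp (t * (part_sum k n \<omega> / sqrt (real n))) \<partial>chain) (complex_of_real (exp (- (t\<^sup>2 * s2 / 2)))) < \<epsilon>' / 2"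
    unfolding k_def[abs_def] s2_def using \<epsilon>' by (intro tendstoD char_coboundary_tendsto[OF u]) simp
  then show "\<forall>\<^sub>F n in sequentially. dist (\<integral>\<omega>. iexp (t * (part_sum h n \<omega> / sqrt (real n))) \<partial>chain) (complex_of_real (exp (- (t\<^sup>2 * v / 2)))) < \<epsilon>'"
  proof eventually_elim
    case (elim n)
    let ?a = "\<integral>\<omega>. iexp (t * (part_sum h n \<omega> / sqrt (real n))) \<partial>chain"
    let ?b = "\<integral>\<omega>. iexp (t * (part_sum k n \<omega> / sqrt (real n))) \<partial>chain"
    let ?c = "complex_of_real (exp (- (t\<^sup>2 * s2 / 2)))"
    let ?d = "complex_of_real (exp (- (t\<^sup>2 * v / 2)))"
    have "dist ?a ?d \<le> dist ?a ?b + dist ?b ?c + dist ?c ?d"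
      by (meson dist_triangle order_trans add_right_mono)
    also have "\<dots> < \<bar>t\<bar> * sqrt \<epsilon> + \<epsilon>' / 2 + t\<^sup>2 / 2 * (sqrt \<epsilon> * (1 / 2 + 4 * v + \<epsilon>))"
      using diff[of n] diff_exp elim unfolding dist_norm by linarith
    also have "\<dots> < \<epsilon>'" using \<epsilon>(2) unfolding c_def by linarith
    finally show ?case .
  qed
qed

lemma char_centered_normal:
  assumes "0 \<le> v"
  shows "char (centered_normal v) t = complex_of_real (exp (- (t\<^sup>2 * v / 2)))"
proof -
  have "char (centered_normal v) t = char std_normal_distribution (t * sqrt v)"
    unfolding centered_normal_def char_def by (subst integral_distr) (auto simp: mult.assoc)
  also have "\<dots> = complex_of_real (exp (- (t\<^sup>2 * v / 2)))"
    unfolding char_std_normal_distribution using assms by (simp add: power_mult_distrib)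
  finally show ?thesis .
qed

theorem clt_of_spectral:
  assumes f: "f \<in> L2 \<pi>" and E: "spectral (\<lambda>x. f x - (\<integral>x. f x \<partial>\<pi>)) E"
    and ne: "AE x in E. x \<noteq> 1" and int: "integrable E (\<lambda>x. 1 / (1 - x))"
  shows "clt_holds \<pi> K f (\<integral>x. (1 + x) / (1 - x) \<partial>E)"
proof -
  define h where "h x = f x - (\<integral>x. f x \<partial>\<pi>)" for x
  have h2: "h \<in> L2 \<pi>" unfolding h_def[abs_def] by (intro L2_diff f L2_const)
  have E': "spectral h E" using E unfolding h_def[abs_def] .
  define v where "v = (\<integral>x. (1 + x) / (1 - x) \<partial>E)"
  have v0: "0 \<le> v"
    by (rule LIMSEQ_le_const[OF scaled_var_tendsto[OF h2 E' ne int, folded v_def]]) (use scaled_var_nonneg in auto)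
  have "weak_conv_m (\<lambda>n. distr chain borel (\<lambda>\<omega>. part_sum h n \<omega> / sqrt (real n))) (centered_normal v)"
  proof (rule levy_continuity)
    have [measurable]: "part_sum h n \<in> borel_measurable chain" for n by (rule part_sum_measurable[OF L2_measurable[OF h2]])
    show "real_distribution (distr chain borel (\<lambda>\<omega>. part_sum h n \<omega> / sqrt (real n)))" for n
      by (intro prob_space.real_distribution_distr prob_space_chain) measurable
    show "real_distribution (centered_normal v)"
      unfolding centered_normal_def using real_dist_normal_dist
      by (intro prob_space.real_distribution_distr) (auto simp: real_distribution_def)
    show "(\<lambda>n. char (distr chain borel (\<lambda>\<omega>. part_sum h n \<omega> / sqrt (real n))) t) \<longlonglongrightarrow> char (centered_normal v) t" for t
      unfolding char_centered_normal[OF v0]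
      using char_tendsto[OF h2 E' ne int, of t] unfolding v_def[symmetric] char_def
      by (subst integral_distr) auto
  qed
  then show ?thesis
    unfolding clt_holds_def sqrt_ergodic_avg v_def[symmetric] h_def[abs_def] using v0 by simp
qed

end

section \<open>Reversibility and powers of a kernel\<close>

context markov_kernel
begin

text \<open>
  Taking \<open>\<phi>\<close> to be the identity or the swap covers both sides of the definition of reversibility.
\<close>

lemma joint_law_integral:
  fixes F :: "'a \<times> 'a \<Rightarrow> real"
  assumes \<phi>: "\<phi> \<in> \<pi> \<Otimes>\<^sub>M \<pi> \<rightarrow>\<^sub>M \<pi> \<Otimes>\<^sub>M \<pi>" and F: "F \<in> borel_measurable (\<pi> \<Otimes>\<^sub>M \<pi>)"
    and a: "a \<in> L2 \<pi>" and b: "b \<in> L2 \<pi>"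
    and le: "\<And>x y. \<bar>F (\<phi> (x, y))\<bar> \<le> (a x)\<^sup>2 + (b y)\<^sup>2"
  shows "(\<integral>z. F z \<partial>(\<pi> \<bind> (\<lambda>x. K x \<bind> (\<lambda>y. return (\<pi> \<Otimes>\<^sub>M \<pi>) (\<phi> (x, y)))))) = (\<integral>x. \<integral>y. F (\<phi> (x, y)) \<partial>K x \<partial>\<pi>)"
proof -
  define N where "N x = K x \<bind> (\<lambda>y. return (\<pi> \<Otimes>\<^sub>M \<pi>) (\<phi> (x, y)))" for x
  have \<phi>x: "(\<lambda>y. \<phi> (x, y)) \<in> K x \<rightarrow>\<^sub>M \<pi> \<Otimes>\<^sub>M \<pi>" if "x \<in> space \<pi>" for x
    by (intro measurable_K[OF that] measurable_compose[OF _ \<phi>] measurable_Pair1' that)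
  have N_eq: "N x = distr (K x) (\<pi> \<Otimes>\<^sub>M \<pi>) (\<lambda>y. \<phi> (x, y))" if "x \<in> space \<pi>" for x
    unfolding N_def using that space_K[OF that] not_empty by (intro bind_return_distr' \<phi>x) auto
  have "(\<lambda>x. distr (K x) (\<pi> \<Otimes>\<^sub>M \<pi>) (\<lambda>y. \<phi> (x, y))) \<in> \<pi> \<rightarrow>\<^sub>M subprob_algebra (\<pi> \<Otimes>\<^sub>M \<pi>)"
    by (rule measurable_distr2[OF _ K_sub]) (simp add: split_def \<phi>)
  then have N: "N \<in> \<pi> \<rightarrow>\<^sub>M subprob_algebra (\<pi> \<Otimes>\<^sub>M \<pi>)"
    by (subst measurable_cong[OF N_eq]) auto
  have [measurable]: "a \<in> borel_measurable \<pi>" "b \<in> borel_measurable \<pi>" using a b by (auto intro: L2_measurable)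
  have "(\<integral>\<^sup>+z. norm (F z) \<partial>(\<pi> \<bind> N)) = (\<integral>\<^sup>+x. \<integral>\<^sup>+z. norm (F z) \<partial>N x \<partial>\<pi>)"
    using F by (intro nn_integral_bind[OF _ N]) auto
  also have "\<dots> = (\<integral>\<^sup>+x. \<integral>\<^sup>+y. norm (F (\<phi> (x, y))) \<partial>K x \<partial>\<pi>)"
    using F by (intro nn_integral_cong) (simp add: N_eq nn_integral_distr[OF \<phi>x])
  also have "\<dots> \<le> (\<integral>\<^sup>+x. \<integral>\<^sup>+y. ennreal ((a x)\<^sup>2) + ennreal ((b y)\<^sup>2) \<partial>K x \<partial>\<pi>)"
    using le by (intro nn_integral_mono) (simp add: ennreal_plus[symmetric] del: ennreal_plus)
  also have "\<dots> = (\<integral>\<^sup>+x. ennreal ((a x)\<^sup>2) + (\<integral>\<^sup>+y. ennreal ((b y)\<^sup>2) \<partial>K x) \<partial>\<pi>)"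
  proof (rule nn_integral_cong)
    fix x assume x: "x \<in> space \<pi>"
    have [measurable]: "b \<in> borel_measurable (K x)" by (intro measurable_K x) measurable
    show "(\<integral>\<^sup>+y. ennreal ((a x)\<^sup>2) + ennreal ((b y)\<^sup>2) \<partial>K x) = ennreal ((a x)\<^sup>2) + (\<integral>\<^sup>+y. ennreal ((b y)\<^sup>2) \<partial>K x)"
      by (subst nn_integral_add) (use prob_space.emeasure_space_1[OF K_prob[OF x]] in auto)
  qed
  also have "\<dots> = (\<integral>\<^sup>+x. ennreal ((a x)\<^sup>2) \<partial>\<pi>) + (\<integral>\<^sup>+x. \<integral>\<^sup>+y. ennreal ((b y)\<^sup>2) \<partial>K x \<partial>\<pi>)"
    by (intro nn_integral_add measurable_compose[OF K_sub nn_integral_measurable_subprob_algebra]) measurable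
  also have "(\<integral>\<^sup>+x. \<integral>\<^sup>+y. ennreal ((b y)\<^sup>2) \<partial>K x \<partial>\<pi>) = (\<integral>\<^sup>+x. ennreal ((b x)\<^sup>2) \<partial>\<pi>)"
    by (rule nn_integral_K) measurable
  also have "(\<integral>\<^sup>+x. ennreal ((a x)\<^sup>2) \<partial>\<pi>) + (\<integral>\<^sup>+x. ennreal ((b x)\<^sup>2) \<partial>\<pi>) < \<infinity>"
    using a b by (simp add: L2_def integrable_iff_bounded)
  finally have fin: "(\<integral>\<^sup>+z. norm (F z) \<partial>(\<pi> \<bind> N)) < \<infinity>" .
  have sets: "sets (\<pi> \<bind> N) = sets (\<pi> \<Otimes>\<^sub>M \<pi>)"
    using N not_empty by (intro sets_bind) (auto dest: measurable_space simp: space_subprob_algebra)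
  have "integrable (\<pi> \<bind> N) F"
    using F fin by (intro integrableI_bounded) (simp_all add: measurable_cong_sets[OF sets refl])
  from integral_bind_integrable[OF N F this not_empty]
  have "(\<integral>z. F z \<partial>(\<pi> \<bind> N)) = (\<integral>x. \<integral>z. F z \<partial>N x \<partial>\<pi>)" .
  also have "\<dots> = (\<integral>x. \<integral>y. F (\<phi> (x, y)) \<partial>K x \<partial>\<pi>)"
    by (intro Bochner_Integration.integral_cong refl) (simp add: N_eq integral_distr[OF \<phi>x F])
  finally show ?thesis unfolding N_def .
qed

lemma reversible_imp_reversible_kernel:
  assumes rev: "reversible \<pi> K"
  shows "reversible_kernel \<pi> K"
proof
  fix f g assume f: "f \<in> L2 \<pi>" and g: "g \<in> L2 \<pi>"
  have [measurable]: "f \<in> borel_measurable \<pi>" "g \<in> borel_measurable \<pi>" using f g by (auto intro: L2_measurable)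
  define F where "F = (\<lambda>(x, y). f x * g y)"
  have F: "F \<in> borel_measurable (\<pi> \<Otimes>\<^sub>M \<pi>)" unfolding F_def by measurable
  have 1: "(\<integral>z. F z \<partial>(\<pi> \<bind> (\<lambda>x. K x \<bind> (\<lambda>y. return (\<pi> \<Otimes>\<^sub>M \<pi>) ((\<lambda>z. z) (x, y)))))) = (\<integral>x. \<integral>y. F ((\<lambda>z. z) (x, y)) \<partial>K x \<partial>\<pi>)"
    by (rule joint_law_integral[OF _ F f g]) (auto simp: F_def abs_mult_le_sum_squares)
  have 2: "(\<integral>z. F z \<partial>(\<pi> \<bind> (\<lambda>y. K y \<bind> (\<lambda>x. return (\<pi> \<Otimes>\<^sub>M \<pi>) (prod.swap (y, x)))))) = (\<integral>y. \<integral>x. F (prod.swap (y, x)) \<partial>K y \<partial>\<pi>)"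
  proof (rule joint_law_integral[OF _ F g f])
    show "prod.swap \<in> \<pi> \<Otimes>\<^sub>M \<pi> \<rightarrow>\<^sub>M \<pi> \<Otimes>\<^sub>M \<pi>"
    proof -
      have "prod.swap = (\<lambda>(x, y). (y, x) :: 'a \<times> 'a)" by (auto simp: fun_eq_iff)
      then show ?thesis using measurable_pair_swap'[of \<pi> \<pi>] by (simp only:)
    qed
    show "\<bar>F (prod.swap (x, y))\<bar> \<le> (g x)\<^sup>2 + (f y)\<^sup>2" for x y
      using abs_mult_le_sum_squares[of "f y" "g x"] by (simp add: F_def add.commute)
  qed
  have "(\<integral>x. \<integral>y. f x * g y \<partial>K x \<partial>\<pi>) = (\<integral>y. \<integral>x. f x * g y \<partial>K y \<partial>\<pi>)"
    using 1 2 rev unfolding reversible_def by (simp add: F_def)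
  then show "ip \<pi> f (op g) = ip \<pi> (op f) g"
    by (simp add: ip_def kernel_op_def)
qed

lemma measurable_kernel_pow: "kernel_pow \<pi> K k \<in> \<pi> \<rightarrow>\<^sub>M prob_algebra \<pi>"
proof (induction k)
  case 0
  have "kernel_pow \<pi> K 0 = return \<pi>" by (rule ext) simp
  then show ?case by simp
next
  case (Suc k)
  have "kernel_pow \<pi> K (Suc k) = (\<lambda>x. kernel_pow \<pi> K k x \<bind> K)" by (rule ext) simp
  then show ?case using measurable_bind_prob_space[OF Suc K_meas] by simp
qed

lemma kernel_pow_invariant: "\<pi> \<bind> kernel_pow \<pi> K k = \<pi>"
proof (induction k)
  case 0
  have "kernel_pow \<pi> K 0 = return \<pi>" by (rule ext) simp
  then show ?case by (simp add: bind_return'')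
next
  case (Suc k)
  have "kernel_pow \<pi> K (Suc k) = (\<lambda>x. kernel_pow \<pi> K k x \<bind> K)" by (rule ext) simp
  then show ?case
    using bind_assoc[OF measurable_prob_algebraD[OF measurable_kernel_pow[of k]] K_sub] Suc K_inv by simp
qed

lemma markov_kernel_pow: "markov_kernel \<pi> (kernel_pow \<pi> K k)"
  by unfold_locales (rule measurable_kernel_pow kernel_pow_invariant)+

text \<open>
  The power of the kernel acts as the power of the operator, but only almost everywhere: \<open>h\<close> may
  fail to be integrable with respect to some of the measures involved.
\<close>

lemma kernel_op_pow_AE:
  fixes h :: "'a \<Rightarrow> real"
  assumes "integrable \<pi> h"
  shows "AE x in \<pi>. kernel_op (kernel_pow \<pi> K k) h x = (op ^^ k) h x"
  using assms
proof (induction k arbitrary: h)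
  case 0
  have "kernel_op (kernel_pow \<pi> K 0) h x = h x" if "x \<in> space \<pi>" for x
    using that 0 by (simp add: kernel_op_def integral_return borel_measurable_integrable)
  then show ?case by (intro AE_I2) (simp del: kernel_pow.simps)
next
  case (Suc k)
  note meas = borel_measurable_integrable[OF Suc.prems]
  note kp = measurable_space[OF measurable_kernel_pow[of k], unfolded space_prob_algebra]
  have "AE x in \<pi>. integrable (kernel_pow \<pi> K (Suc k) x) h"
    by (rule markov_kernel.AE_integrable_K[OF markov_kernel_pow Suc.prems])
  moreover have "AE x in \<pi>. kernel_op (kernel_pow \<pi> K k) (op h) x = (op ^^ k) (op h) x"
    by (rule Suc.IH[OF integrable_op[OF Suc.prems]])
  ultimately show ?case
    using AE_space
  proof eventually_elim
    case (elim x)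
    have sets: "sets (kernel_pow \<pi> K k x) = sets \<pi>" using kp[OF elim(3)] by simp
    have "K \<in> kernel_pow \<pi> K k x \<rightarrow>\<^sub>M subprob_algebra \<pi>" using K_sub by (simp add: measurable_cong_sets[OF sets refl])
    moreover have "space (kernel_pow \<pi> K k x) \<noteq> {}" using sets_eq_imp_space_eq[OF sets] not_empty by simp
    ultimately have "kernel_op (kernel_pow \<pi> K (Suc k)) h x = kernel_op (kernel_pow \<pi> K k) (op h) x"
      using elim(1) meas unfolding kernel_op_def kernel_pow.simps by (intro integral_bind_integrable)
    with elim(2) show ?case by (simp add: funpow_swap1 del: kernel_pow.simps)
  qed
qed

lemma measurable_kernel_pow_pair: "(\<lambda>(x, k). kernel_pow \<pi> K k x) \<in> \<pi> \<Otimes>\<^sub>M measure_pmf \<mu> \<rightarrow>\<^sub>M prob_algebra \<pi>"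
proof -
  have "(\<lambda>(k, x). kernel_pow \<pi> K k x) \<in> count_space UNIV \<Otimes>\<^sub>M \<pi> \<rightarrow>\<^sub>M prob_algebra \<pi>"
    by (rule measurable_pair_measure_countable1) (simp_all add: measurable_kernel_pow)
  from measurable_compose[OF measurable_pair_swap' this]
  have "(\<lambda>(x, k). kernel_pow \<pi> K k x) \<in> \<pi> \<Otimes>\<^sub>M count_space UNIV \<rightarrow>\<^sub>M prob_algebra \<pi>"
    by (simp add: split_def)
  moreover have sets: "sets (\<pi> \<Otimes>\<^sub>M measure_pmf \<mu>) = sets (\<pi> \<Otimes>\<^sub>M count_space UNIV)"
    by (intro sets_pair_measure_cong) simp_all
  ultimately show ?thesis by (simp only: measurable_cong_sets[OF sets refl])
qed

section \<open>Mixtures of powers\<close>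

lemma markov_kernel_mix: "markov_kernel \<pi> (kernel_mix \<pi> \<mu> K)"
proof unfold_locales
  have sub: "subprob_space \<pi>" by (rule prob_space_imp_subprob_space[OF prob_space_axioms])
  have "(\<lambda>_. measure_pmf \<mu>) \<in> \<pi> \<rightarrow>\<^sub>M prob_algebra (measure_pmf \<mu>)"
    by (rule measurable_const) (simp add: space_prob_algebra measure_pmf.prob_space_axioms)
  from measurable_bind_prob_space2[OF this measurable_kernel_pow_pair]
  show "kernel_mix \<pi> \<mu> K \<in> \<pi> \<rightarrow>\<^sub>M prob_algebra \<pi>"
    unfolding kernel_mix_def[abs_def] .
  interpret pair_prob_space \<pi> "measure_pmf \<mu>" ..
  have "\<pi> \<bind> kernel_mix \<pi> \<mu> K = measure_pmf \<mu> \<bind> (\<lambda>k. \<pi> \<bind> (\<lambda>x. kernel_pow \<pi> K k x))"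
    unfolding kernel_mix_def[abs_def] by (rule bind_rotate[OF measurable_prob_algebraD[OF measurable_kernel_pow_pair]])
  also have "\<dots> = \<pi>"
    unfolding kernel_pow_invariant by (rule bind_const'[OF measure_pmf.prob_space_axioms sub])
  finally show "\<pi> \<bind> kernel_mix \<pi> \<mu> K = \<pi>" .
qed

end

context reversible_kernel
begin

text \<open>
  Fubini's theorem, applicable because the powers are contractions: \<open>\<integral> |a K\<^sup>k h| d\<pi> \<le> \<parallel>a\<parallel>\<^sup>2 + \<parallel>h\<parallel>\<^sup>2\<close>
  for all \<open>k\<close>.
\<close>

lemma ip_kernel_mix:
  assumes a: "a \<in> L2 \<pi>" and h: "h \<in> L2 \<pi>"
  shows "ip \<pi> a (kernel_op (kernel_mix \<pi> \<mu> K) h) = (\<integral>k. ip \<pi> a ((op ^^ k) h) \<partial>measure_pmf \<mu>)"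
proof -
  interpret mix: markov_kernel \<pi> "kernel_mix \<pi> \<mu> K" by (rule markov_kernel_mix)
  interpret swap: pair_prob_space "measure_pmf \<mu>" \<pi> ..
  have [measurable]: "a \<in> borel_measurable \<pi>" "h \<in> borel_measurable \<pi>" using a h by (auto intro: L2_measurable)
  define H where "H k = kernel_op (kernel_pow \<pi> K k) h" for k
  have pow2: "H k \<in> L2 \<pi>" "ip \<pi> (H k) (H k) \<le> ip \<pi> h h" for k
    unfolding H_def by (intro markov_kernel.op_L2 markov_kernel.ip_op_le markov_kernel_pow h)+
  have H_meas [measurable]: "H k \<in> borel_measurable \<pi>" for k by (rule L2_measurable[OF pow2(1)])
  have ip_H: "ip \<pi> a (H k) = ip \<pi> a ((op ^^ k) h)" for k
    using kernel_op_pow_AE[OF L2_integrable[OF h], of k] unfolding H_def[symmetric]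
    by (intro ip_cong_AE) auto
  have AE_mix: "AE x in \<pi>. kernel_op (kernel_mix \<pi> \<mu> K) h x = (\<integral>k. H k x \<partial>measure_pmf \<mu>)"
    using mix.AE_integrable_K[OF L2_integrable[OF h]] AE_space
  proof eventually_elim
    case (elim x)
    have "(\<lambda>k. kernel_pow \<pi> K k x) \<in> measure_pmf \<mu> \<rightarrow>\<^sub>M subprob_algebra \<pi>"
      using measurable_space[OF measurable_prob_algebraD[OF measurable_kernel_pow] elim(2)] by (auto simp: measurable_def)
    from integral_bind_integrable[OF this, of h] elim show ?case
      by (simp add: kernel_op_def kernel_mix_def H_def)
  qed
  have pair_meas: "(\<lambda>(k, x). a x * H k x) \<in> borel_measurable (measure_pmf \<mu> \<Otimes>\<^sub>M \<pi>)"
  proof -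
    have "(\<lambda>(k, x). a x * H k x) \<in> borel_measurable (count_space UNIV \<Otimes>\<^sub>M \<pi>)"
      by (rule measurable_pair_measure_countable1) simp_all
    moreover have sets: "sets (measure_pmf \<mu> \<Otimes>\<^sub>M \<pi>) = sets (count_space UNIV \<Otimes>\<^sub>M \<pi>)"
      by (intro sets_pair_measure_cong) simp_all
    ultimately show ?thesis by (simp only: measurable_cong_sets[OF sets refl])
  qed
  have int_pair: "integrable (measure_pmf \<mu> \<Otimes>\<^sub>M \<pi>) (\<lambda>(k, x). a x * H k x)"
  proof (rule swap.Fubini_integrable[OF pair_meas])
    have "norm (\<integral>x. norm (a x * H k x) \<partial>\<pi>) \<le> ip \<pi> a a + ip \<pi> h h" for k
    proof -
      have "norm (\<integral>x. norm (a x * H k x) \<partial>\<pi>) = ip \<pi> (\<lambda>x. \<bar>a x\<bar>) (\<lambda>x. \<bar>H k x\<bar>)"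
        by (simp add: ip_def abs_mult integral_nonneg_AE)
      also have "\<dots> \<le> (ip \<pi> (\<lambda>x. \<bar>a x\<bar>) (\<lambda>x. \<bar>a x\<bar>) + ip \<pi> (\<lambda>x. \<bar>H k x\<bar>) (\<lambda>x. \<bar>H k x\<bar>)) / 2"
        using abs_ip_le[of "\<lambda>x. \<bar>a x\<bar>" \<pi> "\<lambda>x. \<bar>H k x\<bar>"] a pow2(1)[of k] by (simp add: L2_def)
      also have "\<dots> \<le> ip \<pi> a a + ip \<pi> h h"
      proof -
        have eqs: "ip \<pi> (\<lambda>x. \<bar>a x\<bar>) (\<lambda>x. \<bar>a x\<bar>) = ip \<pi> a a" "ip \<pi> (\<lambda>x. \<bar>H k x\<bar>) (\<lambda>x. \<bar>H k x\<bar>) = ip \<pi> (H k) (H k)"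
          by (simp_all add: ip_self)
        have "(r + s) / 2 \<le> r + t" if "s \<le> t" "0 \<le> r" "0 \<le> t" for r s t :: real
          using that by (simp add: field_simps)
        then show ?thesis
          unfolding eqs using pow2(2)[of k] ip_self_nonneg[of \<pi> a] ip_self_nonneg[of \<pi> h] by blast
      qed
      finally show ?thesis .
    qed
    then show "integrable (measure_pmf \<mu>) (\<lambda>k. \<integral>x. norm (case (k, x) of (k, x) \<Rightarrow> a x * H k x) \<partial>\<pi>)"
      by (intro measure_pmf.integrable_const_bound[where B="ip \<pi> a a + ip \<pi> h h"]) auto
    show "AE k in measure_pmf \<mu>. integrable \<pi> (\<lambda>x. case (k, x) of (k, x) \<Rightarrow> a x * H k x)"
      using L2_integrable_mult[OF a pow2(1)] by simp
  qed
  have "ip \<pi> a (kernel_op (kernel_mix \<pi> \<mu> K) h) = (\<integral>x. a x * (\<integral>k. H k x \<partial>measure_pmf \<mu>) \<partial>\<pi>)"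
    unfolding ip_def
  proof (rule integral_cong_AE)
    have "(\<lambda>x. \<integral>k. a x * H k x \<partial>measure_pmf \<mu>) \<in> borel_measurable \<pi>"
      using swap.integrable_product_swap[OF int_pair]
      by (intro borel_measurable_integrable) (use swap.integrable_snd[of "\<lambda>k x. a x * H k x"] int_pair in simp)
    then show "(\<lambda>x. a x * (\<integral>k. H k x \<partial>measure_pmf \<mu>)) \<in> borel_measurable \<pi>" by simp
    show "AE x in \<pi>. a x * kernel_op (kernel_mix \<pi> \<mu> K) h x = a x * (\<integral>k. H k x \<partial>measure_pmf \<mu>)"
      using AE_mix by eventually_elim simp
  qed measurable
  also have "\<dots> = (\<integral>x. \<integral>k. a x * H k x \<partial>measure_pmf \<mu> \<partial>\<pi>)" by simp
  also have "\<dots> = (\<integral>k. \<integral>x. a x * H k x \<partial>\<pi> \<partial>measure_pmf \<mu>)"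
    by (rule swap.Fubini_integral[OF int_pair])
  also have "\<dots> = (\<integral>k. ip \<pi> a ((op ^^ k) h) \<partial>measure_pmf \<mu>)"
    unfolding ip_H[symmetric] by (simp add: ip_def)
  finally show ?thesis .
qed

lemma reversible_kernel_mix: "reversible_kernel \<pi> (kernel_mix \<pi> \<mu> K)"
proof -
  interpret mix: markov_kernel \<pi> "kernel_mix \<pi> \<mu> K" by (rule markov_kernel_mix)
  show ?thesis
  proof unfold_locales
    fix f g assume f: "f \<in> L2 \<pi>" and g: "g \<in> L2 \<pi>"
    have "ip \<pi> f ((op ^^ k) g) = ip \<pi> g ((op ^^ k) f)" for k
      using ip_op_pow[OF f g, of k 0] by (simp add: ip_commute)
    then show "ip \<pi> f (kernel_op (kernel_mix \<pi> \<mu> K) g) = ip \<pi> (kernel_op (kernel_mix \<pi> \<mu> K) f) g"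
      by (simp add: ip_kernel_mix f g ip_commute[of \<pi> "kernel_op (kernel_mix \<pi> \<mu> K) f"])
  qed
qed

end

lemma pgf_eq_integral:
  assumes "\<bar>x\<bar> \<le> 1"
  shows "pgf \<mu> x = (\<integral>k. x ^ k \<partial>measure_pmf \<mu>)"
proof -
  have "integrable (measure_pmf \<mu>) (\<lambda>k. x ^ k)"
    by (rule measure_pmf.integrable_const_bound[where B=1]) (use assms in \<open>auto simp: power_abs power_le_one\<close>)
  then have "integrable (count_space UNIV) (\<lambda>k. pmf \<mu> k * x ^ k)"
    unfolding measure_pmf_eq_density by (subst (asm) integrable_density) auto
  then have "(\<integral>k. pmf \<mu> k * x ^ k \<partial>count_space UNIV) = (\<Sum>k. pmf \<mu> k * x ^ k)"
    by (rule integral_count_space_nat)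
  then show ?thesis
    unfolding pgf_def measure_pmf_eq_density by (subst integral_density) auto
qed

lemma abs_pgf_le: assumes "\<bar>x\<bar> \<le> 1" shows "\<bar>pgf \<mu> x\<bar> \<le> 1"
proof -
  have le: "\<bar>x ^ k\<bar> \<le> 1" for k using assms by (simp add: power_abs power_le_one)
  have "\<bar>pgf \<mu> x\<bar> \<le> (\<integral>k. \<bar>x ^ k\<bar> \<partial>measure_pmf \<mu>)" unfolding pgf_eq_integral[OF assms] by (rule integral_abs_bound)
  also have "\<dots> \<le> (\<integral>k. 1 \<partial>measure_pmf \<mu>)"
    by (intro integral_mono measure_pmf.integrable_const_bound[where B=1]) (use le in auto)
  finally show ?thesis by simp
qed

text \<open>
  In the expectation of \<open>1 - x\<^sup>k\<close> all terms are nonnegative; keep the one with \<open>k = m\<close>.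
\<close>

lemma one_minus_pgf_ge:
  assumes x: "\<bar>x\<bar> \<le> 1"
  shows "pmf \<mu> m * (1 - x ^ m) \<le> 1 - pgf \<mu> x"
proof -
  have le: "\<bar>x ^ k\<bar> \<le> 1" for k using x by (simp add: power_abs power_le_one)
  have int: "integrable (measure_pmf \<mu>) (\<lambda>k. x ^ k)"
    by (rule measure_pmf.integrable_const_bound[where B=1]) (use le in auto)
  have "pmf \<mu> m * (1 - x ^ m) = (\<integral>k. (1 - x ^ m) * indicator {m} k \<partial>measure_pmf \<mu>)"
    by (simp add: measure_pmf_single)
  also have "\<dots> \<le> (\<integral>k. 1 - x ^ k \<partial>measure_pmf \<mu>)"
  proof (rule integral_mono)
    show "(1 - x ^ m) * indicator {m} k \<le> 1 - x ^ k" for k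
      using le[of k] by (cases "k = m") (auto simp: abs_le_iff)
    show "integrable (measure_pmf \<mu>) (\<lambda>k. (1 - x ^ m) * indicator {m} k)"
      by (intro integrable_mult_right measure_pmf.integrable_const_bound[where B=1]) (auto simp: indicator_def)
  qed (use int in simp)
  also have "\<dots> = 1 - pgf \<mu> x" using int by (simp add: pgf_eq_integral[OF x])
  finally show ?thesis .
qed

lemma borel_measurable_pgf: "pgf \<mu> \<in> borel_measurable (restrict_space borel {-1..1})"
proof -
  have "(\<lambda>x. \<Sum>k. pmf \<mu> k * x ^ k) \<in> borel_measurable (restrict_space borel {-1..1})"
    by (intro borel_measurable_suminf measurable_restrict_space1) measurable
  then show ?thesis by (simp add: pgf_def[abs_def])
qed

context reversible_kernel
begin

lemma pgf_measurable_spectral: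
  assumes E: "spectral h E"
  shows "pgf \<mu> \<in> E \<rightarrow>\<^sub>M restrict_space borel {-1..1}"
  using borel_measurable_pgf[of \<mu>] abs_pgf_le[of _ \<mu>] spectral_space[OF E]
  by (auto simp: measurable_restrict_space2_iff measurable_cong_sets[OF spectral_sets[OF E] refl] abs_le_iff)

text \<open>
  The claim is \<open>\<langle>h, R\<^sup>n h\<rangle> = \<integral> G\<^sup>n dE\<close> for the mixture \<open>R\<close>. The induction on \<open>n\<close> needs the stronger
  \<open>\<langle>K\<^sup>m h, R\<^sup>n h\<rangle> = \<integral> x\<^sup>m G(x)\<^sup>n dE\<close>, since expanding one factor \<open>R\<close> produces powers of \<open>K\<close>, which move to
  the left-hand side.
\<close>

lemma spectral_kernel_mix:
  assumes h: "h \<in> L2 \<pi>" and E: "spectral h E"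
  shows "reversible_kernel.spectral \<pi> (kernel_mix \<pi> \<mu> K) h (distr E (restrict_space borel {-1..1}) (pgf \<mu>))"
proof -
  interpret mix: reversible_kernel \<pi> "kernel_mix \<pi> \<mu> K" by (rule reversible_kernel_mix)
  interpret E: finite_measure E by (rule spectral_finite[OF E])
  interpret pair: pair_sigma_finite "measure_pmf \<mu>" E ..
  let ?G = "pgf \<mu>" let ?R = "kernel_op (kernel_mix \<pi> \<mu> K)"
  note G_E = pgf_measurable_spectral[OF E, of \<mu>]
  then have [measurable]: "?G \<in> borel_measurable E" by (simp add: measurable_restrict_space2_iff)
  have [measurable]: "(\<lambda>x. x) \<in> borel_measurable E" by (rule measurable_interval[OF spectral_sets[OF E]]) simp
  have key: "ip \<pi> ((op ^^ m) h) ((?R ^^ n) h) = (\<integral>x. x ^ m * ?G x ^ n \<partial>E)" for m n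
  proof (induction n arbitrary: m)
    case 0
    show ?case using ip_op_pow[OF h h, of m 0] spectral_moment[OF E, of m] by simp
  next
    case (Suc n)
    have Rn: "(?R ^^ n) h \<in> L2 \<pi>" by (rule mix.op_pow_L2[OF h])
    have "ip \<pi> ((op ^^ m) h) ((?R ^^ Suc n) h) = (\<integral>j. ip \<pi> ((op ^^ m) h) ((op ^^ j) ((?R ^^ n) h)) \<partial>measure_pmf \<mu>)"
      by (simp add: ip_kernel_mix[OF op_pow_L2[OF h] Rn])
    also have "\<dots> = (\<integral>j. \<integral>x. x ^ (j + m) * ?G x ^ n \<partial>E \<partial>measure_pmf \<mu>)"
      unfolding Suc.IH[symmetric] using ip_op_pow[OF op_pow_L2[OF h, of m] Rn, of _ 0] by (simp add: funpow_add)
    also have "\<dots> = (\<integral>x. \<integral>j. x ^ (j + m) * ?G x ^ n \<partial>measure_pmf \<mu> \<partial>E)"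
    proof (rule pair.Fubini_integral[symmetric])
      have "(\<lambda>(j, x). x ^ (j + m) * ?G x ^ n) \<in> borel_measurable (count_space UNIV \<Otimes>\<^sub>M E)"
        by (rule measurable_pair_measure_countable1) simp_all
      moreover have sets: "sets (measure_pmf \<mu> \<Otimes>\<^sub>M E) = sets (count_space UNIV \<Otimes>\<^sub>M E)"
        by (intro sets_pair_measure_cong) simp_all
      ultimately have meas: "(\<lambda>(j, x). x ^ (j + m) * ?G x ^ n) \<in> borel_measurable (measure_pmf \<mu> \<Otimes>\<^sub>M E)"
        by (simp only: measurable_cong_sets[OF sets refl])
      have le: "norm (x ^ (j + m) * ?G x ^ n) \<le> 1" if "x \<in> space E" for x j
        using that spectral_space[OF E] abs_pgf_le[of x \<mu>]
        by (auto simp: abs_mult power_abs intro!: mult_le_one power_le_one)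
      have int: "integrable E (\<lambda>x. x ^ (j + m) * ?G x ^ n)" for j
        using le by (intro E.integrable_const_bound[where B=1] AE_I2) auto
      show "integrable (measure_pmf \<mu> \<Otimes>\<^sub>M E) (\<lambda>(j, x). x ^ (j + m) * ?G x ^ n)"
      proof (rule pair.Fubini_integrable[OF meas])
        have "norm (\<integral>x. norm (x ^ (j + m) * ?G x ^ n) \<partial>E) \<le> measure E (space E)" for j
        proof -
          have "(\<integral>x. norm (x ^ (j + m) * ?G x ^ n) \<partial>E) \<le> (\<integral>x. 1 \<partial>E)"
            using le int by (intro integral_mono) auto
          then show ?thesis by (simp add: integral_nonneg_AE)
        qed
        then show "integrable (measure_pmf \<mu>) (\<lambda>j. \<integral>x. norm (case (j, x) of (j, x) \<Rightarrow> x ^ (j + m) * ?G x ^ n) \<partial>E)"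
          by (intro measure_pmf.integrable_const_bound[where B="measure E (space E)"]) auto
        show "AE j in measure_pmf \<mu>. integrable E (\<lambda>x. case (j, x) of (j, x) \<Rightarrow> x ^ (j + m) * ?G x ^ n)"
          using int by simp
      qed
    qed
    also have "\<dots> = (\<integral>x. x ^ m * ?G x ^ Suc n \<partial>E)"
    proof (rule Bochner_Integration.integral_cong[OF refl])
      fix x assume "x \<in> space E"
      then have x: "\<bar>x\<bar> \<le> 1" using spectral_space[OF E] by auto
      have "(\<integral>j. x ^ (j + m) * ?G x ^ n \<partial>measure_pmf \<mu>) = (\<integral>j. x ^ j * (x ^ m * ?G x ^ n) \<partial>measure_pmf \<mu>)"
        by (simp add: power_add mult_ac)
      also have "\<dots> = ?G x * (x ^ m * ?G x ^ n)" by (simp add: pgf_eq_integral[OF x])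
      finally show "(\<integral>j. x ^ (j + m) * ?G x ^ n \<partial>measure_pmf \<mu>) = x ^ m * ?G x ^ Suc n" by (simp only: power_Suc mult_ac)
    qed
    finally show ?case .
  qed
  show ?thesis
    unfolding mix.spectral_def
  proof (intro conjI allI)
    show "finite_measure (distr E (restrict_space borel {-1..1}) ?G)" by (rule E.finite_measure_distr[OF G_E])
    show "ip \<pi> h ((?R ^^ n) h) = (\<integral>x. x ^ n \<partial>distr E (restrict_space borel {-1..1}) ?G)" for n
      using key[of 0 n] by (subst integral_distr[OF G_E]) (auto intro!: measurable_restrict_space1)
  qed simp
qed

end

section \<open>Total variation and integrals of bounded functions\<close>

lemma tv_dist_ge:
  assumes "prob_space M" "prob_space N" "A \<in> sets M"
  shows "\<bar>measure M A - measure N A\<bar> \<le> tv_dist M N"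
  unfolding tv_dist_def
proof (rule cSUP_upper[OF assms(3)], rule bdd_aboveI2)
  fix A
  show "\<bar>measure M A - measure N A\<bar> \<le> 1"
    using prob_space.prob_le_1[OF assms(1), of A] prob_space.prob_le_1[OF assms(2), of A] measure_nonneg[of M A] measure_nonneg[of N A]
    by linarith
qed

text \<open>
  Total variation compares measures of sets. A function \<open>f\<close> with values in \<open>[0, 1]\<close> is uniformly
  approximated by the averages of the indicators of the level sets \<open>{f \<ge> j / n}\<close>, for \<open>j\<close> from \<open>1\<close> to \<open>n\<close>.
\<close>

lemma tv_dist_integral_unit:
  fixes f :: "'a \<Rightarrow> real"
  assumes M: "prob_space M" and N: "prob_space N" and sets: "sets N = sets M"
    and f [measurable]: "f \<in> borel_measurable M" and f01: "\<And>x. x \<in> space M \<Longrightarrow> 0 \<le> f x \<and> f x \<le> 1"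
  shows "\<bar>(\<integral>x. f x \<partial>M) - (\<integral>x. f x \<partial>N)\<bar> \<le> tv_dist M N"
proof -
  have fN [measurable]: "f \<in> borel_measurable N" using f by (simp add: measurable_cong_sets[OF sets refl])
  have sp: "space N = space M" by (rule sets_eq_imp_space_eq[OF sets])
  define A where "A n j = {x \<in> space M. real j \<le> real n * f x}" for n j :: nat
  have A: "A n j \<in> sets M" for n j unfolding A_def by measurable
  define g where "g n x = (\<Sum>j\<in>{1..n}. indicator (A n j) x) / real n" for n x
  have close: "\<bar>f x - g n x\<bar> \<le> 1 / real n" if x: "x \<in> space M" and n: "n > 0" for x n
  proof -
    define y where "y = real n * f x"
    have y: "0 \<le> y" "y \<le> real n" using f01[OF x] n by (auto simp: y_def mult_left_le)
    have "(\<Sum>j\<in>{1..n}. indicator (A n j) x :: real) = (\<Sum>j\<in>{1..n}. if real j \<le> y then 1 else 0)"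
      using x by (intro sum.cong refl) (auto simp: A_def y_def)
    also have "\<dots> = real (card ({1..n} \<inter> {j. real j \<le> y}))"
      by (simp add: sum.If_cases)
    also have "{1..n} \<inter> {j. real j \<le> y} = {1..nat \<lfloor>y\<rfloor>}"
      using y by (auto simp: le_nat_floor le_nat_iff le_floor_iff)
    finally have g: "g n x = of_int \<lfloor>y\<rfloor> / real n" using y by (simp add: g_def)
    have "f x = y / real n" using n by (simp add: y_def)
    then have "\<bar>f x - g n x\<bar> = \<bar>y - of_int \<lfloor>y\<rfloor>\<bar> / real n"
      unfolding g by (simp add: diff_divide_distrib[symmetric] abs_divide)
    also have "\<dots> \<le> 1 / real n" by (intro divide_right_mono) linarith+
    finally show ?thesis .
  qed
  have approx: "\<bar>(\<integral>x. f x \<partial>R) - (\<Sum>j\<in>{1..n}. measure R (A n j)) / real n\<bar> \<le> 1 / real n"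
    if R: "prob_space R" "sets R = sets M" and n: "n > 0" for R n
  proof -
    interpret R: prob_space R by (rule R)
    have spR: "space R = space M" by (rule sets_eq_imp_space_eq[OF R(2)])
    have fR: "integrable R f"
      using f01 f by (intro R.integrable_const_bound[where B=1] AE_I2) (auto simp: spR measurable_cong_sets[OF R(2) refl])
    have AR: "A n j \<in> sets R" for j using A by (simp add: R(2))
    have gR: "integrable R (g n)" "(\<integral>x. g n x \<partial>R) = (\<Sum>j\<in>{1..n}. measure R (A n j)) / real n"
      unfolding g_def[abs_def] using AR by (auto simp: less_top[symmetric])
    have "\<bar>(\<integral>x. f x \<partial>R) - (\<integral>x. g n x \<partial>R)\<bar> = \<bar>\<integral>x. f x - g n x \<partial>R\<bar>" using fR gR by simp
    also have "\<dots> \<le> (\<integral>x. \<bar>f x - g n x\<bar> \<partial>R)" by (rule integral_abs_bound)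
    also have "\<dots> \<le> (\<integral>x. 1 / real n \<partial>R)"
      using fR gR close n by (intro integral_mono) (auto simp: spR)
    finally show ?thesis using gR R.prob_space by simp
  qed
  have "\<bar>(\<integral>x. f x \<partial>M) - (\<integral>x. f x \<partial>N)\<bar> \<le> tv_dist M N + 2 / real n" if n: "n > 0" for n
  proof -
    have "\<bar>(\<Sum>j\<in>{1..n}. measure M (A n j)) / real n - (\<Sum>j\<in>{1..n}. measure N (A n j)) / real n\<bar> =
        \<bar>\<Sum>j\<in>{1..n}. measure M (A n j) - measure N (A n j)\<bar> / real n"
      by (simp add: diff_divide_distrib[symmetric] sum_subtractf abs_divide)
    also have "\<dots> \<le> (\<Sum>j\<in>{1..n}. tv_dist M N) / real n"
      by (intro divide_right_mono order_trans[OF sum_abs] sum_mono tv_dist_ge M N A) simp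
    also have "\<dots> = tv_dist M N" using n by simp
    finally have "\<bar>(\<Sum>j\<in>{1..n}. measure M (A n j)) / real n - (\<Sum>j\<in>{1..n}. measure N (A n j)) / real n\<bar> \<le> tv_dist M N" .
    then show ?thesis using approx[OF M refl n] approx[OF N sets n] by linarith
  qed
  note le = this
  have lim: "(\<lambda>n. tv_dist M N + 2 / real n) \<longlonglongrightarrow> tv_dist M N" by real_asymp
  show ?thesis
    by (rule LIMSEQ_le_const[OF lim]) (use le in \<open>auto intro!: exI[of _ 1]\<close>)
qed

lemma tv_dist_integral:
  fixes f :: "'a \<Rightarrow> real"
  assumes M: "prob_space M" and N: "prob_space N" and sets: "sets N = sets M"
    and f: "f \<in> borel_measurable M" and bound: "\<And>x. x \<in> space M \<Longrightarrow> \<bar>f x\<bar> \<le> B"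
  shows "\<bar>(\<integral>x. f x \<partial>M) - (\<integral>x. f x \<partial>N)\<bar> \<le> 2 * B * tv_dist M N"
proof -
  interpret M: prob_space M by (rule M)
  interpret N: prob_space N by (rule N)
  have sp: "space N = space M" by (rule sets_eq_imp_space_eq[OF sets])
  have fN: "f \<in> borel_measurable N" using f by (simp add: measurable_cong_sets[OF sets refl])
  have B0: "0 \<le> B" using M.not_empty bound by force
  have int: "integrable M f" "integrable N f"
    using bound f fN by (auto intro!: M.integrable_const_bound[where B=B] N.integrable_const_bound[where B=B] AE_I2 simp: sp)
  show ?thesis
  proof (cases "B = 0")
    case True
    then have z: "f x = 0" if "x \<in> space M" for x using bound[OF that] by simp
    have "(\<integral>x. f x \<partial>M) = (\<integral>x. 0 \<partial>M)" "(\<integral>x. f x \<partial>N) = (\<integral>x. 0 \<partial>N)"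
      by (intro Bochner_Integration.integral_cong refl; simp add: z sp)+
    then show ?thesis using True by simp
  next
    case False
    with B0 have B: "B > 0" by simp
    define g where "g x = (f x + B) / (2 * B)" for x
    have "\<bar>(\<integral>x. g x \<partial>M) - (\<integral>x. g x \<partial>N)\<bar> \<le> tv_dist M N"
    proof (rule tv_dist_integral_unit[OF M N sets])
      show "g \<in> borel_measurable M" unfolding g_def[abs_def] using f by measurable
      show "0 \<le> g x \<and> g x \<le> 1" if "x \<in> space M" for x
        using bound[OF that] B by (auto simp: g_def abs_le_iff field_simps)
    qed
    moreover have "(\<integral>x. g x \<partial>M) = ((\<integral>x. f x \<partial>M) + B) / (2 * B)" "(\<integral>x. g x \<partial>N) = ((\<integral>x. f x \<partial>N) + B) / (2 * B)"
      unfolding g_def using int M.prob_space N.prob_space by simp_all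
    ultimately have "\<bar>(\<integral>x. f x \<partial>M) - (\<integral>x. f x \<partial>N)\<bar> / (2 * B) \<le> tv_dist M N"
      using B by (simp add: diff_divide_distrib[symmetric] abs_divide)
    then show ?thesis using B by (simp add: divide_le_eq mult.commute)
  qed
qed

lemma AE_distr_interval_ne:
  fixes c :: real
  assumes f: "f \<in> E \<rightarrow>\<^sub>M restrict_space borel {-1..1}"
  shows "(AE x in distr E (restrict_space borel {-1..1}) f. x \<noteq> c) \<longleftrightarrow> (AE x in E. f x \<noteq> c)"
proof (rule AE_distr_iff[OF f])
  have "{x \<in> space (restrict_space borel {-1..1}). x \<noteq> c} = {-1..1} - {c}" by (auto simp: space_restrict_space)
  then show "{x \<in> space (restrict_space borel {-1..1}). x \<noteq> c} \<in> sets (restrict_space borel {-1..1})"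
    by (simp add: sets_restrict_space_iff)
qed

text \<open>
  Chebyshev's inequality for \<open>x\<^bsup>2n\<^esup>\<close> with \<open>n\<close> tending to infinity.
\<close>

lemma support_of_moment_bound:
  assumes E: "finite_measure E" "sets E = sets (restrict_space borel {-1..1::real})"
    and \<rho>: "0 \<le> \<rho>" and mom: "\<And>n. (\<integral>x. x ^ (2 * n) \<partial>E) \<le> C * \<rho> ^ (2 * n)"
  shows "AE x in E. \<bar>x\<bar> \<le> \<rho>"
proof -
  interpret finite_measure E by (rule E)
  note meas = measurable_interval[OF E(2)]
  have null: "AE x in E. \<bar>x\<bar> < r" if r: "\<rho> < r" for r
  proof -
    define A where "A = {x \<in> space E. r \<le> \<bar>x\<bar>}"
    have abs_meas [measurable]: "(\<lambda>x. \<bar>x\<bar>) \<in> borel_measurable E" by (rule meas) measurable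
    have A: "A \<in> sets E" unfolding A_def by measurable
    have r0: "0 < r" using \<rho> r by simp
    have le: "measure E A \<le> C * ((\<rho> / r)\<^sup>2) ^ n" for n
    proof -
      have "r ^ (2 * n) * measure E A = (\<integral>x. r ^ (2 * n) * indicator A x \<partial>E)"
        using A by simp
      also have "\<dots> \<le> (\<integral>x. x ^ (2 * n) \<partial>E)"
      proof (rule integral_mono)
        show "integrable E (\<lambda>x. x ^ (2 * n))" by (intro integrable_interval_continuous[OF E] continuous_intros)
        show "integrable E (\<lambda>x. r ^ (2 * n) * indicator A x)"
          using A by (intro integrable_mult_right integrable_real_indicator) (simp_all add: emeasure_eq_measure)
        show "r ^ (2 * n) * indicator A x \<le> x ^ (2 * n)" for x
          using r0 power_mono[of r "\<bar>x\<bar>" "2 * n"] by (auto simp: A_def indicator_def power_even_abs)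
      qed
      also have "\<dots> \<le> C * \<rho> ^ (2 * n)" by (rule mom)
      finally have "r ^ (2 * n) * measure E A \<le> C * \<rho> ^ (2 * n)" .
      moreover have "((\<rho> / r)\<^sup>2) ^ n = \<rho> ^ (2 * n) / r ^ (2 * n)" by (simp add: power_divide power_mult)
      ultimately show ?thesis using r0 by (simp only:) (simp add: pos_le_divide_eq mult.commute)
    qed
    have "\<rho> / r < 1" "0 \<le> \<rho> / r" using r r0 \<rho> by (simp_all add: divide_less_eq)
    then have "(\<rho> / r)\<^sup>2 < 1" by (simp add: power_less_one_iff)
    then have "(\<lambda>n. C * ((\<rho> / r)\<^sup>2) ^ n) \<longlonglongrightarrow> C * 0"
      by (intro tendsto_mult tendsto_const LIMSEQ_realpow_zero) simp_all
    then have "measure E A \<le> C * 0" by (rule LIMSEQ_le_const) (use le in auto)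
    then have "measure E A = 0" using measure_nonneg[of E A] by simp
    then have "A \<in> null_sets E" using A by (simp add: null_sets_def emeasure_eq_measure)
    from AE_not_in[OF this] AE_space show ?thesis by eventually_elim (auto simp: A_def)
  qed
  have "AE x in E. \<forall>i. \<bar>x\<bar> < \<rho> + 1 / real (Suc i)"
    by (subst AE_all_countable) (auto intro!: null)
  then show ?thesis
  proof eventually_elim
    case (elim x)
    have "(\<lambda>i. \<rho> + 1 / real (Suc i)) \<longlonglongrightarrow> \<rho> + 0"
      by (intro tendsto_intros LIMSEQ_Suc[OF lim_1_over_n])
    then have "\<bar>x\<bar> \<le> \<rho> + 0" by (rule LIMSEQ_le_const) (use elim in \<open>auto intro: less_imp_le\<close>)
    then show ?case by simp
  qed
qed

section \<open>Ergodicity in spectral terms\<close>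

context reversible_kernel
begin

lemma op_pow_tv_bound_AE:
  assumes w: "w \<in> borel_measurable \<pi>" "\<And>x. x \<in> space \<pi> \<Longrightarrow> \<bar>w x\<bar> \<le> B"
  shows "AE x in \<pi>. \<forall>n. \<bar>(op ^^ n) w x - (\<integral>y. w y \<partial>\<pi>)\<bar> \<le> 2 * B * tv_dist (kernel_pow \<pi> K n x) \<pi>"
proof -
  have "AE x in \<pi>. \<forall>n. kernel_op (kernel_pow \<pi> K n) w x = (op ^^ n) w x"
    unfolding AE_all_countable by (intro allI kernel_op_pow_AE L2_integrable L2_bounded[OF w])
  then show ?thesis
    using AE_space
  proof eventually_elim
    case (elim x)
    show ?case
    proof
      fix n
      have k: "prob_space (kernel_pow \<pi> K n x)" "sets (kernel_pow \<pi> K n x) = sets \<pi>"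
        using measurable_space[OF measurable_kernel_pow[of n] elim(2)] by (simp_all add: space_prob_algebra)
      have sp: "space (kernel_pow \<pi> K n x) = space \<pi>" by (rule sets_eq_imp_space_eq[OF k(2)])
      have "\<bar>(\<integral>y. w y \<partial>kernel_pow \<pi> K n x) - (\<integral>y. w y \<partial>\<pi>)\<bar> \<le> 2 * B * tv_dist (kernel_pow \<pi> K n x) \<pi>"
        by (rule tv_dist_integral[OF k(1) prob_space_axioms k(2)[symmetric]])
           (use w in \<open>auto simp: measurable_cong_sets[OF k(2) refl] sp\<close>)
      then show "\<bar>(op ^^ n) w x - (\<integral>y. w y \<partial>\<pi>)\<bar> \<le> 2 * B * tv_dist (kernel_pow \<pi> K n x) \<pi>"
        using elim(1) by (simp add: kernel_op_def)
    qed
  qed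
qed

text \<open>
  By dominated convergence \<open>\<parallel>K\<^sup>n w\<parallel>\<^sup>2 = \<integral> x\<^bsup>2n\<^esup> dE\<close> tends to \<open>0\<close>, and it is at least \<open>E {1, -1}\<close>.
\<close>

lemma ergodic_no_atoms:
  assumes erg: "ergodic_kernel \<pi> K"
    and w: "w \<in> borel_measurable \<pi>" "\<And>x. x \<in> space \<pi> \<Longrightarrow> \<bar>w x\<bar> \<le> B" "(\<integral>x. w x \<partial>\<pi>) = 0"
    and E: "spectral w E"
  shows "AE x in E. \<bar>x\<bar> < 1"
proof -
  interpret E: finite_measure E by (rule spectral_finite[OF E])
  have w2: "w \<in> L2 \<pi>" by (rule L2_bounded[OF w(1,2)])
  have tv: "AE x in \<pi>. \<forall>n. \<bar>(op ^^ n) w x - (\<integral>y. w y \<partial>\<pi>)\<bar> \<le> 2 * B * tv_dist (kernel_pow \<pi> K n x) \<pi>"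
    by (rule op_pow_tv_bound_AE[OF w(1,2)])
  have "(\<lambda>n. \<integral>x. ((op ^^ n) w x)\<^sup>2 \<partial>\<pi>) \<longlonglongrightarrow> (\<integral>x. 0 \<partial>\<pi>)"
  proof (rule integral_dominated_convergence[where w="\<lambda>_. B\<^sup>2"])
    show "(\<lambda>x. ((op ^^ n) w x)\<^sup>2) \<in> borel_measurable \<pi>" for n using w(1) by measurable
    show "AE x in \<pi>. (\<lambda>n. ((op ^^ n) w x)\<^sup>2) \<longlonglongrightarrow> 0"
      using erg[unfolded ergodic_kernel_def] tv
    proof eventually_elim
      case (elim x)
      have "(\<lambda>n. 2 * B * tv_dist (kernel_pow \<pi> K n x) \<pi>) \<longlonglongrightarrow> 2 * B * 0"
        by (intro tendsto_intros elim)
      then have "(\<lambda>n. 2 * B * tv_dist (kernel_pow \<pi> K n x) \<pi>) \<longlonglongrightarrow> 0" by simp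
      then have "(\<lambda>n. (op ^^ n) w x) \<longlonglongrightarrow> 0"
        by (rule Lim_null_comparison[rotated]) (use elim w(3) in simp)
      from tendsto_power[OF this, of 2] show ?case by simp
    qed
    show "AE x in \<pi>. norm (((op ^^ n) w x)\<^sup>2) \<le> B\<^sup>2" for n
    proof (rule AE_I2)
      fix x assume "x \<in> space \<pi>"
      then have "\<bar>(op ^^ n) w x\<bar> \<le> B" using w(1,2) by (intro op_pow_bounded) auto
      from power_mono[OF this, of 2] show "norm (((op ^^ n) w x)\<^sup>2) \<le> B\<^sup>2" by simp
    qed
  qed simp_all
  moreover have "(\<integral>x. ((op ^^ n) w x)\<^sup>2 \<partial>\<pi>) = (\<integral>x. x ^ (2 * n) \<partial>E)" for n
    using ip_op_pow[OF w2 w2, of n n] spectral_moment[OF E, of "n + n"] by (simp add: ip_self mult_2)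
  ultimately have lim: "(\<lambda>n. \<integral>x. x ^ (2 * n) \<partial>E) \<longlonglongrightarrow> 0" by simp
  have one: "{1, -1} \<in> sets E" by (simp add: spectral_sets[OF E] sets_restrict_space_iff)
  have "measure E {1, -1} \<le> (\<integral>x. x ^ (2 * n) \<partial>E)" for n
  proof -
    have "measure E {1, -1} = (\<integral>x. indicator {1, -1} x \<partial>E)" using one by simp
    also have "\<dots> \<le> (\<integral>x. x ^ (2 * n) \<partial>E)"
    proof (rule integral_mono)
      show "integrable E (indicat_real {1, -1})" using one by (intro integrable_real_indicator) (simp_all add: E.emeasure_eq_measure)
      show "integrable E (\<lambda>x. x ^ (2 * n))" by (intro spectral_integrable[OF E] continuous_intros)
      show "indicator {1, -1} x \<le> x ^ (2 * n)" for x :: real by (auto simp: indicator_def zero_le_even_power)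
    qed
    finally show ?thesis .
  qed
  then have "measure E {1, -1} \<le> 0" by (intro LIMSEQ_le_const[OF lim]) auto
  then have "{1, -1} \<in> null_sets E" using one measure_nonneg[of E "{1, -1}"] by (simp add: null_sets_def E.emeasure_eq_measure)
  from AE_not_in[OF this] AE_space show ?thesis
    by eventually_elim (use spectral_space[OF E] in auto)
qed

lemma spectral_unique:
  assumes "spectral h E" "spectral h F" shows "E = F"
  using assms spectral_moment[OF assms(1)] spectral_moment[OF assms(2)]
  by (intro finite_measure_eqI_moments spectral_finite spectral_sets) auto

lemma mean_ergodic_kernel_mix:
  assumes erg: "ergodic_kernel \<pi> K" and m: "m > 0" "pmf \<mu> m > 0"
  shows "mean_ergodic_kernel \<pi> (kernel_mix \<pi> \<mu> K)"
proof -
  interpret mix: reversible_kernel \<pi> "kernel_mix \<pi> \<mu> K" by (rule reversible_kernel_mix)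
  show ?thesis
  proof
    fix w B E' assume w: "w \<in> borel_measurable \<pi>" "\<And>x. x \<in> space \<pi> \<Longrightarrow> \<bar>w x\<bar> \<le> B" "(\<integral>x. w x \<partial>\<pi>) = 0"
      and E': "mix.spectral w E'"
    have w2: "w \<in> L2 \<pi>" by (rule L2_bounded[OF w(1,2)])
    obtain E where E: "spectral w E" using spectral_exists[OF w2] by blast
    have E'_eq: "E' = distr E (restrict_space borel {-1..1}) (pgf \<mu>)"
      by (rule mix.spectral_unique[OF E' spectral_kernel_mix[OF w2 E]])
    have "AE x in E. \<bar>x\<bar> < 1" by (rule ergodic_no_atoms[OF erg w E])
    then have ne: "AE x in E. pgf \<mu> x \<noteq> 1"
    proof eventually_elim
      case (elim x)
      have "\<bar>x ^ m\<bar> < 1" using elim m by (simp add: power_abs power_less_one_iff)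
      then have "0 < pmf \<mu> m * (1 - x ^ m)" using m by (intro mult_pos_pos) auto
      then show ?case using one_minus_pgf_ge[of x \<mu> m] elim by simp
    qed
    show "AE x in E'. x \<noteq> 1"
      unfolding E'_eq by (rule iffD2[OF AE_distr_interval_ne[OF pgf_measurable_spectral[OF E]] ne])
  qed
qed

section \<open>Geometric ergodicity and the spectral gap\<close>

lemma op_pow_diff_AE:
  assumes a: "a \<in> L2 \<pi>" and b: "b \<in> L2 \<pi>"
  shows "AE x in \<pi>. (op ^^ n) (\<lambda>x. a x - b x) x = (op ^^ n) a x - (op ^^ n) b x"
proof (induction n)
  case (Suc n)
  have "AE x in \<pi>. op ((op ^^ n) (\<lambda>x. a x - b x)) x = op (\<lambda>x. (op ^^ n) a x - (op ^^ n) b x) x"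
    using Suc L2_measurable[OF a] L2_measurable[OF b] by (intro op_cong_AE) auto
  moreover have "AE x in \<pi>. op (\<lambda>x. (op ^^ n) a x - (op ^^ n) b x) x = op ((op ^^ n) a) x - op ((op ^^ n) b) x"
    by (intro op_diff_AE L2_integrable op_pow_L2 a b)
  ultimately show ?case by eventually_elim simp
qed simp

lemma ip_op_pow_le: "h \<in> L2 \<pi> \<Longrightarrow> ip \<pi> ((op ^^ n) h) ((op ^^ n) h) \<le> ip \<pi> h h"
proof (induction n)
  case (Suc n)
  then show ?case using ip_op_le[OF op_pow_L2[OF Suc.prems, of n]] by simp
qed simp

lemma integral_op_pow: "h \<in> L2 \<pi> \<Longrightarrow> (\<integral>x. (op ^^ n) h x \<partial>\<pi>) = (\<integral>x. h x \<partial>\<pi>)"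
  by (induction n) (simp_all add: integral_op[OF L2_integrable[OF op_pow_L2]])

text \<open>
  The function \<open>M\<close> and the total variation distance need not be measurable functions of the state.
  Therefore \<open>B\<close> is a measurable envelope of the set \<open>{M \<le> N}\<close>. For each fixed \<open>w\<close>, the states with the
  asserted decay form a measurable set that contains \<open>{M \<le> N}\<close> up to a null set, hence it contains
  the envelope up to a null set.
\<close>

lemma geometric_decay_on_envelope:
  fixes M :: "'a \<Rightarrow> ennreal"
  assumes \<rho>: "0 \<le> \<rho>" and tv: "AE x in \<pi>. \<forall>n. ennreal (tv_dist (kernel_pow \<pi> K n x) \<pi>) \<le> M x * ennreal (\<rho> ^ n)"
    and B: "measurable_envelope \<pi> {x \<in> space \<pi>. M x \<le> of_nat N} B"
    and w: "w \<in> borel_measurable \<pi>" "\<And>x. x \<in> space \<pi> \<Longrightarrow> \<bar>w x\<bar> \<le> C" and C: "0 \<le> C"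
  shows "AE x in \<pi>. x \<in> B \<longrightarrow> (\<forall>n. \<bar>(op ^^ n) w x - (\<integral>y. w y \<partial>\<pi>)\<bar> \<le> 2 * C * (real N * \<rho> ^ n))"
proof -
  define A where "A = {x \<in> space \<pi>. M x \<le> of_nat N}"
  define S where "S = {x \<in> space \<pi>. \<forall>n. \<bar>(op ^^ n) w x - (\<integral>y. w y \<partial>\<pi>)\<bar> \<le> 2 * C * (real N * \<rho> ^ n)}"
  note [measurable] = w(1)
  have S: "S \<in> sets \<pi>" unfolding S_def by measurable
  have tvw: "AE x in \<pi>. \<forall>n. \<bar>(op ^^ n) w x - (\<integral>y. w y \<partial>\<pi>)\<bar> \<le> 2 * C * tv_dist (kernel_pow \<pi> K n x) \<pi>"
    by (rule op_pow_tv_bound_AE[OF w])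
  have AS: "AE x in \<pi>. x \<in> A \<longrightarrow> x \<in> S"
    using tv tvw
  proof eventually_elim
    case (elim x)
    show ?case
    proof
      assume x: "x \<in> A"
      have "tv_dist (kernel_pow \<pi> K n x) \<pi> \<le> real N * \<rho> ^ n" for n
      proof -
        have "ennreal (tv_dist (kernel_pow \<pi> K n x) \<pi>) \<le> M x * ennreal (\<rho> ^ n)" using elim by blast
        also have "\<dots> \<le> of_nat N * ennreal (\<rho> ^ n)" using x by (intro mult_right_mono) (auto simp: A_def)
        also have "\<dots> = ennreal (real N * \<rho> ^ n)" using \<rho> by (simp add: ennreal_mult ennreal_of_nat_eq_real_of_nat)
        finally show ?thesis using \<rho> by (simp add: ennreal_le_iff)
      qed
      then have "2 * C * tv_dist (kernel_pow \<pi> K n x) \<pi> \<le> 2 * C * (real N * \<rho> ^ n)" for n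
        using C by (intro mult_left_mono) auto
      with elim(2) x show "x \<in> S" unfolding S_def A_def by (auto intro: order_trans)
    qed
  qed
  then obtain Z where Z: "{x \<in> space \<pi>. \<not> (x \<in> A \<longrightarrow> x \<in> S)} \<subseteq> Z" "Z \<in> null_sets \<pi>"
    by (auto simp: eventually_ae_filter)
  have env: "A \<subseteq> B" "B \<in> sets \<pi>" using measurable_envelopeD[OF B] by (simp_all add: A_def)
  have F: "B - S - Z \<in> sets \<pi>" using env S Z by auto
  have "B - S - Z \<subseteq> B - A" using Z(1) by (auto simp: A_def)
  with measurable_envelopeD1[OF B F] have "emeasure \<pi> (B - S - Z) = 0" by (simp add: A_def)
  then have "B - S - Z \<in> null_sets \<pi>" using F by auto
  from AE_not_in[OF this] AE_not_in[OF Z(2)] show ?thesis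
    by eventually_elim (auto simp: S_def)
qed

text \<open>
  Let \<open>k\<close> be \<open>g\<close> cut off outside \<open>B N\<close> and where \<open>|g|\<close> exceeds \<open>N\<close>, and \<open>w = k - \<pi> k\<close>. As \<open>k\<close> is supported where
  the decay is uniform, \<open>\<langle>w, K\<^sup>n w\<rangle> = \<langle>k, K\<^sup>n w\<rangle> = O(\<rho>\<^sup>n)\<close>. So the spectral measure of \<open>w\<close> lives on
  \<open>[-\<rho>, \<rho>]\<close>, and consequently \<open>\<parallel>K\<^sup>n w\<parallel> \<le> \<rho>\<^sup>n \<parallel>w\<parallel>\<close>: the constant depending on \<open>N\<close> has disappeared. Letting
  \<open>N\<close> tend to infinity gives \<open>\<parallel>K\<^sup>n g\<parallel>\<^sup>2 \<le> 4 \<rho>\<^bsup>2n\<^esup> \<parallel>g\<parallel>\<^sup>2\<close>, and the factor \<open>4\<close> is harmless for the support of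
  the spectral measure of \<open>g\<close>.
\<close>

lemma geometric_spectral_support:
  assumes geo: "geometrically_ergodic \<pi> K" and g: "g \<in> L2 \<pi>" "(\<integral>x. g x \<partial>\<pi>) = 0" and E: "spectral g E"
  obtains r where "0 \<le> r" "r < 1" "AE x in E. \<bar>x\<bar> \<le> r"
proof -
  obtain \<rho> and M :: "'a \<Rightarrow> ennreal" where \<rho>: "0 \<le> \<rho>" "\<rho> < 1" and M: "AE x in \<pi>. M x < \<infinity>"
    and tv: "AE x in \<pi>. \<forall>n. ennreal (tv_dist (kernel_pow \<pi> K n x) \<pi>) \<le> M x * ennreal (\<rho> ^ n)"
    using geo unfolding geometrically_ergodic_def by blast
  have "\<exists>B. measurable_envelope \<pi> {x \<in> space \<pi>. M x \<le> of_nat N} B" for N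
  proof -
    obtain B where B: "B \<in> sets \<pi>" "{x \<in> space \<pi>. M x \<le> of_nat N} \<subseteq> B"
      "outer_measure_of \<pi> {x \<in> space \<pi>. M x \<le> of_nat N} = emeasure \<pi> B"
      using outer_measure_of_attain[of "{x \<in> space \<pi>. M x \<le> of_nat N}" \<pi>] by auto
    have "emeasure \<pi> B < \<infinity>" by (simp add: emeasure_eq_measure)
    then show ?thesis using measurable_envelope_eq2[OF B(2,1)] B(3) by auto
  qed
  then obtain B where B: "\<And>N. measurable_envelope \<pi> {x \<in> space \<pi>. M x \<le> of_nat N} (B N)" by metis
  have B_sets [measurable]: "B N \<in> sets \<pi>" and B_sup: "{x \<in> space \<pi>. M x \<le> of_nat N} \<subseteq> B N" for N
    using measurable_envelopeD[OF B] by auto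
  note [measurable] = L2_measurable[OF g(1)]
  define k where "k N x = (if x \<in> B N \<and> \<bar>g x\<bar> \<le> real N then g x else 0)" for N x
  have k_meas [measurable]: "k N \<in> borel_measurable \<pi>" for N unfolding k_def[abs_def] by measurable
  have k_le: "\<bar>k N x\<bar> \<le> real N" for N x by (simp add: k_def)
  have k2: "k N \<in> L2 \<pi>" for N by (rule L2_bounded[OF k_meas k_le])
  define c where "c N = (\<integral>x. k N x \<partial>\<pi>)" for N
  have c_le: "\<bar>c N\<bar> \<le> real N" for N
  proof -
    have "\<bar>c N\<bar> \<le> (\<integral>x. \<bar>k N x\<bar> \<partial>\<pi>)" unfolding c_def by (rule integral_abs_bound)
    also have "\<dots> \<le> (\<integral>x. real N \<partial>\<pi>)" using L2_integrable[OF k2] k_le by (intro integral_mono) auto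
    finally show ?thesis using prob_space by simp
  qed
  define w where "w N x = k N x - c N" for N x
  have w_meas [measurable]: "w N \<in> borel_measurable \<pi>" for N unfolding w_def[abs_def] by measurable
  have w_le: "\<bar>w N x\<bar> \<le> 2 * real N" for N x using k_le[of N x] c_le[of N] unfolding w_def by linarith
  have w2: "w N \<in> L2 \<pi>" for N by (rule L2_bounded[OF w_meas w_le])
  have w_mean: "(\<integral>x. w N x \<partial>\<pi>) = 0" for N
    unfolding w_def using L2_integrable[OF k2[of N]] prob_space by (simp add: c_def)
  have decay: "ip \<pi> ((op ^^ n) (w N)) ((op ^^ n) (w N)) \<le> \<rho> ^ (2 * n) * ip \<pi> (w N) (w N)" for n N
  proof -
    have good: "AE x in \<pi>. x \<in> B N \<longrightarrow> (\<forall>n. \<bar>(op ^^ n) (w N) x - (\<integral>y. w N y \<partial>\<pi>)\<bar> \<le> 2 * (2 * real N) * (real N * \<rho> ^ n))"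
      by (rule geometric_decay_on_envelope[OF \<rho>(1) tv B w_meas w_le]) simp
    define C where "C = real N * (4 * real N * real N)"
    have small: "ip \<pi> (w N) ((op ^^ n) (w N)) \<le> C * \<rho> ^ n" for n
    proof -
      have wn2: "(op ^^ n) (w N) \<in> L2 \<pi>" by (rule op_pow_L2[OF w2])
      have "ip \<pi> (w N) ((op ^^ n) (w N)) = (\<integral>x. k N x * (op ^^ n) (w N) x - c N * (op ^^ n) (w N) x \<partial>\<pi>)"
        by (simp add: ip_def w_def left_diff_distrib)
      also have "\<dots> = (\<integral>x. k N x * (op ^^ n) (w N) x \<partial>\<pi>) - c N * (\<integral>x. (op ^^ n) (w N) x \<partial>\<pi>)"
        using L2_integrable_mult[OF k2[of N] wn2] L2_integrable[OF wn2] by simp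
      also have "\<dots> = (\<integral>x. k N x * (op ^^ n) (w N) x \<partial>\<pi>)"
        by (simp add: integral_op_pow[OF w2] w_mean)
      also have "\<dots> \<le> (\<integral>x. C * \<rho> ^ n \<partial>\<pi>)"
      proof (rule integral_mono_AE)
        show "integrable \<pi> (\<lambda>x. k N x * (op ^^ n) (w N) x)" by (rule L2_integrable_mult[OF k2 wn2])
        show "AE x in \<pi>. k N x * (op ^^ n) (w N) x \<le> C * \<rho> ^ n"
          using good
        proof eventually_elim
          case (elim x)
          show ?case
          proof (cases "x \<in> B N")
            case True
            have "k N x * (op ^^ n) (w N) x \<le> \<bar>k N x\<bar> * \<bar>(op ^^ n) (w N) x\<bar>"
              by (metis abs_ge_self abs_mult)
            also have "\<dots> \<le> real N * (2 * (2 * real N) * (real N * \<rho> ^ n))"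
              using elim True w_mean[of N] k_le[of N x] by (intro mult_mono) auto
            finally show ?thesis by (simp add: C_def mult_ac)
          next
            case False
            then show ?thesis using \<rho> by (simp add: k_def C_def)
          qed
        qed
      qed simp
      finally show ?thesis using prob_space by simp
    qed
    obtain F where F: "spectral (w N) F" using spectral_exists[OF w2] by blast
    have "AE x in F. \<bar>x\<bar> \<le> \<rho>"
      by (rule support_of_moment_bound[OF spectral_finite[OF F] spectral_sets[OF F] \<rho>(1)])
         (use small spectral_moment[OF F] in auto)
    then have "(\<integral>x. x ^ (2 * n) \<partial>F) \<le> (\<integral>x. \<rho> ^ (2 * n) * x ^ 0 \<partial>F)"
    proof (intro integral_mono_AE)
      assume "AE x in F. \<bar>x\<bar> \<le> \<rho>"
      then show "AE x in F. x ^ (2 * n) \<le> \<rho> ^ (2 * n) * x ^ 0"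
      proof eventually_elim
        case (elim x)
        from power_mono[OF this, of "2 * n"] show ?case by (simp add: power_even_abs)
      qed
    qed (intro spectral_integrable[OF F] continuous_intros)+
    also have "\<dots> = \<rho> ^ (2 * n) * ip \<pi> (w N) (w N)"
      unfolding integral_mult_right_zero using spectral_moment[OF F, of 0] by simp
    finally show ?thesis
      using spectral_moment[OF F, of "n + n"] ip_op_pow[OF w2 w2, of n N n N] by (simp add: mult_2)
  qed
  define \<delta> where "\<delta> N = (\<integral>x. (g x - k N x)\<^sup>2 \<partial>\<pi>)" for N
  have \<delta>_lim: "\<delta> \<longlonglongrightarrow> 0"
  proof -
    have "(\<lambda>N. \<integral>x. (g x - k N x)\<^sup>2 \<partial>\<pi>) \<longlonglongrightarrow> (\<integral>x. 0 \<partial>\<pi>)"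
    proof (rule integral_dominated_convergence[where w="\<lambda>x. (g x)\<^sup>2"])
      show "integrable \<pi> (\<lambda>x. (g x)\<^sup>2)" using g by (simp add: L2_def)
      show "AE x in \<pi>. (\<lambda>N. (g x - k N x)\<^sup>2) \<longlonglongrightarrow> 0"
        using M AE_space
      proof eventually_elim
        case (elim x)
        obtain N1 where N1: "\<bar>g x\<bar> \<le> real N1" using real_arch_simple by blast
        obtain N2 :: nat where N2: "M x \<le> of_nat N2"
          using elim(1) ennreal_Ex_less_of_nat[of "M x"] by (auto intro: less_imp_le)
        have "\<forall>\<^sub>F N in sequentially. (g x - k N x)\<^sup>2 = 0"
          using eventually_ge_at_top[of "max N1 N2"]
        proof eventually_elim
          case (elim N)
          have "M x \<le> of_nat N" using N2 elim by (meson max.bounded_iff of_nat_mono order_trans)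
          then have "x \<in> B N" using B_sup[of N] \<open>x \<in> space \<pi>\<close> by auto
          moreover have "\<bar>g x\<bar> \<le> real N" using N1 elim by simp
          ultimately show ?case by (simp add: k_def)
        qed
        then show "(\<lambda>N. (g x - k N x)\<^sup>2) \<longlonglongrightarrow> 0" by (rule tendsto_eventually)
      qed
    qed (auto simp: k_def)
    then show ?thesis by (simp add: \<delta>_def[abs_def])
  qed
  have gw2: "(\<lambda>x. g x - w N x) \<in> L2 \<pi>" for N by (rule L2_diff[OF g(1) w2])
  have gw: "ip \<pi> (\<lambda>x. g x - w N x) (\<lambda>x. g x - w N x) \<le> \<delta> N" for N
  proof -
    define d where "d x = g x - k N x" for x
    have d2: "d \<in> L2 \<pi>" unfolding d_def[abs_def] by (rule L2_diff[OF g(1) k2])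
    have "(\<integral>x. d x \<partial>\<pi>) = - c N"
      unfolding d_def using L2_integrable[OF g(1)] L2_integrable[OF k2] g(2) by (simp add: c_def)
    then have "variance d = (\<integral>x. (d x + c N)\<^sup>2 \<partial>\<pi>)" by simp
    then have "variance d = ip \<pi> (\<lambda>x. g x - w N x) (\<lambda>x. g x - w N x)"
      by (simp add: ip_self d_def w_def algebra_simps)
    moreover have "variance d = (\<integral>x. (d x)\<^sup>2 \<partial>\<pi>) - (\<integral>x. d x \<partial>\<pi>)\<^sup>2"
      using L2_integrable[OF d2] d2 by (intro variance_eq) (auto simp: L2_def)
    ultimately show ?thesis by (simp add: \<delta>_def d_def)
  qed
  have "(\<integral>x. x ^ (2 * n) \<partial>E) \<le> (4 * ip \<pi> g g) * \<rho> ^ (2 * n)" for n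
  proof -
    have le: "(\<integral>x. x ^ (2 * n) \<partial>E) \<le> 2 * (\<rho> ^ (2 * n) * (2 * ip \<pi> g g + 2 * \<delta> N)) + 2 * \<delta> N" for N
    proof -
      let ?v = "\<lambda>x. g x - w N x"
      have "(\<integral>x. x ^ (2 * n) \<partial>E) = ip \<pi> ((op ^^ n) g) ((op ^^ n) g)"
        using spectral_moment[OF E, of "n + n"] ip_op_pow[OF g(1) g(1), of n n] by (simp add: mult_2)
      also have "\<dots> = ip \<pi> (\<lambda>x. (op ^^ n) (w N) x + (op ^^ n) ?v x) (\<lambda>x. (op ^^ n) (w N) x + (op ^^ n) ?v x)"
      proof -
        have "AE x in \<pi>. (op ^^ n) g x = (op ^^ n) (w N) x + (op ^^ n) ?v x"
          using op_pow_diff_AE[OF g(1) w2[of N], of n] by eventually_elim simp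
        then show ?thesis
          using L2_measurable[OF gw2[of N]] by (intro ip_cong_AE borel_measurable_add op_pow_measurable) auto
      qed
      also have "\<dots> \<le> 2 * ip \<pi> ((op ^^ n) (w N)) ((op ^^ n) (w N)) + 2 * ip \<pi> ((op ^^ n) ?v) ((op ^^ n) ?v)"
        by (intro ip_add_le op_pow_L2 w2 gw2)
      also have "\<dots> \<le> 2 * (\<rho> ^ (2 * n) * ip \<pi> (w N) (w N)) + 2 * \<delta> N"
        using decay[of n N] ip_op_pow_le[OF gw2[of N], of n] gw[of N] by linarith
      also have "ip \<pi> (w N) (w N) \<le> 2 * ip \<pi> g g + 2 * \<delta> N"
      proof -
        have "ip \<pi> (w N) (w N) = ip \<pi> (\<lambda>x. g x + - 1 * ?v x) (\<lambda>x. g x + - 1 * ?v x)" by simp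
        also have "\<dots> \<le> 2 * ip \<pi> g g + 2 * ip \<pi> (\<lambda>x. - 1 * ?v x) (\<lambda>x. - 1 * ?v x)"
          by (intro ip_add_le g(1) L2_cmult gw2)
        also have "ip \<pi> (\<lambda>x. - 1 * ?v x) (\<lambda>x. - 1 * ?v x) = ip \<pi> ?v ?v"
          unfolding ip_def by (intro Bochner_Integration.integral_cong refl) (simp add: algebra_simps)
        finally show ?thesis using gw[of N] by linarith
      qed
      finally show ?thesis using \<rho>(1) by (simp add: mult_left_mono)
    qed
    have "(\<lambda>N. 2 * (\<rho> ^ (2 * n) * (2 * ip \<pi> g g + 2 * \<delta> N)) + 2 * \<delta> N) \<longlonglongrightarrow> 2 * (\<rho> ^ (2 * n) * (2 * ip \<pi> g g + 2 * 0)) + 2 * 0"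
      by (intro tendsto_intros \<delta>_lim)
    then have "(\<integral>x. x ^ (2 * n) \<partial>E) \<le> 2 * (\<rho> ^ (2 * n) * (2 * ip \<pi> g g + 2 * 0)) + 2 * 0"
      by (rule LIMSEQ_le_const) (use le in auto)
    then show ?thesis by (simp add: mult_ac)
  qed
  then have "AE x in E. \<bar>x\<bar> \<le> \<rho>"
    by (intro support_of_moment_bound[OF spectral_finite[OF E] spectral_sets[OF E] \<rho>(1)])
  with \<rho> show ?thesis by (rule that)
qed

section \<open>Integrability and the limit theorem for the mixture\<close>

text \<open>
  The integrals of \<open>T\<^sub>n\<close> over \<open>E\<close> are bounded. As \<open>T\<^sub>n(1) = n\<close>, there is no atom at \<open>1\<close>; elsewhere \<open>T\<^sub>n(x)\<close>
  tends to \<open>(1 + x) / (1 - x) = 2 / (1 - x) - 1\<close>, and Fatou's lemma applies.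
\<close>

lemma kipnis_varadhan_integrable:
  assumes f: "f \<in> L2 \<pi>" and kv: "kipnis_varadhan \<pi> K f" and E: "spectral (\<lambda>x. f x - (\<integral>x. f x \<partial>\<pi>)) E"
  shows "AE x in E. x \<noteq> 1" and "integrable E (\<lambda>x. 1 / (1 - x))"
proof -
  interpret E: finite_measure E by (rule spectral_finite[OF E])
  note meas = measurable_interval[OF spectral_sets[OF E]]
  define g where "g x = f x - (\<integral>x. f x \<partial>\<pi>)" for x
  have g2: "g \<in> L2 \<pi>" unfolding g_def[abs_def] by (intro L2_diff f L2_const)
  have Eg: "spectral g E" using E unfolding g_def[abs_def] .
  have "convergent (scaled_var g)"
    using kv unfolding kipnis_varadhan_def var_avg_eq[OF f] scaled_var_def[abs_def] g_def[abs_def] .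
  then obtain C where C: "\<And>n. \<bar>scaled_var g n\<bar> \<le> C" by (metis convergent_imp_Bseq Bseq_def real_norm_def)
  have T_int: "integrable E (toeplitz n)" for n by (intro spectral_integrable[OF E] continuous_intros)
  have T0: "0 \<le> toeplitz n x" if "x \<in> space E" for n x
    using that spectral_space[OF E] toeplitz_nonneg[of x n] by auto
  have T_le: "(\<integral>x. toeplitz n x \<partial>E) \<le> C" for n
    using C[of n] scaled_var_spectral[OF g2 Eg, of n] by simp
  have one: "{1} \<in> sets E" by (simp add: spectral_sets[OF E] sets_restrict_space_iff)
  have "real n * measure E {1} \<le> C" if "n > 0" for n
  proof -
    have "real n * measure E {1} = (\<integral>x. real n * indicator {1} x \<partial>E)" using one by simp
    also have "\<dots> \<le> (\<integral>x. toeplitz n x \<partial>E)"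
    proof (rule integral_mono)
      show "integrable E (\<lambda>x. real n * indicator {1} x)"
        using one by (intro integrable_mult_right integrable_real_indicator) (simp_all add: E.emeasure_eq_measure)
      show "real n * indicator {1} x \<le> toeplitz n x" if "x \<in> space E" for x
        using T0[OF that, of n] \<open>n > 0\<close> by (auto simp: indicator_def toeplitz_def)
    qed (rule T_int)
    finally show ?thesis using T_le[of n] by linarith
  qed
  note le = this
  have m1: "measure E {1} = 0"
  proof (rule ccontr)
    assume "measure E {1} \<noteq> 0"
    then have pos: "measure E {1} > 0" using measure_nonneg[of E "{1}"] by linarith
    then obtain n :: nat where "C < real n * measure E {1}" using reals_Archimedean3 by blast
    moreover have "real n * measure E {1} \<le> real (Suc n) * measure E {1}" by (intro mult_right_mono) auto
    ultimately show False using le[of "Suc n"] by simp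
  qed
  then have "{1} \<in> null_sets E" using one by (simp add: null_sets_def E.emeasure_eq_measure)
  from AE_not_in[OF this] show ne: "AE x in E. x \<noteq> 1" by eventually_elim simp
  have "(\<integral>\<^sup>+x. ennreal ((1 + x) / (1 - x)) \<partial>E) = (\<integral>\<^sup>+x. liminf (\<lambda>n. ennreal (toeplitz n x)) \<partial>E)"
  proof (rule nn_integral_cong_AE)
    show "AE x in E. ennreal ((1 + x) / (1 - x)) = liminf (\<lambda>n. ennreal (toeplitz n x))"
      using ne AE_space
    proof eventually_elim
      case (elim x)
      then have "(\<lambda>n. toeplitz n x) \<longlonglongrightarrow> (1 + x) / (1 - x)"
        using spectral_space[OF E] by (intro toeplitz_tendsto) auto
      from lim_imp_Liminf[OF sequentially_bot tendsto_ennrealI[OF this]] show ?case by simp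
    qed
  qed
  also have "\<dots> \<le> liminf (\<lambda>n. \<integral>\<^sup>+x. ennreal (toeplitz n x) \<partial>E)"
    using borel_measurable_integrable[OF T_int] by (intro nn_integral_liminf) simp
  also have "\<dots> \<le> ennreal C"
  proof -
    have "(\<integral>\<^sup>+x. ennreal (toeplitz n x) \<partial>E) \<le> ennreal C" for n
      using T_le[of n] T0 by (subst nn_integral_eq_integral[OF T_int]) (auto intro!: AE_I2 ennreal_leI)
    then show ?thesis by (intro Liminf_le) (auto intro: always_eventually)
  qed
  finally have fin: "(\<integral>\<^sup>+x. ennreal ((1 + x) / (1 - x)) \<partial>E) < \<infinity>"
    by (rule order.strict_trans1) simp
  have "integrable E (\<lambda>x. (1 + x) / (1 - x))"
  proof (rule integrableI_nonneg)
    show "(\<lambda>x. (1 + x) / (1 - x)) \<in> borel_measurable E" by (rule meas) measurable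
    show "AE x in E. 0 \<le> (1 + x) / (1 - x)"
      using AE_space by eventually_elim (use spectral_space[OF E] in auto)
  qed (rule fin)
  then have "integrable E (\<lambda>x. ((1 + x) / (1 - x) + 1) / 2)" by simp
  moreover have "AE x in E. ((1 + x) / (1 - x) + 1) / 2 = 1 / (1 - x)"
    using ne by eventually_elim (simp add: field_simps)
  moreover have "(\<lambda>x. 1 / (1 - x)) \<in> borel_measurable E" by (rule meas) measurable
  ultimately show "integrable E (\<lambda>x. 1 / (1 - x))"
    using integrable_cong_AE[of "\<lambda>x. ((1 + x) / (1 - x) + 1) / 2" E "\<lambda>x. 1 / (1 - x)"] by (metis borel_measurable_integrable)
qed

text \<open>
  In both cases \<open>1 / (1 - G\<^sub>\<mu>)\<close> is at most \<open>c + c / (1 - x)\<close> almost everywhere. For odd \<open>m\<close>, the gap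
  \<open>1 - x\<^sup>m\<close> is at least \<open>1\<close> for \<open>x \<le> 0\<close> and at least \<open>1 - x\<close> for \<open>x > 0\<close>. For even \<open>m\<close> it vanishes at \<open>-1\<close>, and
  one needs the spectral gap.
\<close>

lemma pgf_gap:
  assumes f: "f \<in> L2 \<pi>" and kv: "kipnis_varadhan \<pi> K f" and E: "spectral (\<lambda>x. f x - (\<integral>x. f x \<partial>\<pi>)) E"
    and m: "m > 0" "pmf \<mu> m > 0" and or: "odd m \<or> geometrically_ergodic \<pi> K"
  shows "AE x in E. pgf \<mu> x \<noteq> 1" and "integrable E (\<lambda>x. 1 / (1 - pgf \<mu> x))"
proof -
  interpret E: finite_measure E by (rule spectral_finite[OF E])
  note ne = kipnis_varadhan_integrable(1)[OF f kv E] and int = kipnis_varadhan_integrable(2)[OF f kv E]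
  define p where "p = pmf \<mu> m"
  have p: "p > 0" using m by (simp add: p_def)
  have gap: "\<exists>c. 0 \<le> c \<and> (AE x in E. 1 / (1 - pgf \<mu> x) \<le> c + c * (1 / (1 - x)) \<and> pgf \<mu> x < 1)"
  proof (cases "odd m")
    case True
    have "AE x in E. 1 / (1 - pgf \<mu> x) \<le> 1 / p + 1 / p * (1 / (1 - x)) \<and> pgf \<mu> x < 1"
      using ne AE_space
    proof eventually_elim
      case (elim x)
      then have x: "-1 \<le> x" "x < 1" using spectral_space[OF E] by auto
      define d where "d = (if x \<le> 0 then 1 else 1 - x)"
      have d: "d > 0" using x by (simp add: d_def)
      have "d \<le> 1 - x ^ m"
      proof (cases "x \<le> 0")
        case True
        then have "x ^ m \<le> 0" using \<open>odd m\<close> by (simp add: power_le_zero_eq odd_pos)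
        then show ?thesis using True by (simp add: d_def)
      next
        case False
        then have "x ^ m \<le> x ^ 1" using x m by (intro power_decreasing) auto
        then show ?thesis using False by (simp add: d_def)
      qed
      then have "p * d \<le> p * (1 - x ^ m)" using p by (intro mult_left_mono) auto
      also have "\<dots> \<le> 1 - pgf \<mu> x" using one_minus_pgf_ge[of x \<mu> m] x unfolding p_def by auto
      finally have le: "p * d \<le> 1 - pgf \<mu> x" .
      have pd: "0 < p * d" using p d by simp
      have "1 / (1 - pgf \<mu> x) \<le> 1 / (p * d)" using le pd by (intro frac_le) auto
      also have "\<dots> = 1 / p * (1 / d)" by simp
      also have "\<dots> \<le> 1 / p * (1 + 1 / (1 - x))"
        using p x by (intro mult_left_mono) (auto simp: d_def)
      also have "\<dots> = 1 / p + 1 / p * (1 / (1 - x))" by (simp only: distrib_left mult_1_right)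
      finally show ?case using le pd by linarith
    qed
    then show ?thesis using p by (intro exI[of _ "1 / p"]) auto
  next
    case False
    have g2: "(\<lambda>x. f x - (\<integral>x. f x \<partial>\<pi>)) \<in> L2 \<pi>" by (intro L2_diff f L2_const)
    have g0: "(\<integral>x. f x - (\<integral>x. f x \<partial>\<pi>) \<partial>\<pi>) = 0" using L2_integrable[OF f] prob_space by simp
    obtain r where r: "0 \<le> r" "r < 1" and supp: "AE x in E. \<bar>x\<bar> \<le> r"
      using geometric_spectral_support[OF _ g2 g0 E] or False by blast
    have "AE x in E. 1 / (1 - pgf \<mu> x) \<le> 1 / (p * (1 - r)) + 1 / (p * (1 - r)) * (1 / (1 - x)) \<and> pgf \<mu> x < 1"
      using supp
    proof eventually_elim
      case (elim x)
      have "\<bar>x\<bar> ^ m \<le> \<bar>x\<bar> ^ 1" using elim r m by (intro power_decreasing) auto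
      then have "x ^ m \<le> r" using elim by (simp add: power_abs[symmetric])
      then have "p * (1 - r) \<le> p * (1 - x ^ m)" using p by (intro mult_left_mono) auto
      also have "\<dots> \<le> 1 - pgf \<mu> x" using one_minus_pgf_ge[of x \<mu> m] elim r unfolding p_def by auto
      finally have "p * (1 - r) \<le> 1 - pgf \<mu> x" .
      moreover have pos: "0 < p * (1 - r)" using p r by simp
      ultimately have "1 / (1 - pgf \<mu> x) \<le> 1 / (p * (1 - r))" "pgf \<mu> x < 1" by (auto intro!: frac_le)
      moreover have "0 \<le> 1 / (p * (1 - r)) * (1 / (1 - x))" using pos elim r by (intro mult_nonneg_nonneg) auto
      ultimately show ?case by linarith
    qed
    then show ?thesis using p r by (intro exI[of _ "1 / (p * (1 - r))"]) auto
  qed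
  then obtain c where c: "0 \<le> c" "AE x in E. 1 / (1 - pgf \<mu> x) \<le> c + c * (1 / (1 - x)) \<and> pgf \<mu> x < 1" by blast
  from c(2) show "AE x in E. pgf \<mu> x \<noteq> 1" by eventually_elim auto
  have [measurable]: "pgf \<mu> \<in> borel_measurable E"
    using pgf_measurable_spectral[OF E, of \<mu>] by (simp add: measurable_restrict_space2_iff)
  show "integrable E (\<lambda>x. 1 / (1 - pgf \<mu> x))"
  proof (rule Bochner_Integration.integrable_bound)
    show "integrable E (\<lambda>x. c + c * (1 / (1 - x)))" using int by (intro Bochner_Integration.integrable_add integrable_mult_right) auto
    show "AE x in E. norm (1 / (1 - pgf \<mu> x)) \<le> norm (c + c * (1 / (1 - x)))"
      using c(2) by eventually_elim (auto simp: abs_le_iff intro: order_trans)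
  qed measurable
qed

end

theorem theorem2:
  fixes \<pi> :: "'a measure" and P :: "'a \<Rightarrow> 'a measure" and f :: "'a \<Rightarrow> real" and \<mu> :: "nat pmf"
  assumes "prob_space \<pi>"
    and "P \<in> \<pi> \<rightarrow>\<^sub>M prob_algebra \<pi>"
    and "\<pi> \<bind> P = \<pi>"
    and "reversible \<pi> P"
    and "ergodic_kernel \<pi> P"
    and "f \<in> borel_measurable \<pi>" and "integrable \<pi> (\<lambda>x. (f x)\<^sup>2)"
    and "kipnis_varadhan \<pi> P f"
    and "measure_pmf.prob \<mu> {k. odd k} > 0 \<or> pmf \<mu> 0 < 1 \<and> geometrically_ergodic \<pi> P"
  shows "let I = (\<integral>\<^sup>+x. ennreal (1 + pgf \<mu> x) / ennreal (1 - pgf \<mu> x) \<partial>spectral_measure \<pi> P f)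
         in I < \<infinity> \<and> clt_holds \<pi> (kernel_mix \<pi> \<mu> P) f (enn2real I)"
proof -
  interpret markov_kernel \<pi> P
    using assms(1-3) by (simp add: markov_kernel_def markov_kernel_axioms_def)
  interpret reversible_kernel \<pi> P
    by (rule reversible_imp_reversible_kernel[OF assms(4)])
  have f: "f \<in> L2 \<pi>" using assms(6,7) by (simp add: L2_def)
  define g where "g = (\<lambda>x. f x - (\<integral>x. f x \<partial>\<pi>))"
  have g2: "g \<in> L2 \<pi>" unfolding g_def by (intro L2_diff f L2_const)
  obtain m where m: "m > 0" "pmf \<mu> m > 0" and odd: "odd m \<or> geometrically_ergodic \<pi> P"
  proof (cases "measure_pmf.prob \<mu> {k. odd k} > 0")
    case True
    then have "set_pmf \<mu> \<inter> {k. odd k} \<noteq> {}" by (metis measure_Int_set_pmf measure_empty inf_commute less_irrefl)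
    then obtain m where "m \<in> set_pmf \<mu>" "odd m" by blast
    then show ?thesis by (intro that[of m]) (auto simp: pmf_positive_iff intro!: odd_pos)
  next
    case False
    then have 0: "pmf \<mu> 0 < 1" "geometrically_ergodic \<pi> P" using assms(9) by auto
    have "\<exists>m\<in>set_pmf \<mu>. m \<noteq> 0"
    proof (rule ccontr)
      assume "\<not> (\<exists>m\<in>set_pmf \<mu>. m \<noteq> 0)"
      then have "set_pmf \<mu> \<subseteq> {0}" by auto
      then have "\<mu> = return_pmf 0" by (simp add: set_pmf_subset_singleton)
      then show False using 0 by simp
    qed
    then show ?thesis using 0 that by (auto simp: pmf_positive_iff)
  qed
  obtain E where E: "spectral g E" using spectral_exists[OF g2] by blast
  have spec_iff: "is_spectral_measure \<pi> P f F \<longleftrightarrow> spectral g F" for F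
    by (auto simp: is_spectral_measure_def spectral_def Let_def ip_def g_def)
  have SE: "spectral_measure \<pi> P f = E"
    unfolding spectral_measure_def spec_iff using E spectral_unique by (intro the_equality) auto
  define E' where "E' = distr E (restrict_space borel {-1..1}) (pgf \<mu>)"
  interpret mix: mean_ergodic_kernel \<pi> "kernel_mix \<pi> \<mu> P"
    by (rule mean_ergodic_kernel_mix[OF assms(5) m])
  note G = pgf_measurable_spectral[OF E, of \<mu>]
  have [measurable]: "pgf \<mu> \<in> borel_measurable E" using G by (simp add: measurable_restrict_space2_iff)
  have E': "mix.spectral g E'" unfolding E'_def by (rule spectral_kernel_mix[OF g2 E])
  have ne: "AE x in E. pgf \<mu> x \<noteq> 1" and int: "integrable E (\<lambda>x. 1 / (1 - pgf \<mu> x))"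
    using pgf_gap[OF f assms(8) E[unfolded g_def] m odd] by auto
  have ne': "AE y in E'. y \<noteq> 1" unfolding E'_def using ne by (simp add: AE_distr_interval_ne[OF G])
  have meas: "(\<lambda>y. 1 / (1 - y)) \<in> borel_measurable (restrict_space borel {-1..1::real})"
    "(\<lambda>y. (1 + y) / (1 - y)) \<in> borel_measurable (restrict_space borel {-1..1::real})"
    by (rule measurable_restrict_space1, measurable)+
  have int': "integrable E' (\<lambda>y. 1 / (1 - y))"
    unfolding E'_def using int by (subst integrable_distr_eq[OF G meas(1)])
  define v where "v = (\<integral>y. (1 + y) / (1 - y) \<partial>E')"
  have clt: "clt_holds \<pi> (kernel_mix \<pi> \<mu> P) f v"
    unfolding v_def by (rule mix.clt_of_spectral[OF f E'[unfolded g_def] ne' int'])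
  have v_eq: "v = (\<integral>x. (1 + pgf \<mu> x) / (1 - pgf \<mu> x) \<partial>E)"
    unfolding v_def E'_def by (rule integral_distr[OF G meas(2)])
  have G_le: "AE x in E. \<bar>pgf \<mu> x\<bar> \<le> 1"
    using AE_space by eventually_elim (use spectral_space[OF E] in \<open>auto intro!: abs_pgf_le\<close>)
  have int_v: "integrable E (\<lambda>x. (1 + pgf \<mu> x) / (1 - pgf \<mu> x))"
  proof (rule Bochner_Integration.integrable_bound[OF integrable_mult_right[OF int, of 2]])
    show "AE x in E. norm ((1 + pgf \<mu> x) / (1 - pgf \<mu> x)) \<le> norm (2 * (1 / (1 - pgf \<mu> x)))"
      using G_le by eventually_elim (auto simp: abs_divide intro!: divide_right_mono)
  qed measurable
  have "(\<integral>\<^sup>+x. ennreal (1 + pgf \<mu> x) / ennreal (1 - pgf \<mu> x) \<partial>E) = (\<integral>\<^sup>+x. ennreal ((1 + pgf \<mu> x) / (1 - pgf \<mu> x)) \<partial>E)"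
    using ne G_le by (intro nn_integral_cong_AE) (auto elim!: eventually_elim2 simp: divide_ennreal abs_le_iff)
  also have "\<dots> = ennreal v"
  proof -
    have "AE x in E. 0 \<le> (1 + pgf \<mu> x) / (1 - pgf \<mu> x)"
      using G_le by eventually_elim (simp add: abs_le_iff)
    then show ?thesis unfolding v_eq by (rule nn_integral_eq_integral[OF int_v])
  qed
  finally have I: "(\<integral>\<^sup>+x. ennreal (1 + pgf \<mu> x) / ennreal (1 - pgf \<mu> x) \<partial>E) = ennreal v" .
  have "0 \<le> v" using clt by (simp add: clt_holds_def)
  then show ?thesis using clt by (simp add: SE I Let_def)
qed

end
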